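(* In the RoPE setup below, assume $\beta_nn^{-\alpha}\to\gamma\in(0,\infty)$. Let $\mathcal X$ be a Poisson point process on $\mathbb R_+$ with intensity $\overline\Lambda([0,y])=\overline C(q)(y/\gamma)^{1/\alpha}$ and atoms $0<Y_1<Y_2<\cdots$. Then for every fixed $k\ge1$, $(A_{(1)},\dots,A_{(k)})\to(W_1,\dots,W_k)$ in distribution, where $W_i=e^{-Y_i}/\sum_{j\ge1}e^{-Y_j}$.
   Context: RoPE setup: Let $d=2L\ge 2$, $\alpha=2/(d-1)$, $q\in\mathbb S^{d-1}\subset\mathbb R^d$ with surface measure $\sigma$. For frequencies $\vartheta_1,\dots,\vartheta_L\in\mathbb R$ let $r(\phi)=\begin{pmatrix}\cos\phi&-\sin\phi\\ \sin\phi&\cos\phi\end{pmatrix}$, $R_p=\mathrm{diag}(r(p\vartheta_1),\dots,r(p\vartheta_L))$, and $u_i=R_i^\top q$. Let $\mathbb T=\mathbb R/\mathbb Z$, $\theta=(\vartheta_l/2\pi)_{l}\in\mathbb T^L$, $\Phi_q(x)=\mathrm{diag}(r(-2\pi x_1),\dots,r(-2\pi x_L))q$, $\mathcal H_q=\overline{\{i\theta\bmod1:i\in\mathbb Z\}}$, $m_{\mathcal H_q}$ its Haar probability measure, $\pi_q=(\Phi_q)_\#m_{\mathcal H_q}$, and $\mathcal O_q=\overline{\{u_i:i\in\mathbb Z\}}$. Assumption: $(x_i)_{i\in\mathbb Z}$ is a stationary sequence in $\mathbb S^{d-1}$ such that (i) it is $m$-dependent for some integer $m\ge0$; (ii) $x_i$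 has density $\rho$ w.r.t. $\sigma$, continuous and strictly positive on a neighborhood of $\mathcal O_q$; (iii) for each $1\le\ell\le m$, $(x_0,x_\ell)$ has a density w.r.t. $\sigma\otimes\sigma$ bounded on a neighborhood of $\mathcal O_q\times\mathcal O_q$. Define $U_i=1-\langle u_i,x_i\rangle$, weights $A_i=e^{-\beta_nU_i}/\sum_{j=1}^ne^{-\beta_nU_j}$ ($1\le i\le n$) with decreasing rearrangement $A_{(1)}\ge\cdots\ge A_{(n)}$, and $\overline C(q)=\frac{2^{1/\alpha}\sigma_{d-2}}{d-1}\int_{\mathbb S^{d-1}}\rho(u)\,\pi_q(du)$, with $\sigma_{d-2}$ the surface area of $\mathbb S^{d-2}$. *)

theory Defs
  imports "HOL-Probability.Probability"
begin

text \<open>Vectors of R^d with d = 2L are represented as elements of real^2^'l,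
  where CARD('l) = L: coordinate block l is the 2-vector x$l.\<close>

definition dimd :: "'l::finite itself \<Rightarrow> nat" where
  "dimd _ = 2 * CARD('l)"

definition alphaR :: "'l::finite itself \<Rightarrow> real" where
  "alphaR t = 2 / (real (dimd t) - 1)"

definition rot2 :: "real \<Rightarrow> real^2 \<Rightarrow> real^2" where
  "rot2 \<phi> v = vector [cos \<phi> * v$1 - sin \<phi> * v$2, sin \<phi> * v$1 + cos \<phi> * v$2]"

text \<open>u_i = R_i^T q; since r(phi)^T = r(-phi), block l of u_i is r(-i vartheta_l) q_l.\<close>
definition rope_u :: "('l::finite \<Rightarrow> real) \<Rightarrow> real^2^'l \<Rightarrow> int \<Rightarrow> real^2^'l" where
  "rope_u freq q i = (\<chi> l. rot2 (- (of_int i * freq l)) (q$l))"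

definition orbit_closure :: "('l::finite \<Rightarrow> real) \<Rightarrow> real^2^'l \<Rightarrow> (real^2^'l) set" where
  "orbit_closure freq q = closure (range (rope_u freq q))"

text \<open>Surface measure on the unit sphere S^{d-1}: the cone measure,
  sigma(A) = d * Lebesgue({t x : x in A, 0 < t <= 1}), obtained as the push-forward
  of d * Lebesgue measure on the punctured unit ball under radial projection.\<close>
definition sphere_measure :: "(real^2^'l::finite) measure" where
  "sphere_measure = distr (density lborel
      (\<lambda>x. ennreal (real (dimd TYPE('l))) * indicator (cball 0 1 - {0}) x))
      borel (\<lambda>x. x /\<^sub>R norm x)"

text \<open>Surface area of the unit sphere S^{k-1} in R^k (so S^{d-2} is sphere_area (d-1)).\<close>
definition sphere_area :: "nat \<Rightarrow> real" where
  "sphere_area k = 2 * pi powr (real k / 2) / Gamma (real k / 2)"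

text \<open>The torus T^L = (R/Z)^L is represented, via x \<mapsto> (exp(2 pi i x_l))_l,
  as the compact group of vectors in complex^'l with unimodular entries
  under componentwise multiplication.\<close>
definition torus_pt :: "('l::finite \<Rightarrow> real) \<Rightarrow> complex^'l" where
  "torus_pt x = (\<chi> l. cis (2 * pi * x l))"

definition H_set :: "('l::finite \<Rightarrow> real) \<Rightarrow> (complex^'l) set" where
  "H_set freq = closure (range (\<lambda>i::int. torus_pt (\<lambda>l. of_int i * (freq l / (2 * pi)))))"

definition tmult :: "complex^'l::finite \<Rightarrow> complex^'l \<Rightarrow> complex^'l" where
  "tmult h z = (\<chi> l. h$l * z$l)"

definition haar_prob :: "(complex^'l::finite) set \<Rightarrow> (complex^'l) measure" where
  "haar_prob H = (THE m. sets m = sets borel \<and> prob_space m \<and> emeasure m H = 1 \<and>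
      (\<forall>h\<in>H. distr m borel (tmult h) = m))"

text \<open>Phi_q(x) = diag(r(-2 pi x_1), ..., r(-2 pi x_L)) q, written on the circle
  representation (z_l = exp(2 pi i x_l), so 2 pi x_l = Arg z_l mod 2 pi).\<close>
definition Phi_q :: "real^2^'l::finite \<Rightarrow> complex^'l \<Rightarrow> real^2^'l" where
  "Phi_q q z = (\<chi> l. rot2 (- Arg (z$l)) (q$l))"

definition pi_q :: "('l::finite \<Rightarrow> real) \<Rightarrow> real^2^'l \<Rightarrow> (real^2^'l) measure" where
  "pi_q freq q = distr (haar_prob (H_set freq)) borel (Phi_q q)"

definition Cbar :: "('l::finite \<Rightarrow> real) \<Rightarrow> real^2^'l \<Rightarrow> (real^2^'l \<Rightarrow> real) \<Rightarrow> real" where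
  "Cbar freq q \<rho> =
     2 powr (1 / alphaR TYPE('l)) * sphere_area (dimd TYPE('l) - 1) / (real (dimd TYPE('l)) - 1)
     * (\<integral>u. \<rho> u \<partial>pi_q freq q)"

definition U_val :: "('l::finite \<Rightarrow> real) \<Rightarrow> real^2^'l \<Rightarrow> (int \<Rightarrow> real^2^'l) \<Rightarrow> int \<Rightarrow> real" where
  "U_val freq q x i = 1 - inner (rope_u freq q i) (x i)"

definition A_weight :: "real \<Rightarrow> nat \<Rightarrow> ('l::finite \<Rightarrow> real) \<Rightarrow> real^2^'l \<Rightarrow> (int \<Rightarrow> real^2^'l) \<Rightarrow> nat \<Rightarrow> real" where
  "A_weight b n freq q x i =
     exp (- b * U_val freq q x (int i)) / (\<Sum>j=1..n. exp (- b * U_val freq q x (int j)))"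

definition desc_stat :: "real list \<Rightarrow> nat \<Rightarrow> real" where
  "desc_stat xs j = rev (sort xs) ! j"

definition poisson_pp_atoms :: "'v measure \<Rightarrow> (nat \<Rightarrow> 'v \<Rightarrow> real) \<Rightarrow> real measure \<Rightarrow> bool" where
  "poisson_pp_atoms N Y Lam \<longleftrightarrow> prob_space N \<and> (\<forall>i. Y i \<in> borel_measurable N) \<and>
     (\<forall>(r::nat) (B::nat \<Rightarrow> real set).
        (\<forall>j<r. B j \<in> sets borel \<and> emeasure Lam (B j) < \<infinity>) \<and> disjoint_family_on B {..<r} \<longrightarrow>
          (\<forall>j<r. AE \<omega> in N. finite {i. Y i \<omega> \<in> B j}) \<and>
          prob_space.indep_vars N (\<lambda>_. count_space UNIV) (\<lambda>j \<omega>. card {i. Y i \<omega> \<in> B j}) {..<r} \<and>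
          (\<forall>j<r. \<forall>c::nat. measure N {\<omega> \<in> space N. card {i. Y i \<omega> \<in> B j} = c}
                 = measure Lam (B j) ^ c / fact c * exp (- measure Lam (B j))))"

definition conv_distr :: "'w measure \<Rightarrow> (nat \<Rightarrow> 'w \<Rightarrow> 'b::topological_space) \<Rightarrow> 'v measure \<Rightarrow> ('v \<Rightarrow> 'b) \<Rightarrow> bool" where
  "conv_distr M Z N W \<longleftrightarrow>
     (\<forall>f::'b \<Rightarrow> real. continuous_on UNIV f \<and> bounded (range f) \<longrightarrow>
        (\<lambda>n. \<integral>\<omega>. f (Z n \<omega>) \<partial>M) \<longlonglongrightarrow> (\<integral>\<omega>. f (W \<omega>) \<partial>N))"

end

(* For cells of the rescaled losses beta_n U_i, the joint generating function of the cell counts is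
   E prod_i (1 - xi_i) with xi_i in [0,1]. By m-dependence, dropping the m preceding factors from the
   product makes it independent of xi_j, so telescoping replaces the expectation by prod_i (1 - E xi_i)
   up to O(sum over |i-j| <= m of E xi_i xi_j + E xi_i E xi_j) = O(1/n). Hence the counts converge to independent
   Poisson variables, whose means are the limits of sum_i P(beta_n U_i <= y): spherical cap asymptotics turn
   this sum into a Cesaro mean of rho along the orbit, and the orbit equidistributes for the Haar measure.
   The Haar measure is itself a weak limit of empirical measures on the orbit: a compact metric space is coded by
   real numbers with uniformly continuous decoding, so that Helly's theorem on the line applies.
   Finally, rounding the weights to finitely many levels changes the normalised order statistics by an
   arbitrarily small amount in mean, uniformly in n, and makes them functions of the cell counts. *)
theory Submission
  imports Defs
begin

subsection \<open>Weak limits of empirical measures on compact spaces\<close>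

text \<open>The obstacle is the denominator: it sums over all weights, while Poisson convergence
  only sees cells in a bounded range of losses. Two estimates close the gap. For large n, the
  expected total of the weights below exp (- K) is at most a constant times exp (- K / 2), because
  the expected number of scaled losses up to y grows only like y powr (1 / \<alpha>). And the
  largest weight falls below exp (- b) with asymptotic probability at most
  \<open>exp (- lam b)\<close>, so division by the sum is harmless. Both estimates hold for the
  Poisson process as well; hence the comparison is stated for a general random decreasing summable
  sequence, and finite samples are padded with zeros to fit it. The losses themselves need not be
  stationary, since u_i changes with i. Stationarity of the tokens serves to carry the joint density
  from the pair (0, l) to every pair (i, i + l), and compactness of the orbit closure makes all cap
  estimates uniform in i. Since \<open>haar_prob\<close> is a definite description, existence and
  uniqueness have to be proved before anything can be said about it.\<close>

lemma ternary_digits_eq: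
  fixes b b' :: "nat \<Rightarrow> bool"
  assumes less: "\<bar>(\<Sum>n. of_bool (b n) * (1/3)^n) - (\<Sum>n. of_bool (b' n) * (1/3)^n)\<bar> < (1/3)^N / (2::real)"
    and "n \<le> N"
  shows "b n = b' n"
proof (rule ccontr)
  assume neq: "b n \<noteq> b' n"
  \<comment> \<open>With digits 0 and 1 in base three, the first disagreement moves the sum by
    (1/3)^k and all later digits together by at most (1/3)^k / 2, so they cannot cancel it. In base
    two they could.\<close>
  define k where "k = (LEAST k. b k \<noteq> b' k)"
  have k: "b k \<noteq> b' k" unfolding k_def using neq by (rule LeastI)
  have kn: "k \<le> n" unfolding k_def using neq by (rule Least_le)
  have below: "b j = b' j" if "j < k" for j
    using that not_less_Least unfolding k_def by blast
  define d :: "nat \<Rightarrow> real" where "d j = (of_bool (b j) - of_bool (b' j)) * (1/3)^j" for j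
  have geo: "summable (\<lambda>n. (1/3::real)^n)" by simp
  have sm: "summable (\<lambda>n. of_bool (c n) * (1/3::real)^n)" for c :: "nat \<Rightarrow> bool"
    by (rule summable_comparison_test[OF _ geo]) (auto intro!: exI[of _ 0])
  have d_sum: "summable d" unfolding d_def left_diff_distrib by (intro summable_diff sm)
  have abs_d: "\<bar>d j\<bar> \<le> (1/3)^j" for j unfolding d_def by (auto simp: of_bool_def)
  have eq: "(\<Sum>n. of_bool (b n) * (1/3)^n) - (\<Sum>n. of_bool (b' n) * (1/3)^n) = suminf d"
    unfolding d_def left_diff_distrib by (rule suminf_diff[OF sm sm])
  have "suminf d = (\<Sum>j. d (j + Suc k)) + sum d {..<Suc k}"
    by (rule suminf_split_initial_segment[OF d_sum])
  moreover have "sum d {..<Suc k} = d k" using below by (simp add: d_def)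
  moreover have "\<bar>d k\<bar> = (1/3)^k" using k by (auto simp: d_def of_bool_def)
  moreover have "\<bar>\<Sum>j. d (j + Suc k)\<bar> \<le> (1/3)^k / 2"
  proof -
    have s: "summable (\<lambda>j. (1/3::real)^(j + Suc k))" using geo summable_ignore_initial_segment by blast
    have "summable (\<lambda>j. \<bar>d (j + Suc k)\<bar>)"
      by (rule summable_comparison_test[OF _ s]) (use abs_d in \<open>auto intro!: exI[of _ 0] simp del: power_Suc\<close>)
    then have "\<bar>\<Sum>j. d (j + Suc k)\<bar> \<le> (\<Sum>j. \<bar>d (j + Suc k)\<bar>)" by (rule summable_rabs)
    also have "\<dots> \<le> (\<Sum>j. (1/3::real)^(j + Suc k))"
      by (intro suminf_le abs_d \<open>summable (\<lambda>j. \<bar>d (j + Suc k)\<bar>)\<close> s)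
    also have "\<dots> = (\<Sum>j. (1/3::real)^j * (1/3)^Suc k)" by (simp only: power_add)
    also have "\<dots> = (\<Sum>j. (1/3::real)^j) * (1/3)^Suc k" by (rule suminf_mult2[symmetric, OF geo])
    also have "\<dots> = (1/3)^k / 2" by (simp add: suminf_geometric)
    finally show ?thesis .
  qed
  ultimately have "\<bar>suminf d\<bar> \<ge> (1/3)^k / 2" by linarith
  moreover have "(1/3::real)^N \<le> (1/3)^k" using kn \<open>n \<le> N\<close> by (intro power_decreasing) auto
  ultimately show False using less unfolding eq by linarith
qed

text \<open>The code of a point records, in base three, which basic open sets contain it.\<close>
lemma compact_real_code:
  fixes S :: "'a::{metric_space,second_countable_topology} set"
  assumes "compact S"
  obtains e :: "'a \<Rightarrow> real" where "\<And>x. 0 \<le> e x \<and> e x \<le> 3/2"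
    "\<And>\<epsilon>. \<epsilon> > 0 \<Longrightarrow> \<exists>\<delta>>0. \<forall>x\<in>S. \<forall>y\<in>S. \<bar>e x - e y\<bar> < \<delta> \<longrightarrow> dist x y < \<epsilon>"
proof -
  obtain \<B> :: "'a set set" where B: "countable \<B>" "topological_basis \<B>"
    using ex_countable_basis by blast
  obtain V :: "nat \<Rightarrow> 'a set" where V: "topological_basis (range V)"
  proof -
    have "\<B> \<noteq> {}" using topological_basisE[OF B(2) open_UNIV UNIV_I] by blast
    then have "range (from_nat_into \<B>) = \<B>" using B(1) by (rule range_from_nat_into)
    then show thesis using that[of "from_nat_into \<B>"] B(2) by simp
  qed
  define e :: "'a \<Rightarrow> real" where "e x = (\<Sum>n. of_bool (x \<in> V n) * (1/3)^n)" for x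
  have geo: "summable (\<lambda>n. (1/3::real)^n)" by simp
  have sm: "summable (\<lambda>n. of_bool (x \<in> V n) * (1/3::real)^n)" for x
    by (rule summable_comparison_test[OF _ geo]) (auto intro!: exI[of _ 0])
  show thesis
  proof
    fix x
    have "e x \<le> (\<Sum>n. (1/3::real)^n)" unfolding e_def
      by (intro suminf_le sm geo) auto
    also have "\<dots> = 3/2" by (simp add: suminf_geometric)
    finally show "0 \<le> e x \<and> e x \<le> 3/2" unfolding e_def by (auto intro!: suminf_nonneg sm)
  next
    fix \<epsilon> :: real assume eps: "\<epsilon> > 0"
    have "\<exists>n. x \<in> V n \<and> V n \<subseteq> ball x (\<epsilon>/2)" for x
    proof -
      have "x \<in> ball x (\<epsilon>/2)" using eps by simp
      from topological_basisE[OF V(1) open_ball this] obtain U where U: "U \<in> range V" "x \<in> U" "U \<subseteq> ball x (\<epsilon>/2)" .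
      obtain n where "U = V n" using U(1) by (rule rangeE)
      then show ?thesis using U(2,3) by (intro exI[of _ n]) simp
    qed
    then obtain n where n: "\<And>x. x \<in> V (n x)" "\<And>x. V (n x) \<subseteq> ball x (\<epsilon>/2)" by metis
    \<comment> \<open>By compactness finitely many of these small basic sets cover S, so agreement
      of the digits up to a fixed index N already forces two points of S into a common small
      set.\<close>
    have "S \<subseteq> (\<Union>x\<in>S. V (n x))" using n by auto
    moreover have "\<And>x. x \<in> S \<Longrightarrow> open (V (n x))" using V(1) topological_basis_open by blast
    ultimately obtain C where C: "C \<subseteq> S" "finite C" "S \<subseteq> (\<Union>x\<in>C. V (n x))"
      using compactE_image[OF assms, of S "\<lambda>x. V (n x)"] by metis
    define N where "N = Max (insert 0 (n ` C))"
    have N: "n c \<le> N" if "c \<in> C" for c unfolding N_def using that C(2) by (intro Max_ge) auto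
    have "dist x y < \<epsilon>" if xy: "x \<in> S" "y \<in> S" and less: "\<bar>e x - e y\<bar> < (1/3)^N/2" for x y
    proof -
      obtain c where c: "c \<in> C" "x \<in> V (n c)" using C xy by blast
      have "(x \<in> V (n c)) = (y \<in> V (n c))"
        using less N[OF c(1)] unfolding e_def by (rule ternary_digits_eq)
      then have "y \<in> V (n c)" using c by simp
      then have "dist c y < \<epsilon>/2" "dist c x < \<epsilon>/2" using c n(2)[of c] by auto
      then show ?thesis using dist_triangle_half_r by blast
    qed
    then show "\<exists>\<delta>>0. \<forall>x\<in>S. \<forall>y\<in>S. \<bar>e x - e y\<bar> < \<delta> \<longrightarrow> dist x y < \<epsilon>"
      by (intro exI[of _ "(1/3)^N/2"]) auto
  qed
qed

text \<open>The coded laws live on a bounded interval, so tightness is automatic. The code itself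
  may be discontinuous; only decoding is uniformly continuous, and it extends to the closure of the
  set of codes, which is where the limit law is carried and from where it is pushed back to S. Test
  functions are only asked to be continuous on S, because the ones used later are not known to be
  continuous elsewhere.\<close>

lemma empirical_measures_subseq_limit:
  fixes S :: "'a::euclidean_space set" and z :: "nat \<Rightarrow> 'a"
  assumes S: "compact S" and z: "\<And>i. z i \<in> S" and s: "strict_mono s"
  obtains r :: "nat \<Rightarrow> nat" and \<mu> :: "'a measure" where "strict_mono r" "prob_space \<mu>" "sets \<mu> = sets borel"
    "AE x in \<mu>. x \<in> S"
    "\<forall>f::'a \<Rightarrow> real. continuous_on S f \<longrightarrow> f \<in> borel_measurable borel \<longrightarrow>
       (\<lambda>n. (\<Sum>i<Suc (s (r n)). f (z i)) / real (Suc (s (r n)))) \<longlonglongrightarrow> integral\<^sup>L \<mu> f"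
proof -
  obtain e :: "'a \<Rightarrow> real" where e: "\<And>x. 0 \<le> e x \<and> e x \<le> 3/2"
    "\<And>\<epsilon>. \<epsilon> > 0 \<Longrightarrow> \<exists>\<delta>>0. \<forall>x\<in>S. \<forall>y\<in>S. \<bar>e x - e y\<bar> < \<delta> \<longrightarrow> dist x y < \<epsilon>"
    using compact_real_code[OF S] by metis
  have inj: "inj_on e S"
  proof (rule inj_onI, rule ccontr)
    fix x y assume xy: "x \<in> S" "y \<in> S" "e x = e y" "x \<noteq> y"
    then obtain \<delta> where "\<delta> > 0" "\<forall>x'\<in>S. \<forall>y'\<in>S. \<bar>e x' - e y'\<bar> < \<delta> \<longrightarrow> dist x' y' < dist x y"
      using e(2)[of "dist x y"] by auto
    then have "\<bar>e x - e y\<bar> < \<delta> \<longrightarrow> dist x y < dist x y" using xy by blast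
    then show False using xy \<open>\<delta> > 0\<close> by simp
  qed
  define D where "D = e ` S"
  have "uniformly_continuous_on D (inv_into S e)"
    unfolding uniformly_continuous_on_def D_def
  proof (intro allI impI)
    fix \<epsilon> :: real assume "\<epsilon> > 0"
    then obtain \<delta> where "\<delta> > 0" "\<forall>x\<in>S. \<forall>y\<in>S. \<bar>e x - e y\<bar> < \<delta> \<longrightarrow> dist x y < \<epsilon>"
      using e(2) by blast
    then show "\<exists>d>0. \<forall>x\<in>e ` S. \<forall>x'\<in>e ` S. dist x' x < d \<longrightarrow> dist (inv_into S e x') (inv_into S e x) < \<epsilon>"
      using inj by (auto simp: dist_real_def intro!: exI[of _ \<delta>])
  qed
  then obtain g where g: "uniformly_continuous_on (closure D) g" "\<And>x. x \<in> D \<Longrightarrow> inv_into S e x = g x"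
    using uniformly_continuous_on_extension_on_closure by metis
  have gc: "continuous_on (closure D) g" using g(1) uniformly_continuous_imp_continuous by blast
  have ge: "g (e x) = x" if "x \<in> S" for x
    using g(2)[of "e x"] that inj by (simp add: D_def)
  have gS: "g ` closure D \<subseteq> S"
    by (rule image_closure_subset[OF gc compact_imp_closed[OF S]]) (auto simp: D_def ge)
  \<comment> \<open>The law of the code at a uniformly chosen index; \<open>Suc n\<close> keeps the
    index set nonempty.\<close>
  define \<nu> where "\<nu> n = distr (measure_pmf (pmf_of_set {..<Suc n})) borel (\<lambda>i. e (z i))" for n
  have rd: "real_distribution (\<nu> n)" for n
    unfolding \<nu>_def by (intro prob_space.real_distribution_distr measure_pmf.prob_space_axioms) auto
  have int_nu: "integral\<^sup>L (\<nu> n) h = (\<Sum>i<Suc n. h (e (z i))) / real (Suc n)"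
    if "h \<in> borel_measurable borel" for h :: "real \<Rightarrow> real" and n
  proof -
    have "integral\<^sup>L (\<nu> n) h = integral\<^sup>L (measure_pmf (pmf_of_set {..<Suc n})) (\<lambda>i. h (e (z i)))"
      unfolding \<nu>_def by (rule integral_distr) (use that in auto)
    also have "\<dots> = (\<Sum>i<Suc n. h (e (z i))) / real (card {..<Suc n})"
      by (rule integral_pmf_of_set) auto
    finally show ?thesis by simp
  qed
  have "tight \<nu>" unfolding tight_def
  proof (intro conjI allI impI rd)
    fix \<epsilon> :: real assume "\<epsilon> > 0"
    have "measure (\<nu> n) {-1<..2} = 1" for n
    proof -
      have "(\<lambda>i. e (z i)) -` {-1<..2} = UNIV" 
      proof (intro equalityI subsetI UNIV_I vimageI2)
        fix i show "e (z i) \<in> {-1<..2}" using e(1)[of "z i"] by simp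
      qed
      then show ?thesis unfolding \<nu>_def by (subst measure_distr) auto
    qed
    then show "\<exists>a b. a < b \<and> (\<forall>n. 1 - \<epsilon> < measure (\<nu> n) {a<..b})"
      using \<open>\<epsilon> > 0\<close> by (intro exI[of _ "-1"] exI[of _ 2]) auto
  qed
  from tight_imp_convergent_subsubsequence[OF this s]
  obtain r M where r: "strict_mono r" and M: "real_distribution M" and wc: "weak_conv_m (\<nu> \<circ> s \<circ> r) M"
    by blast
  interpret M: real_distribution M by (rule M)
  have lim: "(\<lambda>n. (\<Sum>i<Suc (s (r n)). F (e (z i))) / real (Suc (s (r n)))) \<longlonglongrightarrow> integral\<^sup>L M F"
    if cF: "continuous_on UNIV F" and bF: "\<And>x. \<bar>F x\<bar> \<le> B" for F :: "real \<Rightarrow> real" and B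
  proof -
    have "(\<lambda>n. integral\<^sup>L ((\<nu> \<circ> s \<circ> r) n) F) \<longlonglongrightarrow> integral\<^sup>L M F"
      by (rule weak_conv_imp_integral_bdd_continuous_conv[OF _ M wc, of F B])
        (use rd cF bF in \<open>simp_all add: continuous_on_eq_continuous_at\<close>)
    then show ?thesis using int_nu[OF borel_measurable_continuous_onI[OF cF]]
      by (simp only: o_def)
  qed
  have zD: "e (z i) \<in> closure D" for i by (rule subsetD[OF closure_subset]) (simp add: D_def z)
  have DN: "closure D \<noteq> {}" using zD by auto
  \<comment> \<open>The truncated distance to \<open>closure D\<close> is a bounded continuous test
    function that vanishes at every code, so its integral against the limit law is zero.\<close>
  have AE_D: "AE x in M. x \<in> closure D"
  proof -
    define F where "F x = min 1 (infdist x (closure D))" for x :: real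
    have F: "continuous_on UNIV F" unfolding F_def by (intro continuous_intros)
    have Fn: "0 \<le> F x" "F x \<le> 1" for x unfolding F_def by (auto simp: infdist_nonneg)
    have "F (e (z i)) = 0" for i unfolding F_def using zD by simp
    moreover have "\<bar>F x\<bar> \<le> 1" for x using Fn[of x] by simp
    ultimately have "integral\<^sup>L M F = 0" using lim[OF F, of 1] by (simp add: LIMSEQ_const_iff)
    moreover have "integrable M F"
      using borel_measurable_continuous_onI[OF F] Fn by (intro M.integrable_const_bound[of _ 1]) simp_all
    ultimately have "AE x in M. F x = 0" using integral_nonneg_eq_0_iff_AE Fn by blast
    then show ?thesis
    proof eventually_elim
      case (elim x)
      then have "infdist x (closure D) = 0" unfolding F_def by (auto simp: min_def split: if_splits)
      then show ?case using in_closed_iff_infdist_zero[OF closed_closure DN] by blast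
    qed
  qed
  \<comment> \<open>The value off \<open>closure D\<close> is an arbitrary point of S; that set is
    null for the limit law.\<close>
  define g' where "g' x = (if x \<in> closure D then g x else z 0)" for x
  have g'm: "g' \<in> borel_measurable borel" unfolding g'_def
    by (intro borel_measurable_continuous_on_if gc) auto
  have g'M: "g' \<in> measurable M borel" using g'm by simp
  show thesis
  proof
    show "strict_mono r" by (rule r)
    show "prob_space (distr M borel g')" by (rule M.prob_space_distr[OF g'M])
    show "sets (distr M borel g') = sets borel" by simp
    show "AE x in distr M borel g'. x \<in> S"
    proof (subst AE_distr_iff[OF g'M])
      show "{x \<in> space borel. x \<in> S} \<in> sets borel" using S by (simp add: compact_imp_closed borel_closed)
      show "AE x in M. g' x \<in> S" using AE_D by eventually_elim (use gS in \<open>auto simp: g'_def\<close>)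
    qed
  next
    show "\<forall>f::'a \<Rightarrow> real. continuous_on S f \<longrightarrow> f \<in> borel_measurable borel \<longrightarrow>
       (\<lambda>n. (\<Sum>i<Suc (s (r n)). f (z i)) / real (Suc (s (r n)))) \<longlonglongrightarrow> integral\<^sup>L (distr M borel g') f"
    proof (intro allI impI)
    fix f :: "'a \<Rightarrow> real" assume f: "continuous_on S f" "f \<in> borel_measurable borel"
    have cfg: "continuous_on (closure D) (f \<circ> g)"
      by (rule continuous_on_compose[OF gc continuous_on_subset[OF f(1) gS]])
    obtain B where B: "B \<ge> 0" "\<And>x. x \<in> S \<Longrightarrow> \<bar>f x\<bar> \<le> B"
    proof -
      obtain B where "\<forall>y\<in>f ` S. norm y \<le> B"
        using compact_imp_bounded[OF compact_continuous_image[OF f(1) S]] unfolding bounded_iff by blast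
      then have "\<bar>f x\<bar> \<le> \<bar>B\<bar>" if "x \<in> S" for x
        using that by (metis abs_ge_self image_eqI order_trans real_norm_def)
      then show thesis by (intro that[of "\<bar>B\<bar>"]) auto
    qed
    \<comment> \<open>Weak convergence tests functions on the whole line, so the decoded test
      function has to be extended from \<open>closure D\<close> with the same bound.\<close>
    obtain F where F: "continuous_on UNIV F" "\<And>x. x \<in> closure D \<Longrightarrow> F x = (f \<circ> g) x" "\<And>x. norm (F x) \<le> B"
    proof (rule Tietze[OF cfg, of UNIV B])
      fix x assume "x \<in> closure D"
      then show "norm ((f \<circ> g) x) \<le> B" using B(2)[of "g x"] gS by auto
    qed (use B(1) in auto)
    have "(\<lambda>n. (\<Sum>i<Suc (s (r n)). F (e (z i))) / real (Suc (s (r n)))) \<longlonglongrightarrow> integral\<^sup>L M F"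
      by (rule lim[OF F(1)]) (use F(3) in auto)
    moreover have "F (e (z i)) = f (z i)" for i using F(2)[OF zD] ge z by simp
    moreover have "integral\<^sup>L M F = integral\<^sup>L (distr M borel g') f"
      unfolding integral_distr[OF g'M f(2)]
    proof (rule integral_cong_AE)
      show "F \<in> borel_measurable M" using borel_measurable_continuous_onI[OF F(1)] by simp
      show "(\<lambda>x. f (g' x)) \<in> borel_measurable M" by (rule measurable_compose[OF g'M f(2)])
      show "AE x in M. F x = f (g' x)" using AE_D by eventually_elim (simp add: F(2) g'_def)
    qed
    ultimately show "(\<lambda>n. (\<Sum>i<Suc (s (r n)). f (z i)) / real (Suc (s (r n)))) \<longlonglongrightarrow> integral\<^sup>L (distr M borel g') f"
      by simp
    qed
  qed
qed

subsection \<open>Haar measure on the orbit closure\<close>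

text \<open>Closed sets form an intersection-stable generator, and the indicator of a nonempty
  closed set is the pointwise limit of the continuous cutoffs 1 - n * dist (x, C), truncated at
  0.\<close>

lemma prob_measure_eqI_continuous:
  fixes \<mu> \<nu> :: "'a::metric_space measure"
  assumes \<mu>: "prob_space \<mu>" "sets \<mu> = sets borel" and \<nu>: "prob_space \<nu>" "sets \<nu> = sets borel"
    and eq: "\<And>f::'a \<Rightarrow> real. continuous_on UNIV f \<Longrightarrow> (\<And>x. 0 \<le> f x \<and> f x \<le> 1) \<Longrightarrow> integral\<^sup>L \<mu> f = integral\<^sup>L \<nu> f"
  shows "\<mu> = \<nu>"
proof (rule measure_eqI_generator_eq[where E="Collect closed" and \<Omega>=UNIV and A="\<lambda>_. UNIV"])
  show "Int_stable (Collect closed :: 'a set set)" by (auto simp: Int_stable_def)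
  show "sets \<mu> = sigma_sets UNIV (Collect closed)" "sets \<nu> = sigma_sets UNIV (Collect closed)"
    using \<mu> \<nu> by (auto simp: borel_eq_closed)
  show "emeasure \<mu> UNIV \<noteq> \<infinity>" for i :: nat
    using prob_space.emeasure_space_1[OF \<mu>(1)] sets_eq_imp_space_eq[OF \<mu>(2)] by simp
next
  fix C :: "'a set" assume "C \<in> Collect closed"
  then have C: "closed C" by simp
  show "emeasure \<mu> C = emeasure \<nu> C"
  proof (cases "C = {}")
    case False
    define f where "f n x = max 0 (1 - real n * infdist x C)" for n and x :: 'a
    have fc: "continuous_on UNIV (f n)" for n unfolding f_def by (intro continuous_intros)
    have f01: "0 \<le> f n x \<and> f n x \<le> 1" for n x unfolding f_def using infdist_nonneg[of x C] by auto
    have lim: "(\<lambda>n. f n x) \<longlonglongrightarrow> indicator C x" for x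
    proof (cases "x \<in> C")
      case True then show ?thesis by (simp add: f_def)
    next
      case nx: False
      then have pos: "infdist x C > 0"
        using in_closed_iff_infdist_zero[OF C False] infdist_nonneg[of x C] by (simp add: less_le)
      obtain N :: nat where N: "1 < real N * infdist x C" using reals_Archimedean3[OF pos] by blast
      have "f n x = 0" if "n \<ge> N" for n
      proof -
        have "real N * infdist x C \<le> real n * infdist x C" using that pos by simp
        then show ?thesis using N unfolding f_def by simp
      qed
      then have "eventually (\<lambda>n. f n x = indicator C x) sequentially"
        using nx by (auto simp: eventually_sequentially)
      then show ?thesis by (rule tendsto_eventually)
    qed
    have conv: "(\<lambda>n. integral\<^sup>L m (f n)) \<longlonglongrightarrow> measure m C" if "prob_space m" "sets m = sets borel" for m
    proof -
      interpret m: prob_space m by fact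
      have "(\<lambda>n. integral\<^sup>L m (f n)) \<longlonglongrightarrow> integral\<^sup>L m (indicator C)"
      proof (rule integral_dominated_convergence[where w="\<lambda>_. 1"])
        show "indicator C \<in> borel_measurable m" using C that(2) by (intro borel_measurable_indicator) (simp add: borel_closed)
        show "f n \<in> borel_measurable m" for n
          using borel_measurable_continuous_onI[OF fc[of n]] that(2) by (simp cong: measurable_cong_sets)
        show "AE x in m. norm (f n x) \<le> 1" for n using f01 by auto
      qed (use lim in auto)
      moreover have "C \<inter> space m = C" using sets_eq_imp_space_eq[OF that(2)] by simp
      ultimately show ?thesis by simp
    qed
    have "measure \<mu> C = measure \<nu> C"
      using LIMSEQ_unique[OF conv[OF \<mu>]] conv[OF \<nu>] eq[OF fc f01] by simp
    then show ?thesis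
      using prob_space.finite_measure[OF \<mu>(1)] prob_space.finite_measure[OF \<nu>(1)]
      by (simp add: finite_measure.emeasure_eq_measure)
  qed simp
qed auto

lemma tmult_assoc: "tmult (tmult a b) c = tmult a (tmult b c)"
  by (simp add: tmult_def vec_eq_iff mult.assoc)

lemma tmult_commute: "tmult a b = tmult b a"
  by (simp add: tmult_def vec_eq_iff mult.commute)

lemma continuous_on_tmult [continuous_intros]:
  "continuous_on S f \<Longrightarrow> continuous_on S g \<Longrightarrow> continuous_on S (\<lambda>x. tmult (f x) (g x))"
  unfolding tmult_def by (auto intro!: continuous_on_vec_lambda continuous_on_mult continuous_on_component)

lemma measurable_tmult_pair [measurable]: "(\<lambda>p. tmult (fst p) (snd p)) \<in> borel_measurable (borel \<Otimes>\<^sub>M borel)"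
  by (subst borel_prod) (intro borel_measurable_continuous_onI continuous_intros)

lemma measurable_tmult [measurable]: "tmult h \<in> borel_measurable borel"
  by (intro borel_measurable_continuous_onI continuous_intros)

context
  fixes freq :: "'l::finite \<Rightarrow> real"
begin

definition rope_gen :: "int \<Rightarrow> complex^'l" where
  "rope_gen i = torus_pt (\<lambda>l. of_int i * (freq l / (2 * pi)))"

lemma rope_gen_nth: "rope_gen i $ l = cis (of_int i * freq l)"
  by (simp add: rope_gen_def torus_pt_def)

lemma H_set_eq: "H_set freq = closure (range rope_gen)"
  by (simp add: H_set_def rope_gen_def)

lemma rope_gen_add: "rope_gen (i + j) = tmult (rope_gen i) (rope_gen j)"
  by (simp add: vec_eq_iff tmult_def rope_gen_nth cis_mult ring_distribs)

lemma rope_gen_0: "tmult (rope_gen 0) x = x"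
  by (simp add: vec_eq_iff tmult_def rope_gen_nth)

lemma rope_gen_in_H: "rope_gen i \<in> H_set freq"
  unfolding H_set_eq by (rule subsetD[OF closure_subset]) simp

lemma H_set_norm_nth: "z \<in> H_set freq \<Longrightarrow> norm (z $ l) = 1"
proof -
  assume z: "z \<in> H_set freq"
  have "closed {z::complex^'l. norm (z $ l) = 1}"
    by (intro closed_Collect_eq continuous_intros)
  then have "H_set freq \<subseteq> {z. norm (z $ l) = 1}"
    unfolding H_set_eq by (intro closure_minimal) (auto simp: rope_gen_nth)
  then show ?thesis using z by auto
qed

lemma compact_H_set: "compact (H_set freq)"
proof -
  have "norm z \<le> real CARD('l)" if "z \<in> H_set freq" for z
  proof -
    have "norm z \<le> (\<Sum>l\<in>UNIV. norm (z $ l))" unfolding norm_vec_def by (rule L2_set_le_sum) simp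
    then show ?thesis using H_set_norm_nth[OF that] by simp
  qed
  then show ?thesis unfolding compact_eq_bounded_closed bounded_iff by (auto simp: H_set_eq)
qed

text \<open>The property under the definite description in \<open>haar_prob\<close>; once a measure
  with it is known to exist and to be unique, that description denotes it.\<close>

definition haar_like :: "(complex^'l) measure \<Rightarrow> bool" where
  "haar_like m \<longleftrightarrow> sets m = sets borel \<and> prob_space m \<and> emeasure m (H_set freq) = 1 \<and>
      (\<forall>h\<in>H_set freq. distr m borel (tmult h) = m)"

lemma H_set_borel: "H_set freq \<in> sets borel"
  by (simp add: H_set_eq borel_closed)

lemma haar_like_AE:
  assumes "haar_like m" shows "AE x in m. x \<in> H_set freq"
  using assms unfolding haar_like_def by (intro prob_space.AE_prob_1) (simp_all add: measure_def)

text \<open>Both measures equal their convolution, since the group is commutative.\<close>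
lemma haar_like_unique:
  assumes m: "haar_like m" and m': "haar_like m'"
  shows "m = m'"
proof (rule measure_eqI)
  have s: "sets m = sets borel" "sets m' = sets borel" and p: "prob_space m" "prob_space m'"
    using m m' by (auto simp: haar_like_def)
  interpret m: prob_space m by (rule p)
  interpret m': prob_space m' by (rule p)
  interpret pair_sigma_finite m m' ..
  show "sets m = sets m'" using s by simp
  fix A assume A0: "A \<in> sets m"
  then have A: "A \<in> sets borel" using s by simp
  have inv: "(\<integral>\<^sup>+x. indicator A (tmult h x) \<partial>k) = emeasure k A" if "haar_like k" "h \<in> H_set freq" for k h
  proof -
    have "(\<integral>\<^sup>+x. indicator A (tmult h x) \<partial>k) = (\<integral>\<^sup>+x. indicator A x \<partial>distr k borel (tmult h))"
      using that A by (subst nn_integral_distr) (auto simp: haar_like_def measurable_tmult cong: measurable_cong_sets)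
    also have "\<dots> = emeasure k A" using that A by (simp add: haar_like_def)
    finally show ?thesis .
  qed
  have meas: "(\<lambda>(x, y). indicator A (tmult x y) :: ennreal) \<in> borel_measurable (m \<Otimes>\<^sub>M m')"
  proof -
    have "(\<lambda>p. tmult (fst p) (snd p)) \<in> borel_measurable (m \<Otimes>\<^sub>M m')"
      using measurable_tmult_pair s by (simp cong: measurable_cong_sets sets_pair_measure_cong)
    then show ?thesis using A by (simp add: case_prod_beta)
  qed
  have "emeasure m A = (\<integral>\<^sup>+y. emeasure m A \<partial>m')" using m'.emeasure_space_1 by simp
  also have "\<dots> = (\<integral>\<^sup>+y. (\<integral>\<^sup>+x. indicator A (tmult x y) \<partial>m) \<partial>m')"
    by (rule nn_integral_cong_AE) (use haar_like_AE[OF m'] inv[OF m] in \<open>auto simp: tmult_commute\<close>)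
  also have "\<dots> = (\<integral>\<^sup>+x. (\<integral>\<^sup>+y. indicator A (tmult x y) \<partial>m') \<partial>m)"
    using Fubini'[OF meas] .
  also have "\<dots> = (\<integral>\<^sup>+x. emeasure m' A \<partial>m)"
    by (rule nn_integral_cong_AE) (use haar_like_AE[OF m] inv[OF m'] in auto)
  also have "\<dots> = emeasure m' A" using m.emeasure_space_1 by simp
  finally show "emeasure m A = emeasure m' A" .
qed

text \<open>The Krylov-Bogolyubov construction. A weak limit of the orbit averages is invariant
  under the generator, hence under all its integer powers, and by dominated convergence under limits
  of these. The subsequence \<open>s\<close> is arbitrary, because convergence of the full averages
  is later obtained from subsequences.\<close>

lemma haar_like_cesaro_subseq:
  assumes s: "strict_mono s"
  obtains r :: "nat \<Rightarrow> nat" and \<mu> where "strict_mono r" "haar_like \<mu>"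
    "\<forall>f::complex^'l \<Rightarrow> real. continuous_on (H_set freq) f \<longrightarrow> f \<in> borel_measurable borel \<longrightarrow>
       (\<lambda>n. (\<Sum>i<Suc (s (r n)). f (rope_gen (int (Suc i)))) / real (Suc (s (r n)))) \<longlonglongrightarrow> integral\<^sup>L \<mu> f"
proof -
  obtain r \<mu> where r: "strict_mono r" and p: "prob_space \<mu>" and sb: "sets \<mu> = sets borel"
    and AE_H: "AE x in \<mu>. x \<in> H_set freq" and lim0: "\<forall>f::complex^'l \<Rightarrow> real. continuous_on (H_set freq) f \<longrightarrow> f \<in> borel_measurable borel \<longrightarrow>
       (\<lambda>n. (\<Sum>i<Suc (s (r n)). f (rope_gen (int (Suc i)))) / real (Suc (s (r n)))) \<longlonglongrightarrow> integral\<^sup>L \<mu> f"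
    using empirical_measures_subseq_limit[OF compact_H_set, of "\<lambda>i. rope_gen (int (Suc i))", OF rope_gen_in_H s] by blast
  note lim = lim0[rule_format]
  interpret prob_space \<mu> by (rule p)
  have tm: "tmult h \<in> measurable \<mu> borel" for h using sb by (simp cong: measurable_cong_sets)
  define G where "G = {h. distr \<mu> borel (tmult h) = \<mu>}"
  have G_mult: "tmult a b \<in> G" if "a \<in> G" "b \<in> G" for a b
  proof -
    have "distr \<mu> borel (tmult (tmult a b)) = distr \<mu> borel (tmult a \<circ> tmult b)"
      by (rule arg_cong[where f="distr \<mu> borel"]) (simp add: fun_eq_iff tmult_assoc)
    also have "\<dots> = distr (distr \<mu> borel (tmult b)) borel (tmult a)"
      by (rule distr_distr[OF measurable_tmult tm, symmetric])
    finally show ?thesis using that by (simp add: G_def)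
  qed
  have G_1: "rope_gen 1 \<in> G" unfolding G_def mem_Collect_eq
  proof (rule prob_measure_eqI_continuous)
    fix f :: "complex^'l \<Rightarrow> real" assume f: "continuous_on UNIV f" and f01: "\<And>x. 0 \<le> f x \<and> f x \<le> 1"
    let ?N = "\<lambda>n. real (Suc (s (r n)))"
    have fm: "f \<in> borel_measurable borel" using f by (rule borel_measurable_continuous_onI)
    have fc: "continuous_on UNIV (\<lambda>x. f (tmult (rope_gen 1) x))"
      by (intro continuous_on_compose2[OF f] continuous_intros) auto
    define a where "a n = (\<Sum>i<Suc (s (r n)). f (rope_gen (int (Suc i)))) / ?N n" for n
    define b where "b n = (\<Sum>i<Suc (s (r n)). f (tmult (rope_gen 1) (rope_gen (int (Suc i))))) / ?N n" for n
    have l1: "a \<longlonglongrightarrow> integral\<^sup>L \<mu> f" unfolding a_def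
      by (intro lim continuous_on_subset[OF f] fm) auto
    have l2: "b \<longlonglongrightarrow> (\<integral>x. f (tmult (rope_gen 1) x) \<partial>\<mu>)" unfolding b_def
      by (rule lim[OF continuous_on_subset[OF fc]]) (auto intro: borel_measurable_continuous_onI[OF fc])
    \<comment> \<open>Multiplication by the generator shifts the index by one, so the two sums
      differ only by boundary terms with values in [0, 1].\<close>
    have tele: "(\<Sum>i<N. f (tmult (rope_gen 1) (rope_gen (int (Suc i))))) - (\<Sum>i<N. f (rope_gen (int (Suc i))))
        = f (rope_gen (int (Suc N))) - f (rope_gen 1)" for N
      unfolding sum_subtractf[symmetric] rope_gen_add[symmetric]
      using sum_lessThan_telescope[of "\<lambda>i. f (rope_gen (int (Suc i)))" N] by (simp add: add.commute)
    have bound: "\<bar>f (rope_gen (int (Suc N))) - f (rope_gen 1)\<bar> \<le> 1" for N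
      using f01[of "rope_gen (int (Suc N))"] f01[of "rope_gen 1"] by linarith
    have l3: "(\<lambda>n. 1 / ?N n) \<longlonglongrightarrow> 0"
    proof -
      have "(\<lambda>n. 1 / real (Suc n)) \<longlonglongrightarrow> 0" using LIMSEQ_inverse_real_of_nat by (simp add: inverse_eq_divide)
      from LIMSEQ_subseq_LIMSEQ[OF LIMSEQ_subseq_LIMSEQ[OF this s] r] show ?thesis by (simp add: o_def)
    qed
    have "norm (b n - a n) \<le> 1 / ?N n" for n
    proof -
      have "norm (b n - a n) = \<bar>f (rope_gen (int (Suc (Suc (s (r n)))))) - f (rope_gen 1)\<bar> / ?N n"
        unfolding a_def b_def diff_divide_distrib[symmetric] tele by simp
      also have "\<dots> \<le> 1 / ?N n" by (rule divide_right_mono[OF bound]) simp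
      finally show ?thesis .
    qed
    then have "(\<lambda>n. b n - a n) \<longlonglongrightarrow> 0"
      by (intro Lim_null_comparison[OF _ l3] always_eventually allI)
    with tendsto_diff[OF l2 l1] have "(\<integral>x. f (tmult (rope_gen 1) x) \<partial>\<mu>) - integral\<^sup>L \<mu> f = 0"
      by (rule LIMSEQ_unique)
    then have "(\<integral>x. f (tmult (rope_gen 1) x) \<partial>\<mu>) = integral\<^sup>L \<mu> f" by linarith
    then show "integral\<^sup>L (distr \<mu> borel (tmult (rope_gen 1))) f = integral\<^sup>L \<mu> f"
      by (simp add: integral_distr[OF tm fm])
  qed (use p sb in \<open>auto intro: prob_space_distr tm\<close>)
  have id: "distr \<mu> borel (\<lambda>x. x) = \<mu>" using sb by (metis distr_id2)
  have G_0: "rope_gen 0 \<in> G" unfolding G_def using id by (simp add: rope_gen_0[abs_def])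
  \<comment> \<open>Invariance passes to the inverse: replace the measure by its own image under the
    generator, then apply the inverse translation, and the two maps cancel.\<close>
  have G_m1: "rope_gen (-1) \<in> G"
  proof -
    have "distr \<mu> borel (tmult (rope_gen (-1))) = distr (distr \<mu> borel (tmult (rope_gen 1))) borel (tmult (rope_gen (-1)))"
      using G_1 by (simp add: G_def)
    also have "\<dots> = distr \<mu> borel (tmult (rope_gen (-1)) \<circ> tmult (rope_gen 1))"
      by (rule distr_distr[OF measurable_tmult tm])
    also have "tmult (rope_gen (-1)) \<circ> tmult (rope_gen 1) = (\<lambda>x. x)"
      by (simp add: fun_eq_iff tmult_assoc[symmetric] rope_gen_add[symmetric] rope_gen_0)
    also have "distr \<mu> borel (\<lambda>x. x) = \<mu>" by (rule id)
    finally show ?thesis by (simp add: G_def)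
  qed
  have G_gen: "rope_gen i \<in> G" for i
  proof (induction i rule: int_induct[where k=0])
    case (step1 i)
    then show ?case using G_mult[OF _ G_1] by (simp add: rope_gen_add)
  next
    case (step2 i)
    then show ?case using G_mult[OF _ G_m1, of "rope_gen i"] by (simp add: rope_gen_add[symmetric])
  qed (rule G_0)
  have "h \<in> G" if h: "h \<in> H_set freq" for h unfolding G_def mem_Collect_eq
  proof (rule prob_measure_eqI_continuous)
    fix f :: "complex^'l \<Rightarrow> real" assume f: "continuous_on UNIV f" and f01: "\<And>x. 0 \<le> f x \<and> f x \<le> 1"
    have fm: "f \<in> borel_measurable borel" using f by (rule borel_measurable_continuous_onI)
    obtain g where g: "\<And>n. g n \<in> range rope_gen" "g \<longlonglongrightarrow> h"
      using h unfolding H_set_eq closure_sequential by blast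
    have *: "(\<integral>x. f (tmult (g n) x) \<partial>\<mu>) = integral\<^sup>L \<mu> f" for n
    proof -
      have "g n \<in> G" using g(1)[of n] G_gen by auto
      then show ?thesis using integral_distr[OF tm fm, of "g n"] by (simp add: G_def)
    qed
    have "(\<lambda>n. \<integral>x. f (tmult (g n) x) \<partial>\<mu>) \<longlonglongrightarrow> (\<integral>x. f (tmult h x) \<partial>\<mu>)"
    proof (rule integral_dominated_convergence[where w="\<lambda>_. 1"])
      show "AE x in \<mu>. (\<lambda>n. f (tmult (g n) x)) \<longlonglongrightarrow> f (tmult h x)"
      proof (rule AE_I2)
        fix x
        have "continuous_on UNIV (\<lambda>a. f (tmult a x))"
          by (intro continuous_on_compose2[OF f] continuous_intros) auto
        then show "(\<lambda>n. f (tmult (g n) x)) \<longlonglongrightarrow> f (tmult h x)"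
          by (rule continuous_on_tendsto_compose[OF _ g(2)]) simp_all
      qed
    qed (use f01 in \<open>auto intro!: measurable_compose[OF tm fm]\<close>)
    then have "(\<integral>x. f (tmult h x) \<partial>\<mu>) = integral\<^sup>L \<mu> f" unfolding * by (simp add: LIMSEQ_const_iff)
    then show "integral\<^sup>L (distr \<mu> borel (tmult h)) f = integral\<^sup>L \<mu> f"
      by (simp add: integral_distr[OF tm fm])
  qed (use p sb in \<open>auto intro: prob_space_distr tm\<close>)
  moreover have "emeasure \<mu> (H_set freq) = 1"
    using AE_H by (rule emeasure_eq_1_AE[rotated]) (simp add: sb H_set_borel)
  ultimately have "haar_like \<mu>" unfolding haar_like_def using p sb by (auto simp: G_def)
  then show thesis using that r lim0 by blast
qed

lemma haar_like_haar_prob: "haar_like (haar_prob (H_set freq))"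
proof -
  obtain \<mu> where \<mu>: "haar_like \<mu>" by (rule haar_like_cesaro_subseq[OF strict_mono_id]) blast
  have "haar_prob (H_set freq) = (THE m. haar_like m)" by (simp add: haar_prob_def haar_like_def)
  also have "\<dots> = \<mu>" using \<mu> haar_like_unique by blast
  finally show ?thesis using \<mu> by simp
qed

text \<open>If the averages did not converge, a subsequence would stay at a fixed distance from the
  Haar integral. A further subsequence converges to the integral against some invariant measure,
  which by uniqueness is the Haar measure: a contradiction.\<close>

lemma cesaro_haar:
  fixes f :: "complex^'l \<Rightarrow> real"
  assumes f: "continuous_on (H_set freq) f" "f \<in> borel_measurable borel"
  shows "(\<lambda>n. (\<Sum>i=1..n. f (rope_gen (int i))) / real n) \<longlonglongrightarrow> integral\<^sup>L (haar_prob (H_set freq)) f"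
proof -
  let ?L = "integral\<^sup>L (haar_prob (H_set freq)) f"
  define a where "a n = (\<Sum>i<Suc n. f (rope_gen (int (Suc i)))) / real (Suc n)" for n
  have "a \<longlonglongrightarrow> ?L"
  proof (rule ccontr)
    assume "\<not> a \<longlonglongrightarrow> ?L"
    then obtain \<epsilon> where "\<epsilon> > 0" and "\<not> eventually (\<lambda>n. dist (a n) ?L < \<epsilon>) sequentially"
      unfolding tendsto_iff by blast
    then have "infinite {n. \<not> dist (a n) ?L < \<epsilon>}"
      by (simp add: not_eventually cofinite_eq_sequentially[symmetric] eventually_cofinite)
    then obtain s :: "nat \<Rightarrow> nat" where s: "strict_mono s" "\<And>n. s n \<in> {n. \<not> dist (a n) ?L < \<epsilon>}"
      using infinite_enumerate by blast
    obtain r \<mu> where r: "strict_mono r" "haar_like \<mu>" and lim: "\<forall>f::complex^'l \<Rightarrow> real. continuous_on (H_set freq) f \<longrightarrow> f \<in> borel_measurable borel \<longrightarrow>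
       (\<lambda>n. (\<Sum>i<Suc (s (r n)). f (rope_gen (int (Suc i)))) / real (Suc (s (r n)))) \<longlonglongrightarrow> integral\<^sup>L \<mu> f"
      by (rule haar_like_cesaro_subseq[OF s(1)]) (rule that)
    have lim_a: "(\<lambda>n. a (s (r n))) \<longlonglongrightarrow> integral\<^sup>L \<mu> f"
      unfolding a_def using lim f by simp
    have "\<mu> = haar_prob (H_set freq)" using r(2) haar_like_haar_prob by (rule haar_like_unique)
    then have "eventually (\<lambda>n. dist (a (s (r n))) ?L < \<epsilon>) sequentially"
      using lim_a \<open>\<epsilon> > 0\<close> unfolding tendsto_iff by simp
    then show False using s(2) by (auto simp: eventually_sequentially)
  qed
  moreover have "a = (\<lambda>n. (\<Sum>i=1..Suc n. f (rope_gen (int i))) / real (Suc n))"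
    unfolding a_def by (rule ext) (simp only: One_nat_def sum.atLeast_Suc_atMost_Suc_shift lessThan_Suc_atMost atMost_atLeast0 o_def)
  ultimately show ?thesis by (subst filterlim_sequentially_Suc[symmetric]) simp
qed

end

section \<open>The orbit on the sphere as an image of the torus subgroup\<close>

lemma cos_Arg_eq: "cos (Arg z) = (if z = 0 then 1 else Re z / norm z)"
  and sin_Arg_eq: "sin (Arg z) = (if z = 0 then 0 else Im z / norm z)"
proof -
  have "cos (Arg z) = Re z / norm z \<and> sin (Arg z) = Im z / norm z" if "z \<noteq> 0"
    using arg_cong[OF cis_Arg[OF that], of Re] arg_cong[OF cis_Arg[OF that], of Im] by (simp only: cis.sel Re_sgn Im_sgn)
  then show "cos (Arg z) = (if z = 0 then 1 else Re z / norm z)"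
    "sin (Arg z) = (if z = 0 then 0 else Im z / norm z)" by (auto simp: Arg_zero)
qed

lemma Phi_q_nth:
  "Phi_q q z $ l $ k = cos (Arg (z $ l)) * q $ l $ k + (if k = 1 then sin (Arg (z $ l)) * q $ l $ 2 else - sin (Arg (z $ l)) * q $ l $ 1)"
  using exhaust_2[of k] by (auto simp: Phi_q_def rot2_def)

lemma measurable_Phi_q: "Phi_q q \<in> borel_measurable borel" for q :: "real^2^'l::finite"
proof (rule borel_measurable_euclidean_space[THEN iffD2], rule ballI)
  fix i :: "real^2^'l" assume "i \<in> Basis"
  then obtain l k where i: "i = axis l (axis k 1)" by (auto simp: Basis_vec_def)
  have nth: "(\<lambda>z. z $ l) \<in> borel_measurable (borel :: (complex^'l) measure)"
    by (intro borel_measurable_continuous_onI continuous_intros)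
  have "(\<lambda>w. cos (Arg w)) \<in> borel_measurable borel" "(\<lambda>w. sin (Arg w)) \<in> borel_measurable borel"
    unfolding cos_Arg_eq sin_Arg_eq by measurable
  from this[THEN measurable_compose[OF nth]] show "(\<lambda>z. Phi_q q z \<bullet> i) \<in> borel_measurable borel"
    unfolding i inner_axis Phi_q_nth by (simp add: inner_axis Phi_q_nth)
qed

text \<open>Only the cosine and sine of \<open>Arg\<close> enter, and at unimodular entries these
  are the real and imaginary part. So the jump of \<open>Arg\<close> across the negative real axis
  does no harm.\<close>

lemma continuous_on_Phi_q: "continuous_on (H_set freq) (Phi_q q)"
proof -
  define \<Psi> where "\<Psi> z = (\<chi> l. \<chi> k. Re (z $ l) * q $ l $ k + (if k = 1 then Im (z $ l) * q $ l $ 2 else - Im (z $ l) * q $ l $ 1))" for z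
  have "continuous_on (H_set freq) \<Psi>" unfolding \<Psi>_def
  proof (intro continuous_on_vec_lambda)
    fix l k
    show "continuous_on (H_set freq) (\<lambda>z. Re (z $ l) * q $ l $ k + (if k = 1 then Im (z $ l) * q $ l $ 2 else - Im (z $ l) * q $ l $ 1))"
      by (cases "k = 1") (simp, intro continuous_intros, simp, intro continuous_intros)
  qed
  moreover have "Phi_q q z = \<Psi> z" if "z \<in> H_set freq" for z
  proof -
    have "norm (z $ l) = 1" for l using H_set_norm_nth[OF that] .
    then have "cos (Arg (z $ l)) = Re (z $ l) \<and> sin (Arg (z $ l)) = Im (z $ l)" for l
      unfolding cos_Arg_eq sin_Arg_eq by (metis div_by_1 norm_zero zero_neq_one)
    then show ?thesis by (simp add: vec_eq_iff Phi_q_nth \<Psi>_def)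
  qed
  ultimately show ?thesis by (simp cong: continuous_on_cong)
qed

lemma Phi_q_rope_gen: "Phi_q q (rope_gen freq i) = rope_u freq q i"
proof -
  have 1: "cos (Arg (rope_gen freq i $ l)) = cos (of_int i * freq l)"
    and 2: "sin (Arg (rope_gen freq i $ l)) = sin (of_int i * freq l)" for l
    unfolding cos_Arg_eq sin_Arg_eq rope_gen_nth by simp_all
  have "Phi_q q (rope_gen freq i) $ l $ k = rope_u freq q i $ l $ k" for l k
    using exhaust_2[of k] by (auto simp: Phi_q_nth 1 2 rope_u_def rot2_def)
  then show ?thesis by (simp add: vec_eq_iff)
qed

lemma Phi_q_in_orbit_closure: "z \<in> H_set freq \<Longrightarrow> Phi_q q z \<in> orbit_closure freq q"
proof -
  assume z: "z \<in> H_set freq"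
  have "Phi_q q ` closure (range (rope_gen freq)) \<subseteq> orbit_closure freq q"
    unfolding orbit_closure_def
    by (rule image_closure_subset[OF continuous_on_Phi_q[unfolded H_set_eq] closed_closure])
      (auto simp: Phi_q_rope_gen intro: subsetD[OF closure_subset])
  then show ?thesis using z unfolding H_set_eq by blast
qed

lemma norm_rope_u: "norm (rope_u freq q i) = norm q"
proof -
  have "norm (rope_u freq q i $ l) ^ 2 = norm (q $ l) ^ 2" for l
  proof -
    define c where "c = cos (of_int i * freq l)"
    define s where "s = sin (of_int i * freq l)"
    have "c^2 + s^2 = 1" unfolding c_def s_def by simp
    then have "(c * (q $ l $ 1) + s * (q $ l $ 2))\<^sup>2 + (c * (q $ l $ 2) - s * (q $ l $ 1))\<^sup>2 = (q $ l $ 1)\<^sup>2 + (q $ l $ 2)\<^sup>2"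
      by algebra
    then show ?thesis
      unfolding power2_norm_eq_inner inner_vec_def
      by (simp add: sum_2 rope_u_def rot2_def c_def s_def power2_eq_square algebra_simps)
  qed
  then have "norm (rope_u freq q i $ l) = norm (q $ l)" for l by (metis norm_ge_zero power2_eq_imp_eq)
  then show ?thesis by (simp add: norm_vec_def)
qed

lemma orbit_closure_subset_sphere: "q \<in> sphere 0 1 \<Longrightarrow> orbit_closure freq q \<subseteq> sphere 0 1"
  unfolding orbit_closure_def by (rule closure_minimal) (auto simp: norm_rope_u)

lemma compact_orbit_closure: "q \<in> sphere 0 1 \<Longrightarrow> compact (orbit_closure freq q)"
  using orbit_closure_subset_sphere[of q freq] 
  by (auto simp: compact_eq_bounded_closed orbit_closure_def intro: bounded_subset[OF bounded_sphere])

lemma rope_u_in_orbit_closure: "rope_u freq q i \<in> orbit_closure freq q"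
  unfolding orbit_closure_def by (rule subsetD[OF closure_subset]) simp

text \<open>The average is equidistribution applied to \<rho> composed with \<open>Phi_q\<close>.
  Positivity holds because \<rho> has a positive minimum on the compact orbit closure, and
  \<open>Phi_q\<close> takes its values there almost surely.\<close>

lemma
  fixes q :: "real^2^'l::finite" and freq :: "'l \<Rightarrow> real" and \<rho> :: "real^2^'l \<Rightarrow> real"
  assumes q: "q \<in> sphere 0 1" and m: "\<rho> \<in> borel_measurable borel"
    and c: "continuous_on (orbit_closure freq q) \<rho>"
    and pos: "\<And>x. x \<in> orbit_closure freq q \<Longrightarrow> 0 < \<rho> x"
  shows rope_average: "(\<lambda>n. (\<Sum>i=1..n. \<rho> (rope_u freq q (int i))) / real n) \<longlonglongrightarrow> integral\<^sup>L (pi_q freq q) \<rho>"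
    and integral_pi_q_pos: "0 < integral\<^sup>L (pi_q freq q) \<rho>"
proof -
  let ?m = "haar_prob (H_set freq)"
  have hl: "haar_like freq ?m" by (rule haar_like_haar_prob)
  then have sb: "sets ?m = sets borel" and p: "prob_space ?m" by (auto simp: haar_like_def)
  interpret prob_space ?m by (rule p)
  have Pm: "Phi_q q \<in> measurable ?m borel" using measurable_Phi_q sb by (simp cong: measurable_cong_sets)
  have int: "integral\<^sup>L (pi_q freq q) \<rho> = (\<integral>z. \<rho> (Phi_q q z) \<partial>?m)"
    unfolding pi_q_def by (rule integral_distr[OF Pm m])
  have img: "Phi_q q ` H_set freq \<subseteq> orbit_closure freq q" using Phi_q_in_orbit_closure by blast
  have cc: "continuous_on (H_set freq) (\<lambda>z. \<rho> (Phi_q q z))"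
    by (rule continuous_on_compose2[OF c continuous_on_Phi_q img])
  have mm: "(\<lambda>z. \<rho> (Phi_q q z)) \<in> borel_measurable borel" by (rule measurable_compose[OF measurable_Phi_q m])
  show "(\<lambda>n. (\<Sum>i=1..n. \<rho> (rope_u freq q (int i))) / real n) \<longlonglongrightarrow> integral\<^sup>L (pi_q freq q) \<rho>"
    using cesaro_haar[OF cc mm] unfolding int Phi_q_rope_gen .
  have Oc: "compact (orbit_closure freq q)" by (rule compact_orbit_closure[OF q])
  have One: "orbit_closure freq q \<noteq> {}" using rope_u_in_orbit_closure by blast
  obtain x where x: "x \<in> orbit_closure freq q" "\<And>y. y \<in> orbit_closure freq q \<Longrightarrow> \<rho> x \<le> \<rho> y"
    using continuous_attains_inf[OF Oc One c] by blast
  obtain x' where x': "\<And>y. y \<in> orbit_closure freq q \<Longrightarrow> \<rho> y \<le> \<rho> x'"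
    using continuous_attains_sup[OF Oc One c] by blast
  have bnd: "AE z in ?m. \<rho> x \<le> \<rho> (Phi_q q z) \<and> \<bar>\<rho> (Phi_q q z)\<bar> \<le> \<rho> x'"
    using haar_like_AE[OF hl]
  proof eventually_elim
    case (elim z)
    note o = Phi_q_in_orbit_closure[OF elim, of q]
    show ?case using x(2)[OF o] x'[OF o] pos[OF o] by simp
  qed
  have "integrable ?m (\<lambda>z. \<rho> (Phi_q q z))"
  proof (rule integrable_const_bound)
    show "AE z in ?m. norm (\<rho> (Phi_q q z)) \<le> \<rho> x'" using bnd by eventually_elim simp
    show "(\<lambda>z. \<rho> (Phi_q q z)) \<in> borel_measurable ?m" using mm sb by (simp cong: measurable_cong_sets)
  qed
  then have "(\<integral>z. \<rho> x \<partial>?m) \<le> (\<integral>z. \<rho> (Phi_q q z) \<partial>?m)"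
    by (rule integral_mono_AE[rotated]) (use bnd in \<open>auto\<close>)
  then show "0 < integral\<^sup>L (pi_q freq q) \<rho>" unfolding int using pos[OF x(1)] prob_space by simp
qed

subsection \<open>Spherical caps\<close>

text \<open>The reflection in the hyperplane orthogonal to w, and the identity for w = 0. With w = u
  - e it exchanges two unit vectors u and e, which reduces caps in an arbitrary direction to caps
  around a basis vector.\<close>

definition householder :: "'a::real_inner \<Rightarrow> 'a \<Rightarrow> 'a" where
  "householder w x = x - (2 * (x \<bullet> w) / (w \<bullet> w)) *\<^sub>R w"

lemma linear_householder: "linear (householder w)"
  unfolding householder_def
  by (rule linearI) (simp_all add: inner_add_left distrib_left add_divide_distrib scaleR_add_left scaleR_diff_right)

lemma householder_involution: "householder w (householder w x) = x"
  by (cases "w = 0") (simp_all add: householder_def inner_diff_left diff_divide_distrib)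

lemma inner_householder: "x \<bullet> householder w y = householder w x \<bullet> y"
  by (simp add: householder_def inner_diff_left inner_diff_right inner_commute)

lemma norm_householder: "norm (householder w x) = norm x"
  by (simp add: norm_eq_sqrt_inner inner_householder householder_involution)

lemma householder_swaps:
  assumes "norm u = 1" "norm e = 1" shows "householder (u - e) u = e"
proof (cases "u = e")
  case False
  have uu: "u \<bullet> u = 1" "e \<bullet> e = 1" using assms by (simp_all add: norm_eq_1)
  have "(u - e) \<bullet> (u - e) = 2 * (u \<bullet> (u - e))" using uu by (simp add: algebra_simps inner_commute)
  moreover have "(u - e) \<bullet> (u - e) \<noteq> 0" using False by simp
  ultimately show ?thesis by (simp add: householder_def)
qed (simp add: householder_def)

lemma measurable_householder: "householder w \<in> borel_measurable borel"
  for w :: "'a::euclidean_space"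
  by (intro borel_measurable_continuous_onI linear_continuous_on linear_conv_bounded_linear[THEN iffD1] linear_householder)

lemma nn_integral_lborel_translate:
  fixes f :: "'a::euclidean_space \<Rightarrow> ennreal"
  assumes "f \<in> borel_measurable borel"
  shows "(\<integral>\<^sup>+x. f (x + c) \<partial>lborel) = (\<integral>\<^sup>+x. f x \<partial>lborel)"
proof -
  have "(\<integral>\<^sup>+x. f x \<partial>lborel) = (\<integral>\<^sup>+x. f x \<partial>distr lborel borel ((+) c))"
    by (simp add: lborel_distr_plus)
  also have "\<dots> = (\<integral>\<^sup>+x. f (c + x) \<partial>lborel)" using assms by (intro nn_integral_distr) auto
  finally show ?thesis by (simp add: add.commute)
qed

text \<open>Rotation invariance from translation invariance: integrate over pairs \<open>(x, y)\<close> with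
  \<open>T x + y \<in> A\<close> and \<open>y\<close> in the unit ball, in both orders.\<close>
lemma lborel_householder:
  fixes w :: "'a::euclidean_space"
  assumes A: "A \<in> sets borel"
  shows "emeasure lborel (householder w -` A) = emeasure lborel A"
proof -
  define T where "T = householder w"
  define B where "B = ball (0::'a) 1"
  have B: "B \<in> sets borel" "emeasure lborel B = ennreal (unit_ball_vol (real DIM('a)))"
    unfolding B_def by (simp_all add: emeasure_ball)
  have Bpos: "emeasure lborel B \<noteq> 0" "emeasure lborel B \<noteq> \<infinity>"
    unfolding B(2) by (simp_all add: unit_ball_vol_pos ennreal_eq_0_iff not_le)
  have Tm [measurable]: "T \<in> borel_measurable borel" unfolding T_def by (rule measurable_householder)
  note [measurable] = A B(1)
  have Tadd: "T (x + y) = T x + T y" for x y unfolding T_def by (rule linear_add[OF linear_householder])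
  have TT: "T (T x) = x" for x unfolding T_def by (rule householder_involution)
  have Tn: "norm (T x) = norm x" for x unfolding T_def by (rule norm_householder)
  have "emeasure lborel (T -` A) * emeasure lborel B
      = (\<integral>\<^sup>+y. (\<integral>\<^sup>+x. indicator A (T x) \<partial>lborel) * indicator B y \<partial>lborel)"
  proof -
    have "T -` A \<in> sets borel" using measurable_sets[OF Tm A] by simp
    then have "(\<integral>\<^sup>+x. indicator A (T x) \<partial>lborel) = emeasure lborel (T -` A)"
      by (simp add: nn_integral_indicator[symmetric] indicator_def del: nn_integral_indicator)
    then show ?thesis by (simp add: nn_integral_cmult)
  qed
  \<comment> \<open>Since T (x + T y) = T x + y, translating x by T y inserts the summand y without
    changing the inner integral.\<close>
  also have "\<dots> = (\<integral>\<^sup>+y. (\<integral>\<^sup>+x. indicator A (T x + y) \<partial>lborel) * indicator B y \<partial>lborel)"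
  proof -
    have "(\<integral>\<^sup>+x. indicator A (T x) \<partial>lborel) = (\<integral>\<^sup>+x. indicator A (T x + y) \<partial>lborel)" for y
      using nn_integral_lborel_translate[of "\<lambda>x. indicator A (T x)" "T y"] by (simp add: Tadd TT)
    then show ?thesis by (simp only:)
  qed
  also have "\<dots> = (\<integral>\<^sup>+y. (\<integral>\<^sup>+x. indicator A (T x + y) * indicator B y \<partial>lborel) \<partial>lborel)"
    by (simp add: nn_integral_multc)
  also have "\<dots> = (\<integral>\<^sup>+x. (\<integral>\<^sup>+y. indicator A (T x + y) * indicator B y \<partial>lborel) \<partial>lborel)"
    by (rule lborel_pair.Fubini') measurable
  also have "\<dots> = (\<integral>\<^sup>+x. (\<integral>\<^sup>+y. indicator A y * indicator B (y - T x) \<partial>lborel) \<partial>lborel)"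
  proof -
    have "(\<integral>\<^sup>+y. indicator A (T x + y) * indicator B y \<partial>lborel) = (\<integral>\<^sup>+y. indicator A y * indicator B (y - T x) \<partial>lborel)" for x
      using nn_integral_lborel_translate[of "\<lambda>y. indicator A y * indicator B (y - T x)" "T x"]
      by (simp add: add.commute)
    then show ?thesis by (simp only:)
  qed
  also have "\<dots> = (\<integral>\<^sup>+y. (\<integral>\<^sup>+x. indicator A y * indicator B (y - T x) \<partial>lborel) \<partial>lborel)"
    by (rule lborel_pair.Fubini'[symmetric]) measurable
  \<comment> \<open>For fixed y, the substitution x + T y for x turns y - T x into - T x, whose norm
    is that of x; the inner integral is thus the volume of the ball B.\<close>
  also have "\<dots> = (\<integral>\<^sup>+y. indicator A y * emeasure lborel B \<partial>lborel)"
  proof -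
    have "(\<integral>\<^sup>+x. indicator B (y - T x) \<partial>lborel) = emeasure lborel B" for y
    proof -
      have "(\<integral>\<^sup>+x. indicator B (y - T x) \<partial>lborel) = (\<integral>\<^sup>+x. indicator B (y - T (x + T y)) \<partial>lborel)"
        using nn_integral_lborel_translate[of "\<lambda>x. indicator B (y - T x)" "T y"] by simp
      also have "\<dots> = (\<integral>\<^sup>+x. indicator B x \<partial>lborel)"
        by (intro nn_integral_cong) (simp add: Tadd TT B_def indicator_def Tn)
      finally show ?thesis by simp
    qed
    then show ?thesis by (simp add: nn_integral_cmult)
  qed
  also have "\<dots> = emeasure lborel A * emeasure lborel B" by (simp add: nn_integral_multc)
  finally have "emeasure lborel (T -` A) * emeasure lborel B / emeasure lborel B = emeasure lborel A * emeasure lborel B / emeasure lborel B"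
    by simp
  then show ?thesis using Bpos by (simp add: mult_divide_eq_ennreal T_def)
qed

text \<open>Cavalieri: the slice at height s along e is a ball of radius a * s in one dimension
  less, and integrating its volume over heights up to h gives the power h ^ DIM and the divisor
  DIM.\<close>

lemma emeasure_cone:
  fixes e :: "'a::euclidean_space"
  assumes e: "e \<in> Basis" and a: "a > 0" and h: "h > 0"
  shows "emeasure lborel {y. 0 < y \<bullet> e \<and> y \<bullet> e \<le> h \<and> norm (y - (y \<bullet> e) *\<^sub>R e) \<le> a * (y \<bullet> e)}
    = ennreal (unit_ball_vol (real (DIM('a) - 1)) * a ^ (DIM('a) - 1) * h ^ DIM('a) / real DIM('a))" (is "emeasure lborel ?K = _")
proof -
  interpret product_sigma_finite "\<lambda>_::'a. lborel :: real measure" ..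
  define I where "I = (Basis :: 'a set) - {e}"
  define V where "V = unit_ball_vol (real (DIM('a) - 1))"
  define k where "k = DIM('a) - 1"
  have I: "finite I" "e \<notin> I" "insert e I = Basis" "card I = k"
    using e by (auto simp: I_def k_def card_Diff_singleton)
  have kD: "DIM('a) = Suc k" using DIM_positive[where 'a='a] by (simp add: k_def)
  have V: "V \<ge> 0" by (simp add: V_def)
  define \<psi> :: "('a \<Rightarrow> real) \<Rightarrow> 'a" where "\<psi> f = (\<Sum>b\<in>Basis. f b *\<^sub>R b)" for f
  have \<psi>m [measurable]: "\<psi> \<in> borel_measurable (Pi\<^sub>M Basis (\<lambda>_. lborel))" unfolding \<psi>_def by measurable
  have K [measurable]: "?K \<in> sets borel" by measurable
  have inK: "\<psi> (g(e := s)) \<in> ?K \<longleftrightarrow> 0 < s \<and> s \<le> h \<and> sqrt (\<Sum>i\<in>I. (g i)\<^sup>2) \<le> a * s" for g s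
  proof -
    have nth: "\<psi> (g(e := s)) \<bullet> b = (g(e := s)) b" if "b \<in> Basis" for b
      using that unfolding \<psi>_def by simp
    let ?w = "\<psi> (g(e := s)) - s *\<^sub>R e"
    have w: "?w \<bullet> b = (if b = e then 0 else g b)" if "b \<in> Basis" for b
      using that e nth[OF that] by (simp add: inner_diff_left inner_Basis)
    have "norm ?w = sqrt (\<Sum>b\<in>Basis. (?w \<bullet> b) * (?w \<bullet> b))"
      unfolding norm_eq_sqrt_inner by (subst euclidean_inner) (rule refl)
    also have "(\<Sum>b\<in>Basis. (?w \<bullet> b) * (?w \<bullet> b)) = (\<Sum>b\<in>Basis. if b = e then 0 else (g b)\<^sup>2)"
      by (rule sum.cong) (auto simp: w power2_eq_square)
    also have "\<dots> = (\<Sum>b\<in>I. (g b)\<^sup>2)"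
      unfolding I(3)[symmetric] using I(1,2) by (auto intro!: sum.cong)
    finally have n: "norm ?w = sqrt (\<Sum>b\<in>I. (g b)\<^sup>2)" .
    have s: "\<psi> (g(e := s)) \<bullet> e = s" using nth[OF e] by simp
    show ?thesis by (simp only: mem_Collect_eq s n)
  qed
  have "emeasure lborel ?K = emeasure (Pi\<^sub>M Basis (\<lambda>_. lborel)) (\<psi> -` ?K \<inter> space (Pi\<^sub>M Basis (\<lambda>_. lborel)))"
    by (subst lborel_eq) (simp only: \<psi>_def[symmetric, abs_def] emeasure_distr[OF \<psi>m K])
  also have "\<dots> = (\<integral>\<^sup>+f. indicator ?K (\<psi> f) \<partial>Pi\<^sub>M (insert e I) (\<lambda>_. lborel))"
    unfolding I(3) nn_integral_indicator[OF measurable_sets[OF \<psi>m K], symmetric]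
    by (rule nn_integral_cong) (simp only: indicator_def vimage_eq Int_iff simp_thms)
  also have "\<dots> = (\<integral>\<^sup>+s. (\<integral>\<^sup>+g. indicator ?K (\<psi> (g(e := s))) \<partial>Pi\<^sub>M I (\<lambda>_. lborel)) \<partial>lborel)"
    by (rule product_nn_integral_insert_rev[OF I(1,2)]) (simp add: I(3))
  also have "\<dots> = (\<integral>\<^sup>+s. ennreal (V * a ^ k * s ^ k) * indicator {0..h} s \<partial>lborel)"
  proof (rule nn_integral_cong_AE)
    \<comment> \<open>In dimension one the two sides disagree at s = 0, where 0 ^ 0 = 1 on the right
      but the slice on the left is empty; this null point is removed.\<close>
    have "AE s in lborel. s \<noteq> (0::real)" by (rule AE_lborel_singleton)
    then show "AE s in lborel. (\<integral>\<^sup>+g. indicator ?K (\<psi> (g(e := s))) \<partial>Pi\<^sub>M I (\<lambda>_. lborel)) = ennreal (V * a ^ k * s ^ k) * indicator {0..h} s"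
    proof eventually_elim
      case (elim s)
      show ?case
      proof (cases "0 < s \<and> s \<le> h")
        case True
        let ?B = "{f. sqrt (\<Sum>i\<in>I. (f i)\<^sup>2) \<le> a * s} \<inter> space (Pi\<^sub>M I (\<lambda>_. lborel :: real measure))"
        have B: "?B \<in> sets (Pi\<^sub>M I (\<lambda>_. lborel))"
        proof -
          have "(\<lambda>f. sqrt (\<Sum>i\<in>I. (f i)\<^sup>2)) \<in> borel_measurable (Pi\<^sub>M I (\<lambda>_. lborel :: real measure))"
            using I(1) by measurable
          from measurable_sets[OF this, of "{..a * s}"] show ?thesis by (simp add: vimage_def)
        qed
        have "(\<integral>\<^sup>+g. indicator ?K (\<psi> (g(e := s))) \<partial>Pi\<^sub>M I (\<lambda>_. lborel)) = (\<integral>\<^sup>+g. indicator ?B g \<partial>Pi\<^sub>M I (\<lambda>_. lborel))"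
          using True inK by (intro nn_integral_cong) (auto simp: indicator_def)
        also have "\<dots> = emeasure (Pi\<^sub>M I (\<lambda>_. lborel)) ?B" using B by (rule nn_integral_indicator)
        also have "\<dots> = ennreal (V * (a * s) ^ k)"
          using emeasure_cball_aux[OF I(1), of "a * s"] a True I(4) by (simp add: V_def k_def)
        finally show ?thesis using True by (simp add: power_mult_distrib mult.assoc)
      next
        case False
        then have "(\<integral>\<^sup>+g. indicator ?K (\<psi> (g(e := s))) \<partial>Pi\<^sub>M I (\<lambda>_. lborel)) = 0"
        proof -
          have "indicator ?K (\<psi> (g(e := s))) = (0 :: ennreal)" for g
            using inK[of g s] False by (intro indicator_simps(2)) blast
          then show ?thesis by (simp only: nn_integral_const) simp
        qed
        then show ?thesis using False elim by (auto simp: indicator_def)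
      qed
    qed
  qed
  also have "\<dots> = ennreal (V * a ^ k * (h ^ Suc k / Suc k) - V * a ^ k * (0 ^ Suc k / Suc k))"
  proof (rule nn_integral_FTC_Icc[where F="\<lambda>s. V * a ^ k * (s ^ Suc k / Suc k)"])
    fix s :: real assume s: "s \<in> {0..h}"
    then show "0 \<le> V * a ^ k * s ^ k" using V a by simp
    have "((\<lambda>s. s ^ Suc k / Suc k) has_real_derivative s ^ k) (at s)"
      by (auto intro!: derivative_eq_intros simp del: power_Suc)
    then show "((\<lambda>s. V * a ^ k * (s ^ Suc k / Suc k)) has_real_derivative V * a ^ k * s ^ k) (at s)"
      by (rule DERIV_cmult)
  qed (use h in auto)
  also have "\<dots> = ennreal (V * a ^ k * h ^ Suc k / Suc k)" by simp
  finally show ?thesis unfolding V_def k_def kD[unfolded k_def, symmetric] .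
qed

section \<open>Surface measure of small caps\<close>

text \<open>The preimage of the cap of height t around u under radial projection of the punctured
  unit ball. As the surface measure is a cone measure, the cap has DIM times the volume of this
  set.\<close>

definition sector :: "'a::real_inner \<Rightarrow> real \<Rightarrow> 'a set" where
  "sector u t = {y. y \<noteq> 0 \<and> norm y \<le> 1 \<and> (1 - t) * norm y \<le> u \<bullet> y}"

lemma sector_borel: "sector u t \<in> sets borel" for u :: "'a::euclidean_space"
  unfolding sector_def by measurable

lemma emeasure_sphere_measure_cap:
  fixes u :: "real^2^'l::finite"
  shows "emeasure sphere_measure {x. 1 - inner u x \<le> t} = ennreal (real DIM(real^2^'l)) * emeasure lborel (sector u t)"
proof -
  let ?d = "density lborel (\<lambda>x. ennreal (real (dimd TYPE('l))) * indicator (cball 0 1 - {0}) x) :: (real^2^'l) measure"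
  have m: "(\<lambda>x. x /\<^sub>R norm x) \<in> measurable ?d (borel :: (real^2^'l) measure)" by simp
  have c: "{x. 1 - inner u x \<le> t} \<in> sets borel" by measurable
  have v: "(\<lambda>x. x /\<^sub>R norm x) -` {x. 1 - inner u x \<le> t} \<in> sets borel"
    using measurable_sets[OF m c] by simp
  have "emeasure sphere_measure {x. 1 - inner u x \<le> t} = emeasure ?d ((\<lambda>x. x /\<^sub>R norm x) -` {x. 1 - inner u x \<le> t})"
    unfolding sphere_measure_def by (subst emeasure_distr[OF m c]) simp
  also have "\<dots> = (\<integral>\<^sup>+x. ennreal (real (dimd TYPE('l))) * indicator (cball 0 1 - {0}) x * indicator ((\<lambda>x. x /\<^sub>R norm x) -` {x. 1 - inner u x \<le> t}) x \<partial>lborel)"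
  proof (rule emeasure_density)
    show "(\<lambda>x. ennreal (real (dimd TYPE('l))) * indicator (cball 0 1 - {0::real^2^'l}) x) \<in> borel_measurable lborel"
      by (intro borel_measurable_times_ennreal borel_measurable_const borel_measurable_indicator) auto
  qed (use v in simp)
  also have "\<dots> = (\<integral>\<^sup>+x. ennreal (real (dimd TYPE('l))) * indicator (sector u t) x \<partial>lborel)"
  proof (rule nn_integral_cong)
    fix x :: "real^2^'l"
    have "x /\<^sub>R norm x \<in> {x. 1 - inner u x \<le> t} \<longleftrightarrow> (1 - t) * norm x \<le> u \<bullet> x" if "x \<noteq> 0"
    proof -
      have "x /\<^sub>R norm x \<in> {x. 1 - inner u x \<le> t} \<longleftrightarrow> 1 - t \<le> u \<bullet> x / norm x"
        by (auto simp: divide_inverse mult.commute)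
      then show ?thesis using that by (simp add: pos_le_divide_eq)
    qed
    then show "ennreal (real (dimd TYPE('l))) * indicator (cball 0 1 - {0}) x * indicator ((\<lambda>x. x /\<^sub>R norm x) -` {x. 1 - inner u x \<le> t}) x
      = ennreal (real (dimd TYPE('l))) * indicator (sector u t) x"
      by (cases "x = 0") (simp_all add: indicator_def sector_def)
  qed
  also have "\<dots> = ennreal (real (dimd TYPE('l))) * emeasure lborel (sector u t)"
    by (rule nn_integral_cmult_indicator) (simp add: sector_borel)
  finally show ?thesis by (simp add: dimd_def mult.commute)
qed

text \<open>The reflection exchanging u and e maps one sector onto the other, and it preserves
  volume.\<close>

lemma emeasure_sector_eq:
  fixes u e :: "'a::euclidean_space"
  assumes "norm u = 1" "norm e = 1"
  shows "emeasure lborel (sector u t) = emeasure lborel (sector e t)"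
proof -
  have "householder (u - e) e = u"
    using householder_swaps[OF assms] householder_involution[of "u - e" u] by simp
  moreover have "householder (u - e) y = 0 \<longleftrightarrow> y = 0" for y
    using norm_householder[of "u - e" y] by (metis norm_eq_zero)
  ultimately have "sector u t = householder (u - e) -` sector e t"
    by (auto simp: sector_def norm_householder inner_householder)
  then show ?thesis using lborel_householder[OF sector_borel] by metis
qed

text \<open>Up to its spherical lid the sector is a straight cone whose half angle has cosine 1 - t,
  hence tangent sqrt (2 * t - t^2) / (1 - t). It contains this cone cut off flat at height 1 - t and
  is contained in the cone cut off at height 1, and both volumes are explicit.\<close>

lemma emeasure_sector_bounds:
  fixes u :: "'a::euclidean_space"
  assumes u: "norm u = 1" and t: "0 < t" "t < 1"
  defines "v \<equiv> unit_ball_vol (real (DIM('a) - 1)) * (sqrt (2 * t - t\<^sup>2) / (1 - t)) ^ (DIM('a) - 1) / real DIM('a)"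
  shows "ennreal ((1 - t) ^ DIM('a) * v) \<le> emeasure lborel (sector u t)"
    and "emeasure lborel (sector u t) \<le> ennreal v"
proof -
  obtain e :: 'a where e: "e \<in> Basis" using nonempty_Basis by blast
  have ne: "norm e = 1" using e by simp
  define a where "a = sqrt (2 * t - t\<^sup>2) / (1 - t)"
  have pos: "2 * t - t\<^sup>2 > 0" using t by (simp add: power2_eq_square)
  have a: "a > 0" unfolding a_def using pos t by simp
  define C where "C h = {y. 0 < y \<bullet> e \<and> y \<bullet> e \<le> h \<and> norm (y - (y \<bullet> e) *\<^sub>R e) \<le> a * (y \<bullet> e)}" for h
  have ny: "(norm y)\<^sup>2 = (y \<bullet> e)\<^sup>2 + (norm (y - (y \<bullet> e) *\<^sub>R e))\<^sup>2" for y
    using ne unfolding norm_eq_1 power2_norm_eq_inner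
    by (simp add: inner_diff_left inner_diff_right inner_commute power2_eq_square)
  have key: "(1 - t) * norm y \<le> y \<bullet> e \<longleftrightarrow> norm (y - (y \<bullet> e) *\<^sub>R e) \<le> a * (y \<bullet> e)" if s: "y \<bullet> e > 0" for y
  proof -
    define s w n where "s = y \<bullet> e" and "w = norm (y - (y \<bullet> e) *\<^sub>R e)" and "n = norm y"
    have n2: "n\<^sup>2 = s\<^sup>2 + w\<^sup>2" using ny[of y] by (simp add: s_def w_def n_def)
    have a2: "a\<^sup>2 * (1 - t)\<^sup>2 = 1 - (1 - t)\<^sup>2"
      using pos t by (simp add: a_def power_divide real_sqrt_pow2) (simp add: power2_eq_square algebra_simps)
    have "(1 - t) * n \<le> s \<longleftrightarrow> ((1 - t) * n)\<^sup>2 \<le> s\<^sup>2"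
      using abs_le_square_iff[of "(1 - t) * n" s] s t by (simp add: s_def n_def abs_mult)
    also have "\<dots> \<longleftrightarrow> (1 - t)\<^sup>2 * w\<^sup>2 \<le> (1 - t)\<^sup>2 * (a * s)\<^sup>2"
    proof -
      have "(1 - t)\<^sup>2 * (a * s)\<^sup>2 = (1 - (1 - t)\<^sup>2) * s\<^sup>2" unfolding a2[symmetric] by (simp add: power_mult_distrib)
      moreover have "((1 - t) * n)\<^sup>2 = (1 - t)\<^sup>2 * s\<^sup>2 + (1 - t)\<^sup>2 * w\<^sup>2"
        by (simp add: power_mult_distrib n2 distrib_left)
      moreover have "(1 - (1 - t)\<^sup>2) * s\<^sup>2 = s\<^sup>2 - (1 - t)\<^sup>2 * s\<^sup>2" by (simp add: left_diff_distrib)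
      ultimately show ?thesis by linarith
    qed
    also have "\<dots> \<longleftrightarrow> w\<^sup>2 \<le> (a * s)\<^sup>2" using t by simp
    also have "\<dots> \<longleftrightarrow> w \<le> a * s"
      using abs_le_square_iff[of w "a * s"] s a by (simp add: s_def w_def abs_mult)
    finally show ?thesis by (simp add: s_def w_def n_def)
  qed
  have sub2: "sector e t \<subseteq> C 1"
  proof
    fix y assume y: "y \<in> sector e t"
    then have p: "0 < (1 - t) * norm y" "(1 - t) * norm y \<le> y \<bullet> e" using t by (auto simp: sector_def inner_commute)
    have "y \<bullet> e \<le> 1" using Cauchy_Schwarz_ineq2[of y e] y ne by (auto simp: sector_def)
    then show "y \<in> C 1" using p key[of y] by (auto simp: C_def)
  qed
  have sub1: "C (1 - t) \<subseteq> sector e t"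
  proof
    fix y assume y: "y \<in> C (1 - t)"
    then have k: "(1 - t) * norm y \<le> y \<bullet> e" using key[of y] by (auto simp: C_def)
    also have "\<dots> \<le> 1 - t" using y by (auto simp: C_def)
    finally have "norm y \<le> 1" using t by simp
    then show "y \<in> sector e t" using y k by (auto simp: sector_def C_def inner_commute)
  qed
  have eC: "emeasure lborel (C h) = ennreal (h ^ DIM('a) * v)" if "h > 0" for h
    unfolding C_def using emeasure_cone[OF e a that] by (simp add: v_def a_def mult.commute mult.left_commute)
  have Cb: "C h \<in> sets lborel" for h unfolding C_def by simp
  show "ennreal ((1 - t) ^ DIM('a) * v) \<le> emeasure lborel (sector u t)"
    using emeasure_mono[OF sub1, of lborel] sector_borel[of e t] eC[of "1 - t"] t
    unfolding emeasure_sector_eq[OF u ne] by simp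
  show "emeasure lborel (sector u t) \<le> ennreal v"
    using emeasure_mono[OF sub2 Cb] eC[of 1] unfolding emeasure_sector_eq[OF u ne] by simp
qed

text \<open>The coefficient of t powr (1 / \<alpha>) in the surface measure of a cap of small height
  t; it is the factor in front of the integral in \<open>Cbar\<close>.\<close>

definition cap_const :: "'l::finite itself \<Rightarrow> real" where
  "cap_const t = 2 powr (1 / alphaR t) * sphere_area (dimd t - 1) / (real (dimd t) - 1)"

lemma dimd_ge_2: "dimd TYPE('l::finite) \<ge> 2"
  unfolding dimd_def by simp

lemma inverse_alphaR: "1 / alphaR TYPE('l::finite) = real (dimd TYPE('l) - 1) / 2"
  using dimd_ge_2[where 'l='l] by (simp add: alphaR_def of_nat_diff)

lemma inverse_alphaR_pos: "1 / alphaR TYPE('l::finite) > 0"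
  unfolding inverse_alphaR using dimd_ge_2[where 'l='l] by simp

text \<open>By the functional equation of the Gamma function, the area of a unit sphere divided by
  the dimension is the volume of its ball. This matches the constant of the theorem with the one
  produced by the cone volumes.\<close>

lemma cap_const_eq:
  "cap_const TYPE('l::finite) = unit_ball_vol (real (dimd TYPE('l) - 1)) * 2 powr (1 / alphaR TYPE('l))"
proof -
  define n where "n = dimd TYPE('l) - 1"
  define k where "k = real n"
  have k: "k > 0" using dimd_ge_2[where 'l='l] by (simp add: k_def n_def)
  have G: "Gamma (k / 2 + 1) = k / 2 * Gamma (k / 2)" using k by (intro Gamma_plus1) (auto dest: nonpos_Ints_nonpos)
  have "sphere_area n / k = unit_ball_vol k"
    unfolding sphere_area_def unit_ball_vol_def k_def[symmetric] G by (simp add: mult.commute)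
  moreover have "real (dimd TYPE('l)) - 1 = k" using dimd_ge_2[where 'l='l] by (simp add: k_def n_def)
  ultimately show ?thesis
    unfolding cap_const_def n_def[symmetric] k_def[symmetric] by (metis times_divide_eq_right mult.commute)
qed

text \<open>The flat cones from inside and outside differ by the factor (1 - t) ^ D, which tends to
  1, and neither bound depends on the direction u. That is where the uniformity in u comes
  from.\<close>

lemma sphere_cap_asymp:
  assumes "\<epsilon> > 0"
  obtains t0 where "0 < t0" "t0 < 1"
    "\<forall>t u. 0 < t \<longrightarrow> t < t0 \<longrightarrow> norm (u::real^2^'l::finite) = 1 \<longrightarrow>
       emeasure sphere_measure {x. 1 - inner u x \<le> t} < \<infinity> \<and>
       \<bar>measure sphere_measure {x. 1 - inner u x \<le> t} - cap_const TYPE('l) * t powr (1 / alphaR TYPE('l))\<bar>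
         \<le> \<epsilon> * t powr (1 / alphaR TYPE('l))"
proof -
  define D where "D = DIM(real^2^'l)"
  have D: "D = dimd TYPE('l)" by (simp add: D_def dimd_def)
  define p where "p = 1 / alphaR TYPE('l)"
  define V where "V = unit_ball_vol (real (D - 1))"
  \<comment> \<open>\<open>w t\<close> is the measure of the outer cone divided by t powr p: the
    base radius is sqrt (t * (2 - t)) / (1 - t), and p is half of D - 1.\<close>
  define w where "w t = V * ((2 - t) / (1 - t)\<^sup>2) powr p" for t :: real
  have p: "p = real (D - 1) / 2" unfolding p_def D by (rule inverse_alphaR)
  have \<kappa>: "cap_const TYPE('l) = V * 2 powr p" unfolding cap_const_eq V_def p_def D ..
  have lim1: "(w \<longlongrightarrow> cap_const TYPE('l)) (at_right 0)"
  proof -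
    have "(w \<longlongrightarrow> V * ((2 - 0) / (1 - 0)\<^sup>2) powr p) (at_right 0)"
      unfolding w_def by (intro tendsto_intros) auto
    then show ?thesis by (simp add: \<kappa>)
  qed
  have lim2: "((\<lambda>t. (1 - t) ^ D * w t) \<longlongrightarrow> cap_const TYPE('l)) (at_right 0)"
  proof -
    have "((\<lambda>t. (1 - t) ^ D * w t) \<longlongrightarrow> (1 - 0) ^ D * cap_const TYPE('l)) (at_right 0)"
      by (intro tendsto_intros lim1)
    then show ?thesis by simp
  qed
  have "eventually (\<lambda>t. dist (w t) (cap_const TYPE('l)) < \<epsilon> \<and> dist ((1 - t) ^ D * w t) (cap_const TYPE('l)) < \<epsilon>) (at_right 0)"
    using tendstoD[OF lim1 assms] tendstoD[OF lim2 assms] by eventually_elim simp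
  then obtain b where b: "b > 0" "\<And>t. 0 < t \<Longrightarrow> t < b \<Longrightarrow> dist (w t) (cap_const TYPE('l)) < \<epsilon> \<and> dist ((1 - t) ^ D * w t) (cap_const TYPE('l)) < \<epsilon>"
    unfolding eventually_at_right_field by auto
  show thesis
  proof (rule that[of "min b (1/2)"], goal_cases)
    case 3
    show ?case
    proof (intro allI impI)
      fix t and u :: "real^2^'l" assume t: "0 < t" "t < min b (1/2)" and u: "norm u = 1"
      have t1: "t < 1" using t by simp
      define v where "v = V * (sqrt (2 * t - t\<^sup>2) / (1 - t)) ^ (D - 1) / real D"
      have Dp: "real D > 0" using dimd_ge_2[where 'l='l] by (simp add: D)
      have Dv: "real D * v = w t * t powr p"
      proof -
        define x where "x = (2 - t) / (1 - t)\<^sup>2"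
        have x: "x > 0" using t by (simp add: x_def)
        have "sqrt (2 * t - t\<^sup>2) / (1 - t) = sqrt (t * x)"
        proof -
          have "t * x = (2 * t - t\<^sup>2) / (1 - t)\<^sup>2" by (simp add: x_def power2_eq_square algebra_simps)
          then show ?thesis using t by (simp add: real_sqrt_divide)
        qed
        also have "\<dots> = (t * x) powr (1/2)" using t x by (simp add: powr_half_sqrt)
        finally have "(sqrt (2 * t - t\<^sup>2) / (1 - t)) ^ (D - 1) = (t * x) powr p"
          using powr_power[of "t * x" "1/2" "D - 1"] t x by (simp add: p)
        also have "\<dots> = t powr p * x powr p" using t x by (simp add: powr_mult)
        finally show ?thesis using Dp unfolding v_def w_def x_def[symmetric] by simp
      qed
      let ?c = "{x. 1 - inner u x \<le> t}"
      have e: "emeasure sphere_measure ?c = ennreal (real D) * emeasure lborel (sector u t)"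
        unfolding emeasure_sphere_measure_cap D_def ..
      have vw: "w t * t powr p \<ge> 0" unfolding w_def V_def by simp
      have up: "emeasure sphere_measure ?c \<le> ennreal (w t * t powr p)"
        unfolding e Dv[symmetric] using mult_left_mono[OF emeasure_sector_bounds(2)[OF u t(1) t1], of "ennreal (real D)"]
        by (simp add: v_def V_def D_def ennreal_mult'[symmetric])
      have lo: "ennreal ((1 - t) ^ D * (w t * t powr p)) \<le> emeasure sphere_measure ?c"
        unfolding e Dv[symmetric] using mult_left_mono[OF emeasure_sector_bounds(1)[OF u t(1) t1], of "ennreal (real D)"]
        by (simp add: v_def V_def D_def ennreal_mult'[symmetric] mult.left_commute)
      have fin: "emeasure sphere_measure ?c < \<infinity>" using up by (rule le_less_trans) simp
      then have em: "emeasure sphere_measure ?c = ennreal (measure sphere_measure ?c)"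
        by (intro emeasure_eq_ennreal_measure) simp
      have "measure sphere_measure ?c \<le> w t * t powr p"
        using up vw unfolding em by (simp add: ennreal_le_iff)
      moreover have "(1 - t) ^ D * w t * t powr p \<le> measure sphere_measure ?c"
        using lo unfolding em by (simp add: ennreal_le_iff mult.assoc)
      moreover have "w t * t powr p \<le> (cap_const TYPE('l) + \<epsilon>) * t powr p"
        using b(2)[of t] t by (intro mult_right_mono) (auto simp: dist_real_def)
      moreover have "(cap_const TYPE('l) - \<epsilon>) * t powr p \<le> (1 - t) ^ D * w t * t powr p"
        using b(2)[of t] t by (intro mult_right_mono) (auto simp: dist_real_def)
      ultimately show "emeasure sphere_measure ?c < \<infinity> \<and>
        \<bar>measure sphere_measure ?c - cap_const TYPE('l) * t powr (1 / alphaR TYPE('l))\<bar> \<le> \<epsilon> * t powr (1 / alphaR TYPE('l))"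
        using fin unfolding p_def[symmetric] by (auto simp: algebra_simps abs_le_iff)
    qed
  qed (use b(1) in auto)
qed

subsection \<open>Poisson limits for m-dependent events\<close>

lemma prod_one_minus_ge:
  fixes x :: "'b \<Rightarrow> real"
  assumes "finite A" "\<And>i. i \<in> A \<Longrightarrow> 0 \<le> x i \<and> x i \<le> 1"
  shows "1 - (\<Prod>i\<in>A. 1 - x i) \<le> sum x A"
  using assms
proof (induction A rule: finite_induct)
  case (insert a A)
  define P where "P = (\<Prod>i\<in>A. 1 - x i)"
  have "0 \<le> P" "P \<le> 1" unfolding P_def using insert by (auto intro!: prod_nonneg prod_le_1)
  then have "x a * P \<le> x a" using insert.prems[of a] by (intro mult_left_le) auto
  moreover have "1 - P \<le> sum x A" using insert unfolding P_def by auto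
  ultimately show ?case using insert by (simp add: P_def[symmetric] algebra_simps)
qed simp

locale probability = prob_space M for M :: "'a measure"
begin

text \<open>Replacing the product over \<open>i < j\<close> by the one over \<open>i < j - m\<close> costs at most the
  sum of the omitted \<open>\<xi> i\<close>; the shortened product is independent of \<open>\<xi> j\<close>.\<close>
lemma expectation_prod_m_dependent:
  fixes \<xi> :: "nat \<Rightarrow> 'a \<Rightarrow> real"
  assumes meas: "\<And>i. \<xi> i \<in> borel_measurable M"
    and bnd: "\<And>i \<omega>. 0 \<le> \<xi> i \<omega> \<and> \<xi> i \<omega> \<le> 1"
    and indep: "\<And>j. j < n \<Longrightarrow> expectation (\<lambda>\<omega>. \<xi> j \<omega> * (\<Prod>i<j-m. 1 - \<xi> i \<omega>)) = expectation (\<xi> j) * expectation (\<lambda>\<omega>. \<Prod>i<j-m. 1 - \<xi> i \<omega>)"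
  shows "\<bar>expectation (\<lambda>\<omega>. \<Prod>i<n. 1 - \<xi> i \<omega>) - (\<Prod>i<n. 1 - expectation (\<xi> i))\<bar>
    \<le> (\<Sum>j<n. \<Sum>i\<in>{j-m..<j}. expectation (\<lambda>\<omega>. \<xi> i \<omega> * \<xi> j \<omega>) + expectation (\<xi> i) * expectation (\<xi> j))"
  using indep
proof (induction n)
  case (Suc j)
  define R where "R \<omega> = (\<Prod>i<j. 1 - \<xi> i \<omega>)" for \<omega>
  define Q where "Q \<omega> = (\<Prod>i<j-m. 1 - \<xi> i \<omega>)" for \<omega>
  define S where "S \<omega> = (\<Sum>i\<in>{j-m..<j}. \<xi> i \<omega>)" for \<omega>
  define err where "err = (\<Sum>i\<in>{j-m..<j}. expectation (\<lambda>\<omega>. \<xi> i \<omega> * \<xi> j \<omega>) + expectation (\<xi> i) * expectation (\<xi> j))"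
  have [measurable]: "R \<in> borel_measurable M" "Q \<in> borel_measurable M" "S \<in> borel_measurable M" "\<xi> i \<in> borel_measurable M" for i
    unfolding R_def Q_def S_def using meas by measurable
  have R: "0 \<le> R \<omega>" "R \<omega> \<le> 1" and Q: "0 \<le> Q \<omega>" "Q \<omega> \<le> 1" for \<omega>
    unfolding R_def Q_def using bnd by (auto intro!: prod_nonneg prod_le_1)
  \<comment> \<open>R equals Q times the product T of the omitted factors, and the union bound gives
    1 - T \<le> S.\<close>
  have RQ: "R \<omega> \<le> Q \<omega> \<and> Q \<omega> - R \<omega> \<le> S \<omega>" for \<omega>
  proof -
    define T where "T = (\<Prod>i\<in>{j-m..<j}. 1 - \<xi> i \<omega>)"
    have T: "0 \<le> T" "T \<le> 1" unfolding T_def using bnd by (auto intro!: prod_nonneg prod_le_1)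
    have "{..<j} = {..<j-m} \<union> {j-m..<j}" by auto
    then have RT: "R \<omega> = Q \<omega> * T" unfolding R_def Q_def T_def by (simp add: prod.union_disjoint ivl_disj_int)
    have "1 - T \<le> S \<omega>" unfolding T_def S_def by (rule prod_one_minus_ge) (use bnd in auto)
    moreover have "Q \<omega> * (1 - T) \<le> 1 * (1 - T)" using Q[of \<omega>] T by (intro mult_right_mono) auto
    moreover have "Q \<omega> * T \<le> Q \<omega>" using Q[of \<omega>] T by (intro mult_left_le)
    ultimately show ?thesis unfolding RT by (simp add: algebra_simps)
  qed
  have b\<xi>: "\<bar>\<xi> i \<omega>\<bar> \<le> 1" for i \<omega> using bnd[of i \<omega>] by simp
  have ib: "integrable M f" if "f \<in> borel_measurable M" "\<And>\<omega>. 0 \<le> f \<omega> \<and> f \<omega> \<le> 1" for f :: "'a \<Rightarrow> real"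
    by (rule integrable_const_bound[of _ 1]) (use that in auto)
  have i\<xi>: "integrable M (\<xi> i)" for i by (rule ib) (use bnd in auto)
  have i\<xi>\<xi>: "integrable M (\<lambda>\<omega>. \<xi> i \<omega> * \<xi> j \<omega>)" for i j
    by (rule ib) (use bnd in \<open>auto intro!: mult_le_one\<close>)
  have iR: "integrable M R" and iQ: "integrable M Q" by (auto intro!: ib simp: R Q)
  have i\<xi>R: "integrable M (\<lambda>\<omega>. \<xi> j \<omega> * R \<omega>)" and i\<xi>Q: "integrable M (\<lambda>\<omega>. \<xi> j \<omega> * Q \<omega>)"
    by (auto intro!: ib mult_le_one simp: R Q bnd)
  have iS: "integrable M S" unfolding S_def by (intro Bochner_Integration.integrable_sum i\<xi>)
  have i\<xi>S: "integrable M (\<lambda>\<omega>. \<xi> j \<omega> * S \<omega>)"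
    unfolding S_def sum_distrib_left by (intro Bochner_Integration.integrable_sum i\<xi>\<xi>)
  have E\<xi>: "0 \<le> expectation (\<xi> i)" "expectation (\<xi> i) \<le> 1" for i
    using bnd i\<xi> by (auto intro!: Bochner_Integration.integral_nonneg integral_le_const)
  have d1: "0 \<le> expectation (\<lambda>\<omega>. \<xi> j \<omega> * Q \<omega>) - expectation (\<lambda>\<omega>. \<xi> j \<omega> * R \<omega>)"
    using RQ bnd by (simp add: integral_mono[OF i\<xi>R i\<xi>Q] mult_left_mono)
  have "expectation (\<lambda>\<omega>. \<xi> j \<omega> * Q \<omega> - \<xi> j \<omega> * R \<omega>) \<le> expectation (\<lambda>\<omega>. \<xi> j \<omega> * S \<omega>)"
  proof (rule integral_mono)
    show "integrable M (\<lambda>\<omega>. \<xi> j \<omega> * Q \<omega> - \<xi> j \<omega> * R \<omega>)" by (intro Bochner_Integration.integrable_diff i\<xi>Q i\<xi>R)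
    show "\<xi> j \<omega> * Q \<omega> - \<xi> j \<omega> * R \<omega> \<le> \<xi> j \<omega> * S \<omega>" for \<omega>
      using RQ[of \<omega>] bnd[of j \<omega>] by (simp add: right_diff_distrib[symmetric] mult_left_mono)
  qed (rule i\<xi>S)
  also have "\<dots> = (\<Sum>i\<in>{j-m..<j}. expectation (\<lambda>\<omega>. \<xi> i \<omega> * \<xi> j \<omega>))"
    unfolding S_def sum_distrib_left by (subst Bochner_Integration.integral_sum[OF i\<xi>\<xi>]) (simp add: mult.commute)
  finally have d2: "expectation (\<lambda>\<omega>. \<xi> j \<omega> * Q \<omega>) - expectation (\<lambda>\<omega>. \<xi> j \<omega> * R \<omega>) \<le> (\<Sum>i\<in>{j-m..<j}. expectation (\<lambda>\<omega>. \<xi> i \<omega> * \<xi> j \<omega>))"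
    using i\<xi>Q i\<xi>R by simp
  have d3: "0 \<le> expectation Q - expectation R" using integral_mono[OF iR iQ] RQ by simp
  have "expectation (\<lambda>\<omega>. Q \<omega> - R \<omega>) \<le> expectation S"
    by (rule integral_mono) (use RQ iQ iR iS in auto)
  also have "\<dots> = (\<Sum>i\<in>{j-m..<j}. expectation (\<xi> i))"
    unfolding S_def by (rule Bochner_Integration.integral_sum[OF i\<xi>])
  finally have "expectation Q - expectation R \<le> (\<Sum>i\<in>{j-m..<j}. expectation (\<xi> i))" using iQ iR by simp
  then have d4: "expectation (\<xi> j) * (expectation Q - expectation R) \<le> (\<Sum>i\<in>{j-m..<j}. expectation (\<xi> i) * expectation (\<xi> j))"
    by (subst sum_distrib_right[symmetric], subst mult.commute) (rule mult_right_mono[OF _ E\<xi>(1)])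
  have d5: "0 \<le> expectation (\<xi> j) * (expectation Q - expectation R)" using d3 E\<xi>[of j] by simp
  have ind: "expectation (\<lambda>\<omega>. \<xi> j \<omega> * Q \<omega>) = expectation (\<xi> j) * expectation Q"
    using Suc.prems[of j] unfolding Q_def by simp
  \<comment> \<open>By the independence \<open>ind\<close> the difference is E[\<xi> j * (Q - R)] -
    E[\<xi> j] * E[Q - R]. Both terms are nonnegative, and each is bounded by one of the two sums in
    \<open>err\<close>.\<close>
  have one: "\<bar>expectation (\<lambda>\<omega>. (1 - \<xi> j \<omega>) * R \<omega>) - (1 - expectation (\<xi> j)) * expectation R\<bar> \<le> err"
  proof -
    have "expectation (\<lambda>\<omega>. (1 - \<xi> j \<omega>) * R \<omega>) = expectation R - expectation (\<lambda>\<omega>. \<xi> j \<omega> * R \<omega>)"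
      using iR i\<xi>R by (simp add: left_diff_distrib)
    moreover have "err = (\<Sum>i\<in>{j-m..<j}. expectation (\<lambda>\<omega>. \<xi> i \<omega> * \<xi> j \<omega>)) + (\<Sum>i\<in>{j-m..<j}. expectation (\<xi> i) * expectation (\<xi> j))"
      unfolding err_def by (rule sum.distrib)
    ultimately show ?thesis using d1 d2 d4 d5 ind by (simp add: algebra_simps abs_le_iff)
  qed
  define PE where "PE = (\<Prod>i<j. 1 - expectation (\<xi> i))"
  define tot where "tot = (\<Sum>j<j. \<Sum>i\<in>{j-m..<j}. expectation (\<lambda>\<omega>. \<xi> i \<omega> * \<xi> j \<omega>) + expectation (\<xi> i) * expectation (\<xi> j))"
  have IH: "\<bar>expectation R - PE\<bar> \<le> tot" unfolding R_def PE_def tot_def using Suc by simp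
  \<comment> \<open>Errors accumulated so far are not amplified, because they are multiplied by a
    number in [0, 1].\<close>
  have "\<bar>(1 - expectation (\<xi> j)) * expectation R - (1 - expectation (\<xi> j)) * PE\<bar> = (1 - expectation (\<xi> j)) * \<bar>expectation R - PE\<bar>"
    using E\<xi>[of j] by (simp add: right_diff_distrib[symmetric] abs_mult)
  also have "\<dots> \<le> 1 * \<bar>expectation R - PE\<bar>" using E\<xi>[of j] by (intro mult_right_mono) auto
  also have "\<dots> \<le> tot" using IH by simp
  finally have two: "\<bar>(1 - expectation (\<xi> j)) * expectation R - (1 - expectation (\<xi> j)) * PE\<bar> \<le> tot" .
  have pe1: "(\<lambda>\<omega>. \<Prod>i<Suc j. 1 - \<xi> i \<omega>) = (\<lambda>\<omega>. (1 - \<xi> j \<omega>) * R \<omega>)" unfolding R_def by (simp add: mult.commute)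
  have pe2: "(\<Prod>i<Suc j. 1 - expectation (\<xi> i)) = (1 - expectation (\<xi> j)) * PE" unfolding PE_def by (simp add: mult.commute)
  show ?case using one two unfolding pe1 pe2 sum.lessThan_Suc tot_def[symmetric] err_def[symmetric] by linarith
qed (simp add: prob_space)

end

text \<open>The bound 1 - x \<le> exp (- x) gives the upper estimate, and ln (1 - x) \<ge> - x - 2 *
  x^2 for x \<le> 1/2 the lower one. The quadratic correction is at most 2 * b n times the sum,
  which vanishes in the limit.\<close>

lemma prod_one_minus_tendsto_exp:
  fixes p :: "nat \<Rightarrow> nat \<Rightarrow> real"
  assumes b: "b \<longlonglongrightarrow> 0" and p: "eventually (\<lambda>n. \<forall>i<n. 0 \<le> p n i \<and> p n i \<le> b n) sequentially"
    and s: "(\<lambda>n. \<Sum>i<n. p n i) \<longlonglongrightarrow> l"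
  shows "(\<lambda>n. \<Prod>i<n. 1 - p n i) \<longlonglongrightarrow> exp (- l)"
proof -
  have "eventually (\<lambda>n. b n < 1/2) sequentially" using b by (rule order_tendstoD) simp
  then have ev: "eventually (\<lambda>n. \<forall>i<n. 0 \<le> p n i \<and> p n i \<le> b n \<and> p n i \<le> 1/2) sequentially"
    using p by eventually_elim force
  have l1: "(\<lambda>n. exp (- (\<Sum>i<n. p n i))) \<longlonglongrightarrow> exp (- l)" by (intro tendsto_intros s)
  have "(\<lambda>n. exp (- (\<Sum>i<n. p n i) - 2 * b n * (\<Sum>i<n. p n i))) \<longlonglongrightarrow> exp (- l - 2 * 0 * l)"
    by (intro tendsto_intros s b)
  then have l2: "(\<lambda>n. exp (- (\<Sum>i<n. p n i) - 2 * b n * (\<Sum>i<n. p n i))) \<longlonglongrightarrow> exp (- l)" by simp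
  have e1: "eventually (\<lambda>n. (\<Prod>i<n. 1 - p n i) \<le> exp (- (\<Sum>i<n. p n i))) sequentially"
    using ev
  proof eventually_elim
    case (elim n)
    have "(\<Prod>i<n. 1 - p n i) \<le> (\<Prod>i<n. exp (- p n i))"
      using elim by (intro prod_mono) (auto intro: order_trans[OF _ exp_ge_add_one_self])
    then show ?case by (simp add: exp_sum sum_negf[symmetric])
  qed
  have e2: "eventually (\<lambda>n. exp (- (\<Sum>i<n. p n i) - 2 * b n * (\<Sum>i<n. p n i)) \<le> (\<Prod>i<n. 1 - p n i)) sequentially"
    using ev
  proof eventually_elim
    case (elim n)
    have "exp (- (\<Sum>i<n. p n i) - 2 * b n * (\<Sum>i<n. p n i)) = (\<Prod>i<n. exp (- p n i - 2 * b n * p n i))"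
      by (simp add: exp_sum[symmetric] sum_subtractf sum_negf sum_distrib_left)
    also have "\<dots> \<le> (\<Prod>i<n. 1 - p n i)"
    proof (rule prod_mono)
      fix i assume "i \<in> {..<n}"
      then have i: "0 \<le> p n i" "p n i \<le> b n" "p n i \<le> 1/2" using elim by auto
      have "- p n i - 2 * b n * p n i \<le> - p n i - 2 * (p n i)\<^sup>2"
        using mult_right_mono[OF i(2,1)] by (simp add: power2_eq_square)
      also have "\<dots> \<le> ln (1 - p n i)" using i by (intro ln_one_minus_pos_lower_bound) auto
      finally have "exp (- p n i - 2 * b n * p n i) \<le> exp (ln (1 - p n i))" by simp
      then show "0 \<le> exp (- p n i - 2 * b n * p n i) \<and> exp (- p n i - 2 * b n * p n i) \<le> 1 - p n i" using i by simp
    qed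
    finally show ?case .
  qed
  show ?thesis by (rule tendsto_sandwich[OF e2 e1 l2 l1])
qed

section \<open>From generating functions to point probabilities\<close>

text \<open>Once the lower coefficients converge, they can be subtracted. After division by s ^ c,
  what stands behind coefficient c is of order s and is made small by the choice of s, uniformly in
  n because all coefficients lie in [0, 1].\<close>

lemma coeff_tendsto_of_power_series_tendsto:
  fixes p :: "nat \<Rightarrow> nat \<Rightarrow> real"
  assumes p: "\<And>n k. 0 \<le> p n k \<and> p n k \<le> 1" and q: "\<And>k. 0 \<le> q k \<and> q k \<le> 1"
    and lim: "\<And>s. 0 < s \<Longrightarrow> s < 1 \<Longrightarrow> (\<lambda>n. \<Sum>k. p n k * s ^ k) \<longlonglongrightarrow> (\<Sum>k. q k * s ^ k)"
  shows "(\<lambda>n. p n c) \<longlonglongrightarrow> q c"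
proof (induction c rule: less_induct)
  case (less c)
  show ?case
  proof (rule LIMSEQ_I)
    fix \<epsilon> :: real assume "\<epsilon> > 0"
    \<comment> \<open>After division by s ^ c the two tails cost at most 4 * s, hence at most
      \<epsilon> / 4; the bound s \<le> 1/4 makes the geometric sum at most 2.\<close>
    define s where "s = min (1/4) (\<epsilon> / 16)"
    have s: "0 < s" "s \<le> 1/4" "16 * s \<le> \<epsilon>" using \<open>\<epsilon> > 0\<close> by (auto simp: s_def)
    have gs: "summable (\<lambda>k. s ^ k)" using s by (intro summable_geometric) auto
    have tail: "\<bar>(\<Sum>k. f k * s ^ k) - (\<Sum>k<c. f k * s ^ k) - f c * s ^ c\<bar> \<le> 2 * s ^ Suc c"
      if f: "\<And>k. 0 \<le> f k \<and> f k \<le> 1" for f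
    proof -
      have le: "norm (f k * s ^ k) \<le> s ^ k" for k using f[of k] s by (simp add: abs_mult mult_left_le_one_le)
      have sf: "summable (\<lambda>k. f k * s ^ k)" by (rule summable_comparison_test'[OF gs]) (rule le)
      have "(\<Sum>k. f k * s ^ k) = (\<Sum>k. f (k + Suc c) * s ^ (k + Suc c)) + (\<Sum>k<Suc c. f k * s ^ k)"
        by (rule suminf_split_initial_segment[OF sf])
      then have eq: "(\<Sum>k. f k * s ^ k) - (\<Sum>k<c. f k * s ^ k) - f c * s ^ c = (\<Sum>k. f (k + Suc c) * s ^ (k + Suc c))" by simp
      have gs': "summable (\<lambda>k. s ^ (k + Suc c))" using gs by (rule summable_ignore_initial_segment)
      have "norm (\<Sum>k. f (k + Suc c) * s ^ (k + Suc c)) \<le> (\<Sum>k. s ^ (k + Suc c))"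
        by (rule norm_suminf_le[OF _ gs']) (rule le)
      also have "\<dots> = (\<Sum>k. s ^ k) * s ^ Suc c" unfolding power_add using gs by (rule suminf_mult2[symmetric])
      also have "(\<Sum>k. s ^ k) = 1 / (1 - s)" using s by (intro suminf_geometric) auto
      also have "1 / (1 - s) * s ^ Suc c \<le> 2 * s ^ Suc c" using s by (intro mult_right_mono) (auto simp: field_simps)
      finally show ?thesis unfolding eq by simp
    qed
    have l0: "(\<lambda>n. (\<Sum>k. p n k * s ^ k) - (\<Sum>k<c. p n k * s ^ k)) \<longlonglongrightarrow> (\<Sum>k. q k * s ^ k) - (\<Sum>k<c. q k * s ^ k)"
      by (intro tendsto_intros lim less) (use s in auto)
    have "s ^ c * \<epsilon> / 2 > 0" using s \<open>\<epsilon> > 0\<close> by simp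
    from LIMSEQ_D[OF l0 this] obtain n0 where n0: "\<And>n. n \<ge> n0 \<Longrightarrow>
       \<bar>((\<Sum>k. p n k * s ^ k) - (\<Sum>k<c. p n k * s ^ k)) - ((\<Sum>k. q k * s ^ k) - (\<Sum>k<c. q k * s ^ k))\<bar> < s ^ c * \<epsilon> / 2"
      by auto
    have "norm (p n c - q c) < \<epsilon>" if "n \<ge> n0" for n
    proof -
      have "\<bar>p n c * s ^ c - q c * s ^ c\<bar> < s ^ c * \<epsilon> / 2 + 4 * s ^ Suc c"
        using n0[OF that] tail[of "p n", OF p] tail[of q, OF q] by linarith
      also have "4 * s ^ Suc c \<le> s ^ c * \<epsilon> / 2"
        using mult_left_mono[OF s(3), of "s ^ c"] s \<open>\<epsilon> > 0\<close> by (simp add: mult.commute mult.left_commute)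
      finally have less: "\<bar>p n c * s ^ c - q c * s ^ c\<bar> < s ^ c * \<epsilon>" by (simp add: mult.commute)
      have "\<bar>p n c * s ^ c - q c * s ^ c\<bar> = s ^ c * \<bar>p n c - q c\<bar>"
        using s unfolding left_diff_distrib[symmetric] abs_mult by simp
      then have "s ^ c * \<bar>p n c - q c\<bar> < s ^ c * \<epsilon>" using less by simp
      moreover have "s ^ c > 0" using s by simp
      ultimately show ?thesis by (simp only: mult_less_cancel_left_pos real_norm_def)
    qed
    then show "\<exists>no. \<forall>n\<ge>no. norm (p n c - q c) < \<epsilon>" by blast
  qed
qed

definition poisson_weight :: "real \<Rightarrow> nat \<Rightarrow> real" where
  "poisson_weight l k = l ^ k / fact k * exp (- l)"

lemma poisson_weight_sums: "(\<lambda>k. poisson_weight l k * s ^ k) sums exp (- l * (1 - s))"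
proof -
  have "(\<lambda>k. (l * s) ^ k /\<^sub>R fact k) sums exp (l * s)" by (rule exp_converges)
  then have "(\<lambda>k. exp (- l) * ((l * s) ^ k /\<^sub>R fact k)) sums (exp (- l) * exp (l * s))" by (rule sums_mult)
  moreover have "exp (- l) * exp (l * s) = exp (- l * (1 - s))" by (simp add: exp_add[symmetric] algebra_simps)
  ultimately show ?thesis by (simp add: poisson_weight_def power_mult_distrib field_simps scaleR_conv_of_real)
qed

lemma poisson_weight_nonneg: "l \<ge> 0 \<Longrightarrow> 0 \<le> poisson_weight l k"
  by (simp add: poisson_weight_def)

lemma poisson_weight_le_1: "l \<ge> 0 \<Longrightarrow> poisson_weight l k \<le> 1"
proof -
  assume l: "l \<ge> 0"
  have s: "poisson_weight l sums 1" using poisson_weight_sums[of l 1] by simp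
  have "sum (poisson_weight l) {k} \<le> suminf (poisson_weight l)"
    by (rule sum_le_suminf) (use s l in \<open>auto simp: sums_iff poisson_weight_nonneg\<close>)
  then show ?thesis using s by (simp add: sums_iff)
qed

text \<open>The coordinates are converted one at a time. At stage j the first j counts are already
  pinned to their values, while the others still carry a free variable. Moving to the next stage
  means reading off one coefficient of a power series in a single variable, so a one-variable
  statement suffices.\<close>

lemma (in probability) joint_pmf_tendsto_poisson:
  fixes N :: "nat \<Rightarrow> nat \<Rightarrow> 'a \<Rightarrow> nat"
  assumes meas: "\<And>n a. N n a \<in> measurable M (count_space UNIV)" and l: "\<And>a. l a \<ge> 0"
    and pgf: "\<And>t. (\<And>a. 0 \<le> t a \<and> t a \<le> 1) \<Longrightarrow>
       (\<lambda>n. expectation (\<lambda>\<omega>. \<Prod>a<r. t a ^ N n a \<omega>)) \<longlonglongrightarrow> (\<Prod>a<r. exp (- l a * (1 - t a)))"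
  shows "(\<lambda>n. prob {\<omega>\<in>space M. \<forall>a<r. N n a \<omega> = c a}) \<longlonglongrightarrow> (\<Prod>a<r. poisson_weight (l a) (c a))"
proof -
  define F where "F j t a k = (if a < j then of_bool (k = c a) else t a ^ k :: real)" for j t and a k :: nat
  define G where "G j t a = (if a < j then poisson_weight (l a) (c a) else exp (- l a * (1 - t a)))" for j t and a :: nat
  note [measurable] = meas
  have "j \<le> r \<Longrightarrow> (\<And>a. 0 \<le> t a \<and> t a \<le> 1) \<Longrightarrow>
     (\<lambda>n. expectation (\<lambda>\<omega>. \<Prod>a<r. F j t a (N n a \<omega>))) \<longlonglongrightarrow> (\<Prod>a<r. G j t a)" for j t
  proof (induction j arbitrary: t)
    case 0
    then show ?case using pgf[of t] by (simp add: F_def G_def)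
  next
    case (Suc j)
    have jr: "j < r" using Suc.prems by simp
    define A where "A = {..<r} - {j}"
    have A: "{..<r} = insert j A" "finite A" "j \<notin> A" using jr by (auto simp: A_def)
    define H where "H n \<omega> = (\<Prod>a\<in>A. F j t a (N n a \<omega>))" for n \<omega>
    have Fb: "0 \<le> F j t a k" "F j t a k \<le> 1" for a k using Suc.prems(2)[of a] by (auto simp: F_def power_le_one)
    have Hb: "0 \<le> H n \<omega>" "H n \<omega> \<le> 1" for n \<omega> unfolding H_def by (auto intro!: prod_nonneg prod_le_1 Fb)
    have [measurable]: "H n \<in> borel_measurable M" for n unfolding H_def by measurable
    \<comment> \<open>The coefficient of s ^ k when the variable of coordinate j is called s: the
      event that count j equals k, weighted by the factors of all other coordinates.\<close>
    define p where "p n k = expectation (\<lambda>\<omega>. of_bool (N n j \<omega> = k) * H n \<omega>)" for n k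
    define q where "q k = poisson_weight (l j) k * (\<Prod>a\<in>A. G j t a)" for k
    have G01: "0 \<le> G j t a" "G j t a \<le> 1" for a
      using Suc.prems(2)[of a] l[of a] by (auto simp: G_def poisson_weight_nonneg poisson_weight_le_1)
    have int: "integrable M (\<lambda>\<omega>. of_bool (N n j \<omega> = k) * H n \<omega>)" for n k
      by (rule integrable_const_bound[of _ 1]) (use Hb in \<open>auto simp: of_bool_def\<close>)
    have "(\<lambda>n. p n (c j)) \<longlonglongrightarrow> q (c j)"
    proof (rule coeff_tendsto_of_power_series_tendsto)
      show "0 \<le> p n k \<and> p n k \<le> 1" for n k
      proof
        show "0 \<le> p n k" unfolding p_def using Hb by (intro Bochner_Integration.integral_nonneg) simp
        show "p n k \<le> 1" unfolding p_def using Hb by (intro integral_le_const[OF int]) (simp add: of_bool_def)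
      qed
      show "0 \<le> q k \<and> q k \<le> 1" for k unfolding q_def
        using G01 l by (auto intro!: mult_nonneg_nonneg prod_nonneg mult_le_one prod_le_1 poisson_weight_nonneg poisson_weight_le_1)
      fix s :: real assume s: "0 < s" "s < 1"
      \<comment> \<open>The induction hypothesis holds for all choices of the free variables, so the
        one of coordinate j may be set to s.\<close>
      define t' where "t' = t(j := s)"
      have t': "0 \<le> t' a \<and> t' a \<le> 1" for a using Suc.prems(2)[of a] s by (auto simp: t'_def)
      have FA: "F j t' a = F j t a" and GA: "G j t' a = G j t a" if "a \<in> A" for a
        using that by (auto simp: F_def G_def t'_def A_def fun_eq_iff)
      have "(\<lambda>n. expectation (\<lambda>\<omega>. \<Prod>a<r. F j t' a (N n a \<omega>))) \<longlonglongrightarrow> (\<Prod>a<r. G j t' a)"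
        using Suc.IH[of t'] t' jr by simp
      moreover have "expectation (\<lambda>\<omega>. \<Prod>a<r. F j t' a (N n a \<omega>)) = (\<Sum>k. p n k * s ^ k)" for n
      proof -
        have e: "(\<Prod>a<r. F j t' a (N n a \<omega>)) = s ^ N n j \<omega> * H n \<omega>" for \<omega>
        proof -
          have "(\<Prod>a\<in>A. F j t' a (N n a \<omega>)) = H n \<omega>" unfolding H_def by (rule prod.cong) (simp_all add: FA)
          then show ?thesis unfolding A(1) prod.insert[OF A(2,3)] by (simp add: F_def t'_def)
        qed
        have ss: "(\<lambda>k. of_bool (N n j \<omega> = k) * H n \<omega> * s ^ k) sums (s ^ N n j \<omega> * H n \<omega>)" for \<omega>
        proof -
          have "(\<lambda>k. of_bool (N n j \<omega> = k) * H n \<omega> * s ^ k) = (\<lambda>k. if k = N n j \<omega> then H n \<omega> * s ^ k else 0)"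
            by auto
          then show ?thesis using sums_single[of "N n j \<omega>" "\<lambda>k. H n \<omega> * s ^ k"] by (simp add: mult.commute)
        qed
        have le: "norm (of_bool (N n j \<omega> = k) * H n \<omega> * s ^ k) \<le> s ^ k" for k \<omega>
          using Hb[of n \<omega>] s by (simp add: of_bool_def mult_left_le_one_le)
        have gs: "summable (\<lambda>k. s ^ k)" using s by (intro summable_geometric) auto
        have "expectation (\<lambda>\<omega>. \<Sum>k. of_bool (N n j \<omega> = k) * H n \<omega> * s ^ k) = (\<Sum>k. expectation (\<lambda>\<omega>. of_bool (N n j \<omega> = k) * H n \<omega> * s ^ k))"
        proof (rule integral_suminf)
          show "integrable M (\<lambda>\<omega>. of_bool (N n j \<omega> = k) * H n \<omega> * s ^ k)" for k using int by (intro integrable_mult_left) auto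
          show "AE \<omega> in M. summable (\<lambda>k. norm (of_bool (N n j \<omega> = k) * H n \<omega> * s ^ k))"
            by (intro AE_I2 summable_comparison_test'[OF gs]) (use le in auto)
          show "summable (\<lambda>k. expectation (\<lambda>\<omega>. norm (of_bool (N n j \<omega> = k) * H n \<omega> * s ^ k)))"
          proof (rule summable_comparison_test'[OF gs])
            fix k
            have "expectation (\<lambda>\<omega>. norm (of_bool (N n j \<omega> = k) * H n \<omega> * s ^ k)) \<le> s ^ k"
            proof (rule integral_le_const)
              show "integrable M (\<lambda>\<omega>. norm (of_bool (N n j \<omega> = k) * H n \<omega> * s ^ k))"
                by (intro integrable_norm integrable_mult_left) (rule int)
            qed (use le in auto)
            then show "norm (expectation (\<lambda>\<omega>. norm (of_bool (N n j \<omega> = k) * H n \<omega> * s ^ k))) \<le> s ^ k"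
              by (subst real_norm_def, subst abs_of_nonneg) (auto intro!: Bochner_Integration.integral_nonneg)
          qed
        qed
        then show ?thesis unfolding e p_def using ss by (simp add: sums_iff)
      qed
      moreover have "(\<Prod>a<r. G j t' a) = (\<Sum>k. q k * s ^ k)"
      proof -
        have "(\<lambda>k. poisson_weight (l j) k * s ^ k * (\<Prod>a\<in>A. G j t a)) sums (exp (- l j * (1 - s)) * (\<Prod>a\<in>A. G j t a))"
          by (rule sums_mult2[OF poisson_weight_sums])
        then have "(\<lambda>k. q k * s ^ k) sums (exp (- l j * (1 - s)) * (\<Prod>a\<in>A. G j t a))"
          unfolding q_def by (simp add: mult.commute mult.left_commute)
        moreover have "(\<Prod>a<r. G j t' a) = exp (- l j * (1 - s)) * (\<Prod>a\<in>A. G j t a)"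
        proof -
          have "(\<Prod>a\<in>A. G j t' a) = (\<Prod>a\<in>A. G j t a)" by (rule prod.cong) (simp_all add: GA)
          then show ?thesis unfolding A(1) prod.insert[OF A(2,3)] by (simp add: G_def t'_def)
        qed
        ultimately show ?thesis by (simp add: sums_iff)
      qed
      ultimately show "(\<lambda>n. \<Sum>k. p n k * s ^ k) \<longlonglongrightarrow> (\<Sum>k. q k * s ^ k)" by simp
    qed
    moreover have "(\<Prod>a<r. F (Suc j) t a (N n a \<omega>)) = of_bool (N n j \<omega> = c j) * H n \<omega>" for n \<omega>
    proof -
      have "(\<Prod>a\<in>A. F (Suc j) t a (N n a \<omega>)) = H n \<omega>"
        unfolding H_def by (rule prod.cong) (auto simp: F_def A_def)
      then show ?thesis unfolding A(1) prod.insert[OF A(2,3)] by (simp add: F_def)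
    qed
    moreover have "(\<Prod>a<r. G (Suc j) t a) = q (c j)"
    proof -
      have "(\<Prod>a\<in>A. G (Suc j) t a) = (\<Prod>a\<in>A. G j t a)"
        by (rule prod.cong) (auto simp: G_def A_def)
      then show ?thesis unfolding A(1) q_def prod.insert[OF A(2,3)] by (simp add: G_def)
    qed
    ultimately show ?case unfolding p_def by simp
  qed
  from this[of r "\<lambda>_. 1"] have lim: "(\<lambda>n. expectation (\<lambda>\<omega>. \<Prod>a<r. F r (\<lambda>_. 1) a (N n a \<omega>))) \<longlonglongrightarrow> (\<Prod>a<r. G r (\<lambda>_. 1) a)" by simp
  have e1: "expectation (\<lambda>\<omega>. \<Prod>a<r. F r (\<lambda>_. 1) a (N n a \<omega>)) = prob {\<omega>\<in>space M. \<forall>a<r. N n a \<omega> = c a}" for n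
  proof -
    have "expectation (\<lambda>\<omega>. \<Prod>a<r. F r (\<lambda>_. 1) a (N n a \<omega>)) = expectation (indicator {\<omega>\<in>space M. \<forall>a<r. N n a \<omega> = c a})"
      by (intro Bochner_Integration.integral_cong) (auto simp: F_def indicator_def of_bool_def prod_zero_iff)
    then show ?thesis by simp
  qed
  have e2: "(\<Prod>a<r. G r (\<lambda>_. 1) a) = (\<Prod>a<r. poisson_weight (l a) (c a))" by (simp add: G_def)
  show ?thesis using lim unfolding e1 e2 .
qed

subsection \<open>Convergence of finite count vectors\<close>

text \<open>Count vectors are coded as functions vanishing from r on. There are only countably many,
  so measurability and laws can be checked on single vectors.\<close>

lemma countable_finite_support: "countable {c :: nat \<Rightarrow> nat. \<forall>a\<ge>r. c a = 0}"
proof (rule countable_subset)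
  show "{c :: nat \<Rightarrow> nat. \<forall>a\<ge>r. c a = 0} \<subseteq> range (\<lambda>xs a. if a < length xs then xs ! a else 0)"
  proof
    fix c :: "nat \<Rightarrow> nat" assume "c \<in> {c. \<forall>a\<ge>r. c a = 0}"
    then have "c = (\<lambda>a. if a < length (map c [0..<r]) then map c [0..<r] ! a else 0)" by (auto simp: fun_eq_iff)
    then show "c \<in> range (\<lambda>xs a. if a < length xs then xs ! a else 0)" by (rule image_eqI) simp
  qed
qed simp

lemma finite_bounded_support: "finite {c :: nat \<Rightarrow> nat. (\<forall>a\<ge>r. c a = 0) \<and> (\<forall>a<r. c a \<le> R)}"
proof (rule finite_subset)
  show "{c :: nat \<Rightarrow> nat. (\<forall>a\<ge>r. c a = 0) \<and> (\<forall>a<r. c a \<le> R)} \<subseteq> (\<lambda>f a. if a < r then f a else 0) ` (PiE {..<r} (\<lambda>_. {..R}))"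
  proof
    fix c :: "nat \<Rightarrow> nat" assume c: "c \<in> {c. (\<forall>a\<ge>r. c a = 0) \<and> (\<forall>a<r. c a \<le> R)}"
    then have "c = (\<lambda>a. if a < r then restrict c {..<r} a else 0)" by (auto simp: fun_eq_iff)
    then show "c \<in> (\<lambda>f a. if a < r then f a else 0) ` (PiE {..<r} (\<lambda>_. {..R}))"
      by (rule image_eqI[where x="restrict c {..<r}"]) (use c in \<open>auto simp: PiE_iff\<close>)
  qed
qed (intro finite_imageI finite_PiE, auto)

context probability
begin

lemma measurable_count_vector:
  fixes C :: "'a \<Rightarrow> nat \<Rightarrow> nat"
  assumes C: "\<And>a. a < r \<Longrightarrow> (\<lambda>\<omega>. C \<omega> a) \<in> measurable M (count_space UNIV)" "\<And>\<omega> a. r \<le> a \<Longrightarrow> C \<omega> a = (0::nat)"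
  shows "C \<in> measurable M (count_space {c. \<forall>a\<ge>r. c a = 0})"
proof (rule measurable_count_space_eq_countable[OF countable_finite_support, THEN iffD2], intro conjI ballI)
  show "C \<in> space M \<rightarrow> {c. \<forall>a\<ge>r. c a = 0}" using C(2) by auto
  fix c :: "nat \<Rightarrow> nat" assume c: "c \<in> {c. \<forall>a\<ge>r. c a = 0}"
  have "C -` {c} \<inter> space M = {\<omega> \<in> space M. \<forall>a\<in>{..<r}. C \<omega> a = c a}"
  proof -
    have "C \<omega> = c" if "\<forall>a<r. C \<omega> a = c a" for \<omega>
    proof
      fix a show "C \<omega> a = c a" using that c C(2)[of a \<omega>] by (cases "a < r") auto
    qed
    then show ?thesis by blast
  qed
  also have "\<dots> \<in> sets M"
  proof (rule sets.sets_Collect_finite_All)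
    fix a assume "a \<in> {..<r}"
    then have "(\<lambda>\<omega>. C \<omega> a) -` {c a} \<inter> space M \<in> sets M" using C(1) by (intro measurable_sets) auto
    then show "{\<omega> \<in> space M. C \<omega> a = c a} \<in> sets M" by (simp add: vimage_def Int_def conj_commute)
  qed simp
  finally show "C -` {c} \<inter> space M \<in> sets M" .
qed

text \<open>On D the expectation is the finite sum; off D the function h contributes at most b times
  the missing mass.\<close>

lemma expectation_count_vector_approx:
  fixes h :: "(nat \<Rightarrow> nat) \<Rightarrow> real"
  assumes C: "C \<in> measurable M (count_space {c. \<forall>a\<ge>r. c a = 0})"
    and D: "finite D" "D \<subseteq> {c. \<forall>a\<ge>r. c a = 0}" and h: "\<And>c. \<bar>h c\<bar> \<le> b"
  shows "\<bar>expectation (\<lambda>\<omega>. h (C \<omega>)) - (\<Sum>c\<in>D. h c * prob {\<omega>\<in>space M. C \<omega> = c})\<bar> \<le> b * (1 - (\<Sum>c\<in>D. prob {\<omega>\<in>space M. C \<omega> = c}))"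
proof -
  have m: "(\<lambda>\<omega>. g (C \<omega>)) \<in> borel_measurable M" for g :: "(nat \<Rightarrow> nat) \<Rightarrow> real"
    by (rule measurable_compose[OF C]) simp
  have i: "integrable M (\<lambda>\<omega>. g (C \<omega>))" if "\<And>c. \<bar>g c\<bar> \<le> a" for g :: "(nat \<Rightarrow> nat) \<Rightarrow> real" and a
    by (rule integrable_const_bound[of _ a]) (use that m in auto)
  have ic: "expectation (\<lambda>\<omega>. \<Sum>c\<in>D. g c * of_bool (C \<omega> = c)) = (\<Sum>c\<in>D. g c * prob {\<omega>\<in>space M. C \<omega> = c})"
    and iic: "integrable M (\<lambda>\<omega>. \<Sum>c\<in>D. g c * of_bool (C \<omega> = c))" for g :: "(nat \<Rightarrow> nat) \<Rightarrow> real"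
  proof -
    have *: "integrable M (\<lambda>\<omega>. g c * of_bool (C \<omega> = c))" for c
      by (rule i[of "\<lambda>x. g c * of_bool (x = c)" "\<bar>g c\<bar>"]) (auto simp: of_bool_def)
    then show "integrable M (\<lambda>\<omega>. \<Sum>c\<in>D. g c * of_bool (C \<omega> = c))" by (rule Bochner_Integration.integrable_sum)
    have "expectation (\<lambda>\<omega>. of_bool (C \<omega> = c)) = prob {\<omega>\<in>space M. C \<omega> = c}" for c
    proof -
      have "expectation (\<lambda>\<omega>. of_bool (C \<omega> = c)) = expectation (indicator {\<omega>\<in>space M. C \<omega> = c})"
        by (rule Bochner_Integration.integral_cong) (auto simp: indicator_def)
      also have "\<dots> = prob ({\<omega>\<in>space M. C \<omega> = c} \<inter> space M)" by (rule Bochner_Integration.integral_indicator)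
      also have "{\<omega>\<in>space M. C \<omega> = c} \<inter> space M = {\<omega>\<in>space M. C \<omega> = c}" by blast
      finally show ?thesis .
    qed
    then show "expectation (\<lambda>\<omega>. \<Sum>c\<in>D. g c * of_bool (C \<omega> = c)) = (\<Sum>c\<in>D. g c * prob {\<omega>\<in>space M. C \<omega> = c})"
      using * by (subst Bochner_Integration.integral_sum) auto
  qed
  have "\<bar>expectation (\<lambda>\<omega>. h (C \<omega>)) - (\<Sum>c\<in>D. h c * prob {\<omega>\<in>space M. C \<omega> = c})\<bar>
      = \<bar>expectation (\<lambda>\<omega>. h (C \<omega>) - (\<Sum>c\<in>D. h c * of_bool (C \<omega> = c)))\<bar>"
    unfolding ic[symmetric] by (subst Bochner_Integration.integral_diff[OF i[of h b, OF h] iic]) (rule refl)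
  also have "\<dots> \<le> expectation (\<lambda>\<omega>. \<bar>h (C \<omega>) - (\<Sum>c\<in>D. h c * of_bool (C \<omega> = c))\<bar>)"
    by (rule integral_abs_bound)
  also have "\<dots> \<le> expectation (\<lambda>\<omega>. b - (\<Sum>c\<in>D. b * of_bool (C \<omega> = c)))"
  proof (rule integral_mono)
    show "integrable M (\<lambda>\<omega>. \<bar>h (C \<omega>) - (\<Sum>c\<in>D. h c * of_bool (C \<omega> = c))\<bar>)"
      by (intro integrable_abs Bochner_Integration.integrable_diff i[of h b, OF h] iic)
    show "integrable M (\<lambda>\<omega>. b - (\<Sum>c\<in>D. b * of_bool (C \<omega> = c)))"
      by (intro Bochner_Integration.integrable_diff iic) simp
    fix \<omega>
    have "(\<Sum>c\<in>D. g c * of_bool (C \<omega> = c)) = (if C \<omega> \<in> D then g (C \<omega>) else 0)" for g :: "(nat \<Rightarrow> nat) \<Rightarrow> real"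
      using D(1) by (simp add: of_bool_def if_distrib[of "\<lambda>x. _ * x"] sum.delta cong: if_cong)
    then show "\<bar>h (C \<omega>) - (\<Sum>c\<in>D. h c * of_bool (C \<omega> = c))\<bar> \<le> b - (\<Sum>c\<in>D. b * of_bool (C \<omega> = c))"
      using h[of "C \<omega>"] by simp
  qed
  also have "\<dots> = b * (1 - (\<Sum>c\<in>D. prob {\<omega>\<in>space M. C \<omega> = c}))"
    using iic[of "\<lambda>_. b"] by (simp add: ic prob_space right_diff_distrib sum_distrib_left)
  finally show ?thesis .
qed

end

text \<open>A Scheffe argument. A finite box carries nearly all of the limit mass, and convergence
  of its finitely many point masses makes the laws of \<open>C n\<close> carry nearly all of theirs
  in the same box. No tightness has to be assumed, because the limit has total mass one; h may be
  any bounded function, as the space is discrete.\<close>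

lemma expectation_tendsto_of_pmf_tendsto:
  fixes h :: "(nat \<Rightarrow> nat) \<Rightarrow> real"
  assumes M: "prob_space M" and N: "prob_space N"
    and C: "\<And>n. C n \<in> measurable M (count_space {c. \<forall>a\<ge>r. c a = 0})"
    and C': "C' \<in> measurable N (count_space {c. \<forall>a\<ge>r. c a = 0})"
    and lim: "\<And>c. \<forall>a\<ge>r. c a = 0 \<Longrightarrow> (\<lambda>n. measure M {\<omega>\<in>space M. C n \<omega> = c}) \<longlonglongrightarrow> measure N {\<omega>\<in>space N. C' \<omega> = c}"
    and h: "\<And>c. \<bar>h c\<bar> \<le> b"
  shows "(\<lambda>n. \<integral>\<omega>. h (C n \<omega>) \<partial>M) \<longlonglongrightarrow> (\<integral>\<omega>. h (C' \<omega>) \<partial>N)"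
proof (rule LIMSEQ_I)
  interpret M: probability M using M by (simp add: probability_def)
  interpret N: probability N using N by (simp add: probability_def)
  fix \<epsilon> :: real assume \<epsilon>: "\<epsilon> > 0"
  have b: "b \<ge> 0" using h[of undefined] by simp
  define D where "D R = {c :: nat \<Rightarrow> nat. (\<forall>a\<ge>r. c a = 0) \<and> (\<forall>a<r. c a \<le> R)}" for R
  have Dfin: "finite (D R)" for R unfolding D_def by (rule finite_bounded_support)
  have DK: "D R \<subseteq> {c. \<forall>a\<ge>r. c a = 0}" for R unfolding D_def by auto
  define q where "q c = measure N {\<omega>\<in>space N. C' \<omega> = c}" for c
  have pD: "sum q (D R) = measure N (C' -` D R \<inter> space N)" for R
  proof -
    have "measure N (\<Union>c\<in>D R. {\<omega>\<in>space N. C' \<omega> = c}) = (\<Sum>c\<in>D R. measure N {\<omega>\<in>space N. C' \<omega> = c})"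
    proof (rule N.finite_measure_finite_Union[OF Dfin])
      show "(\<lambda>c. {\<omega>\<in>space N. C' \<omega> = c}) ` D R \<subseteq> sets N"
      proof safe
        fix c assume "c \<in> D R"
        then have "C' -` {c} \<inter> space N \<in> sets N" using DK[of R] by (intro measurable_sets[OF C']) auto
        then show "{\<omega>\<in>space N. C' \<omega> = c} \<in> sets N" by (simp add: vimage_def Int_def conj_commute)
      qed
    qed (auto simp: disjoint_family_on_def)
    moreover have "(\<Union>c\<in>D R. {\<omega>\<in>space N. C' \<omega> = c}) = C' -` D R \<inter> space N" by auto
    ultimately show ?thesis unfolding q_def by simp
  qed
  have "(\<lambda>R. measure N (C' -` D R \<inter> space N)) \<longlonglongrightarrow> measure N (\<Union>R. C' -` D R \<inter> space N)"
  proof (rule N.finite_Lim_measure_incseq)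
    show "range (\<lambda>R. C' -` D R \<inter> space N) \<subseteq> sets N" using DK by (auto intro!: measurable_sets[OF C'])
    show "incseq (\<lambda>R. C' -` D R \<inter> space N)" by (rule incseq_SucI) (auto simp: D_def le_Suc_eq)
  qed
  moreover have "(\<Union>R. C' -` D R \<inter> space N) = space N"
  proof
    show "space N \<subseteq> (\<Union>R. C' -` D R \<inter> space N)"
    proof
      fix \<omega> assume w: "\<omega> \<in> space N"
      then have "C' \<omega> \<in> {c. \<forall>a\<ge>r. c a = 0}" using measurable_space[OF C'] by auto
      moreover have "C' \<omega> a \<le> Max (insert 0 (C' \<omega> ` {..<r}))" if "a < r" for a using that by (intro Max_ge) auto
      ultimately have "C' \<omega> \<in> D (Max (insert 0 (C' \<omega> ` {..<r})))" unfolding D_def by auto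
      then show "\<omega> \<in> (\<Union>R. C' -` D R \<inter> space N)" using w by blast
    qed
  qed auto
  ultimately have "(\<lambda>R. sum q (D R)) \<longlonglongrightarrow> 1" by (simp add: pD N.prob_space)
  then have "eventually (\<lambda>R. sum q (D R) > 1 - \<epsilon> / (4 * (b + 1))) sequentially"
    by (rule order_tendstoD) (use \<epsilon> b in simp)
  then obtain R where R: "1 - sum q (D R) < \<epsilon> / (4 * (b + 1))" by (auto simp: eventually_sequentially algebra_simps)
  have small: "b * (1 - sum q (D R)) < \<epsilon> / 4"
  proof -
    have "0 \<le> 1 - sum q (D R)" unfolding pD by simp
    then have "b * (1 - sum q (D R)) \<le> (b + 1) * (1 - sum q (D R))" by (intro mult_right_mono) auto
    also have "\<dots> < (b + 1) * (\<epsilon> / (4 * (b + 1)))" using R b by (intro mult_strict_left_mono) auto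
    also have "\<dots> = \<epsilon> / 4" using b by (simp add: divide_simps)
    finally show ?thesis .
  qed
  define p where "p n c = measure M {\<omega>\<in>space M. C n \<omega> = c}" for n c
  have lp: "(\<lambda>n. p n c) \<longlonglongrightarrow> q c" if "c \<in> D R" for c
    unfolding p_def q_def using lim DK that by blast
  have "(\<lambda>n. (\<Sum>c\<in>D R. h c * p n c)) \<longlonglongrightarrow> (\<Sum>c\<in>D R. h c * q c)" by (intro tendsto_sum tendsto_mult_left lp)
  from LIMSEQ_D[OF this, of "\<epsilon>/4"] \<epsilon> obtain n1 where n1: "\<And>n. n \<ge> n1 \<Longrightarrow> \<bar>(\<Sum>c\<in>D R. h c * p n c) - (\<Sum>c\<in>D R. h c * q c)\<bar> < \<epsilon>/4" by auto
  \<comment> \<open>The mass outside the box converges along with the point masses inside it, so it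
    is eventually as small as in the limit.\<close>
  have "(\<lambda>n. b * (1 - sum (p n) (D R))) \<longlonglongrightarrow> b * (1 - sum q (D R))" by (intro tendsto_intros lp)
  then have "eventually (\<lambda>n. b * (1 - sum (p n) (D R)) < \<epsilon>/4) sequentially" using small by (rule order_tendstoD)
  then obtain n2 where n2: "\<And>n. n \<ge> n2 \<Longrightarrow> b * (1 - sum (p n) (D R)) < \<epsilon>/4" by (auto simp: eventually_sequentially)
  have "norm ((\<integral>\<omega>. h (C n \<omega>) \<partial>M) - (\<integral>\<omega>. h (C' \<omega>) \<partial>N)) < \<epsilon>" if n: "n \<ge> max n1 n2" for n
  proof -
    have "\<bar>(\<integral>\<omega>. h (C n \<omega>) \<partial>M) - (\<Sum>c\<in>D R. h c * p n c)\<bar> \<le> b * (1 - sum (p n) (D R))"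
      unfolding p_def by (rule M.expectation_count_vector_approx[OF C Dfin DK h])
    moreover have "\<bar>(\<integral>\<omega>. h (C' \<omega>) \<partial>N) - (\<Sum>c\<in>D R. h c * q c)\<bar> \<le> b * (1 - sum q (D R))"
      unfolding q_def by (rule N.expectation_count_vector_approx[OF C' Dfin DK h])
    moreover have "\<bar>(\<Sum>c\<in>D R. h c * p n c) - (\<Sum>c\<in>D R. h c * q c)\<bar> < \<epsilon>/4" "b * (1 - sum (p n) (D R)) < \<epsilon>/4"
      using n n1[of n] n2[of n] by auto
    ultimately show ?thesis using small unfolding real_norm_def by linarith
  qed
  then show "\<exists>no. \<forall>n\<ge>no. norm ((\<integral>\<omega>. h (C n \<omega>) \<partial>M) - (\<integral>\<omega>. h (C' \<omega>) \<partial>N)) < \<epsilon>" by blast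
qed

text \<open>At most one factor differs from 1, because v lies in at most one of the sets. This makes
  the expectation of \<xi> linear in the cell probabilities.\<close>

lemma one_minus_prod_disjoint:
  fixes t :: "nat \<Rightarrow> real"
  assumes "disjoint_family_on B {..<r}"
  shows "1 - (\<Prod>a<r. if v \<in> B a then t a else 1) = (\<Sum>a<r. (1 - t a) * of_bool (v \<in> B a))"
proof (cases "\<exists>a<r. v \<in> B a")
  case True
  then obtain a where a: "a < r" "v \<in> B a" by blast
  have other: "v \<notin> B b" if "b \<in> {..<r} - {a}" for b
    using assms a that by (auto simp: disjoint_family_on_def)
  have "(\<Prod>b<r. if v \<in> B b then t b else 1) = t a * (\<Prod>b\<in>{..<r} - {a}. if v \<in> B b then t b else 1)"
    using a by (subst prod.remove[of _ a]) auto
  also have "(\<Prod>b\<in>{..<r} - {a}. if v \<in> B b then t b else 1) = 1" using other by (intro prod.neutral) auto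
  finally have 1: "(\<Prod>b<r. if v \<in> B b then t b else 1) = t a" by simp
  have "(\<Sum>b<r. (1 - t b) * of_bool (v \<in> B b)) = (1 - t a) + (\<Sum>b\<in>{..<r} - {a}. (1 - t b) * of_bool (v \<in> B b))"
    using a by (subst sum.remove[of _ a]) auto
  also have "(\<Sum>b\<in>{..<r} - {a}. (1 - t b) * of_bool (v \<in> B b)) = 0" using other by (intro sum.neutral) auto
  finally show ?thesis using 1 by simp
qed simp

text \<open>The hypothesis \<open>P1\<close> makes the individual terms uniformly small, and
  \<open>P2\<close> excludes clustering: at most n * m pairs of indices are close, each costing O(1
  / n^2). Independence is asked for every g with values in [0, 1], because the function used depends
  on the variables of the generating function.\<close>

lemma (in probability) counts_tendsto_poisson:
  fixes V :: "nat \<Rightarrow> nat \<Rightarrow> 'a \<Rightarrow> real" and B :: "nat \<Rightarrow> real set"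
  assumes V [measurable]: "\<And>n i. V n i \<in> borel_measurable M" and B [measurable]: "\<And>a. B a \<in> sets borel"
    and dis: "disjoint_family_on B {..<r}" and l: "\<And>a. l a \<ge> 0"
    and indep: "\<And>n j g. g \<in> borel_measurable borel \<Longrightarrow> (\<And>v. 0 \<le> g v \<and> g v \<le> (1::real)) \<Longrightarrow>
       expectation (\<lambda>\<omega>. (1 - g (V n j \<omega>)) * (\<Prod>i<j-m. g (V n i \<omega>))) = expectation (\<lambda>\<omega>. 1 - g (V n j \<omega>)) * expectation (\<lambda>\<omega>. \<Prod>i<j-m. g (V n i \<omega>))"
    and P1: "eventually (\<lambda>n. \<forall>i<n. prob {\<omega>\<in>space M. V n i \<omega> \<in> (\<Union>a<r. B a)} \<le> K / real n) sequentially"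
    and P2: "eventually (\<lambda>n. \<forall>i j. i < j \<longrightarrow> j < n \<longrightarrow> j \<le> i + m \<longrightarrow> prob {\<omega>\<in>space M. V n i \<omega> \<in> (\<Union>a<r. B a) \<and> V n j \<omega> \<in> (\<Union>a<r. B a)} \<le> K / (real n)\<^sup>2) sequentially"
    and intens: "\<And>a. a < r \<Longrightarrow> (\<lambda>n. \<Sum>i<n. prob {\<omega>\<in>space M. V n i \<omega> \<in> B a}) \<longlonglongrightarrow> l a"
  shows "(\<lambda>n. prob {\<omega>\<in>space M. \<forall>a<r. card {i. i < n \<and> V n i \<omega> \<in> B a} = c a}) \<longlonglongrightarrow> (\<Prod>a<r. poisson_weight (l a) (c a))"
proof (rule joint_pmf_tendsto_poisson)
  have cardeq: "card {i. i < n \<and> V n i \<omega> \<in> B a} = (\<Sum>i<n. of_bool (V n i \<omega> \<in> B a))" for n a \<omega>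
  proof -
    have "{i. i < n \<and> V n i \<omega> \<in> B a} = {i\<in>{..<n}. V n i \<omega> \<in> B a}" by auto
    then have "card {i. i < n \<and> V n i \<omega> \<in> B a} = (\<Sum>i\<in>{i\<in>{..<n}. V n i \<omega> \<in> B a}. 1)" by simp
    also have "\<dots> = (\<Sum>i<n. if V n i \<omega> \<in> B a then 1 else 0)" by (rule sum.inter_filter) simp
    finally show ?thesis by (simp only: of_bool_def)
  qed
  show "(\<lambda>\<omega>. card {i. i < n \<and> V n i \<omega> \<in> B a}) \<in> measurable M (count_space UNIV)" for n a
    unfolding cardeq by measurable
  show "l a \<ge> 0" for a by (rule l)
  fix t :: "nat \<Rightarrow> real" assume t: "\<And>a. 0 \<le> t a \<and> t a \<le> 1"
  define g where "g v = (\<Prod>a<r. if v \<in> B a then t a else 1)" for v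
  define U where "U = (\<Union>a<r. B a)"
  have Um [measurable]: "U \<in> sets borel" unfolding U_def by measurable
  have gm [measurable]: "g \<in> borel_measurable borel" unfolding g_def by measurable
  have g01: "0 \<le> g v \<and> g v \<le> 1" for v unfolding g_def using t by (auto intro!: prod_nonneg prod_le_1)
  have gU: "1 - g v \<le> of_bool (v \<in> U)" for v
  proof (cases "v \<in> U")
    case False
    then have "g v = 1" unfolding g_def U_def by (intro prod.neutral) auto
    then show ?thesis by simp
  qed (use g01 in simp)
  define \<xi> where "\<xi> n i \<omega> = 1 - g (V n i \<omega>)" for n i \<omega>
  have \<xi>m [measurable]: "\<xi> n i \<in> borel_measurable M" for n i unfolding \<xi>_def by measurable
  have \<xi>01: "0 \<le> \<xi> n i \<omega> \<and> \<xi> n i \<omega> \<le> 1" for n i \<omega> unfolding \<xi>_def using g01[of "V n i \<omega>"] by simp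
  have prodeq: "(\<Prod>a<r. t a ^ card {i. i < n \<and> V n i \<omega> \<in> B a}) = (\<Prod>i<n. 1 - \<xi> n i \<omega>)" for n \<omega>
  proof -
    have "(\<Prod>a<r. t a ^ card {i. i < n \<and> V n i \<omega> \<in> B a}) = (\<Prod>a<r. \<Prod>i<n. if V n i \<omega> \<in> B a then t a else 1)"
      unfolding cardeq power_sum by (intro prod.cong refl) auto
    also have "\<dots> = (\<Prod>i<n. 1 - \<xi> n i \<omega>)" unfolding \<xi>_def g_def by (subst prod.swap) simp
    finally show ?thesis .
  qed
  have ib: "integrable M f" if "f \<in> borel_measurable M" "\<And>\<omega>. 0 \<le> f \<omega> \<and> f \<omega> \<le> 1" for f :: "'a \<Rightarrow> real"
    by (rule integrable_const_bound[of _ 1]) (use that in auto)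
  have E\<xi>: "expectation (\<xi> n i) = (\<Sum>a<r. (1 - t a) * prob {\<omega>\<in>space M. V n i \<omega> \<in> B a})" for n i
  proof -
    have "expectation (\<xi> n i) = expectation (\<lambda>\<omega>. \<Sum>a<r. (1 - t a) * indicator {\<omega>\<in>space M. V n i \<omega> \<in> B a} \<omega>)"
      unfolding \<xi>_def g_def one_minus_prod_disjoint[OF dis]
      by (intro Bochner_Integration.integral_cong refl sum.cong) (auto simp: indicator_def)
    also have "\<dots> = (\<Sum>a<r. (1 - t a) * prob {\<omega>\<in>space M. V n i \<omega> \<in> B a})"
    proof -
      have "integrable M (indicator {\<omega>\<in>space M. V n i \<omega> \<in> B a} :: 'a \<Rightarrow> real)" for a
        by (rule integrable_real_indicator) (measurable, simp add: emeasure_eq_measure)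
      then show ?thesis by (subst Bochner_Integration.integral_sum) auto
    qed
    finally show ?thesis .
  qed
  have E\<xi>0: "0 \<le> expectation (\<xi> n i)" for n i using \<xi>01 by (intro Bochner_Integration.integral_nonneg) auto
  have E\<xi>U: "expectation (\<xi> n i) \<le> prob {\<omega>\<in>space M. V n i \<omega> \<in> U}" for n i
  proof -
    have "expectation (\<xi> n i) \<le> expectation (indicator {\<omega>\<in>space M. V n i \<omega> \<in> U})"
      using gU \<xi>01 by (intro integral_mono ib) (auto simp: \<xi>_def indicator_def of_bool_def split: if_splits)
    then show ?thesis by simp
  qed
  have E\<xi>\<xi>: "expectation (\<lambda>\<omega>. \<xi> n i \<omega> * \<xi> n j \<omega>) \<le> prob {\<omega>\<in>space M. V n i \<omega> \<in> U \<and> V n j \<omega> \<in> U}" for n i j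
  proof -
    have "expectation (\<lambda>\<omega>. \<xi> n i \<omega> * \<xi> n j \<omega>) \<le> expectation (indicator {\<omega>\<in>space M. V n i \<omega> \<in> U \<and> V n j \<omega> \<in> U})"
    proof (intro integral_mono ib)
      fix \<omega> assume "\<omega> \<in> space M"
      have "\<xi> n i \<omega> * \<xi> n j \<omega> \<le> of_bool (V n i \<omega> \<in> U) * of_bool (V n j \<omega> \<in> U)"
        using gU \<xi>01 by (intro mult_mono) (auto simp: \<xi>_def)
      then show "\<xi> n i \<omega> * \<xi> n j \<omega> \<le> indicator {\<omega>\<in>space M. V n i \<omega> \<in> U \<and> V n j \<omega> \<in> U} \<omega>"
        using \<open>\<omega> \<in> space M\<close> by (auto simp: indicator_def split: if_splits)
    qed (use \<xi>01 in \<open>auto intro!: mult_le_one simp: indicator_def\<close>)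
    then show ?thesis by simp
  qed
  have bound: "\<bar>expectation (\<lambda>\<omega>. \<Prod>i<n. 1 - \<xi> n i \<omega>) - (\<Prod>i<n. 1 - expectation (\<xi> n i))\<bar>
    \<le> (\<Sum>j<n. \<Sum>i\<in>{j-m..<j}. expectation (\<lambda>\<omega>. \<xi> n i \<omega> * \<xi> n j \<omega>) + expectation (\<xi> n i) * expectation (\<xi> n j))" for n
    by (rule expectation_prod_m_dependent[OF \<xi>m \<xi>01]) (use indep[OF gm g01] in \<open>simp add: \<xi>_def[abs_def]\<close>)
  have diff0: "(\<lambda>n. expectation (\<lambda>\<omega>. \<Prod>i<n. 1 - \<xi> n i \<omega>) - (\<Prod>i<n. 1 - expectation (\<xi> n i))) \<longlonglongrightarrow> 0"
  proof (rule Lim_null_comparison)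
    show "(\<lambda>n. real m * (K + K\<^sup>2) / real n) \<longlonglongrightarrow> 0" by (rule lim_const_over_n)
    show "eventually (\<lambda>n. norm (expectation (\<lambda>\<omega>. \<Prod>i<n. 1 - \<xi> n i \<omega>) - (\<Prod>i<n. 1 - expectation (\<xi> n i))) \<le> real m * (K + K\<^sup>2) / real n) sequentially"
      using P1 P2 eventually_gt_at_top[of 0]
    proof eventually_elim
      case (elim n)
      have p1: "expectation (\<xi> n i) \<le> K / real n" if "i < n" for i
        using E\<xi>U[of n i] elim(1) that unfolding U_def by (meson order_trans)
      have K0: "0 \<le> K / real n" using p1[of 0] E\<xi>0[of n 0] elim(3) by linarith
      have p2: "expectation (\<lambda>\<omega>. \<xi> n i \<omega> * \<xi> n j \<omega>) \<le> K / (real n)\<^sup>2" if "i < j" "j < n" "j \<le> i + m" for i j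
        using E\<xi>\<xi>[of n i j] elim(2) that unfolding U_def by (meson order_trans)
      have K1: "0 \<le> K" using K0 elim(3) by (simp add: zero_le_divide_iff)
      have trm: "expectation (\<lambda>\<omega>. \<xi> n i \<omega> * \<xi> n j \<omega>) + expectation (\<xi> n i) * expectation (\<xi> n j) \<le> (K + K\<^sup>2) / (real n)\<^sup>2"
        if "j < n" "i \<in> {j-m..<j}" for i j
      proof -
        have "expectation (\<xi> n i) * expectation (\<xi> n j) \<le> K / real n * (K / real n)"
          using that E\<xi>0 K0 by (intro mult_mono p1) auto
        moreover have "j \<le> i + m" using that by auto
        ultimately show ?thesis using p2[of i j] that by (simp add: add_divide_distrib power2_eq_square)
      qed
      have "norm (expectation (\<lambda>\<omega>. \<Prod>i<n. 1 - \<xi> n i \<omega>) - (\<Prod>i<n. 1 - expectation (\<xi> n i)))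
         \<le> (\<Sum>j<n. \<Sum>i\<in>{j-m..<j}. (K + K\<^sup>2) / (real n)\<^sup>2)"
        unfolding real_norm_def by (rule order_trans[OF bound]) (intro sum_mono trm, auto)
      also have "\<dots> \<le> (\<Sum>j<n. real m * ((K + K\<^sup>2) / (real n)\<^sup>2))"
      proof (rule sum_mono)
        fix j
        have "real (card {j-m..<j}) \<le> real m" by (simp del: of_nat_diff)
        then show "(\<Sum>i\<in>{j-m..<j}. (K + K\<^sup>2) / (real n)\<^sup>2) \<le> real m * ((K + K\<^sup>2) / (real n)\<^sup>2)"
          unfolding sum_constant using K1 by (intro mult_right_mono) auto
      qed
      also have "\<dots> = real m * (K + K\<^sup>2) / real n" by (simp add: power2_eq_square)
      finally show ?case .
    qed
  qed
  have sumE: "(\<lambda>n. \<Sum>i<n. expectation (\<xi> n i)) \<longlonglongrightarrow> (\<Sum>a<r. (1 - t a) * l a)"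
  proof -
    have "(\<Sum>i<n. expectation (\<xi> n i)) = (\<Sum>a<r. (1 - t a) * (\<Sum>i<n. prob {\<omega>\<in>space M. V n i \<omega> \<in> B a}))" for n
      unfolding E\<xi> sum_distrib_left by (rule sum.swap)
    then show ?thesis using intens by (auto intro!: tendsto_sum tendsto_mult_left)
  qed
  have prodlim: "(\<lambda>n. \<Prod>i<n. 1 - expectation (\<xi> n i)) \<longlonglongrightarrow> exp (- (\<Sum>a<r. (1 - t a) * l a))"
  proof (rule prod_one_minus_tendsto_exp[OF lim_const_over_n _ sumE])
    show "eventually (\<lambda>n. \<forall>i<n. 0 \<le> expectation (\<xi> n i) \<and> expectation (\<xi> n i) \<le> K / real n) sequentially"
      using P1
    proof eventually_elim
      case (elim n)
      then show ?case using E\<xi>0 E\<xi>U[of n] unfolding U_def by (meson order_trans)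
    qed
  qed
  have "(\<lambda>n. expectation (\<lambda>\<omega>. \<Prod>i<n. 1 - \<xi> n i \<omega>)) \<longlonglongrightarrow> exp (- (\<Sum>a<r. (1 - t a) * l a))"
    using tendsto_add[OF diff0 prodlim] by simp
  moreover have "exp (- (\<Sum>a<r. (1 - t a) * l a)) = (\<Prod>a<r. exp (- l a * (1 - t a)))"
    by (simp add: exp_sum[symmetric] sum_negf[symmetric] mult.commute)
  ultimately show "(\<lambda>n. expectation (\<lambda>\<omega>. \<Prod>a<r. t a ^ card {i. i < n \<and> V n i \<omega> \<in> B a})) \<longlonglongrightarrow> (\<Prod>a<r. exp (- l a * (1 - t a)))"
    unfolding prodeq by simp
qed

subsection \<open>Rounding the weights\<close>

text \<open>In a decreasing sequence the indices whose value exceeds a threshold form such a set.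
  The position j is therefore above the threshold exactly if more than j entries are, which
  translates between counts and order statistics.\<close>

lemma finite_downset_nat:
  fixes S :: "nat set"
  assumes "finite S" and down: "\<And>i j. i \<in> S \<Longrightarrow> j < i \<Longrightarrow> j \<in> S"
  shows "j \<in> S \<longleftrightarrow> j < card S"
proof -
  define n where "n = (LEAST n. n \<notin> S)"
  have "\<exists>n. n \<notin> S" using assms(1) infinite_UNIV_nat by (metis UNIV_eq_I)
  then have n: "n \<notin> S" unfolding n_def by (rule LeastI_ex)
  have "S = {..<n}"
  proof (intro equalityI subsetI)
    fix i assume i: "i \<in> S"
    then have "i \<noteq> n" "\<not> n < i" using n down by blast+
    then show "i \<in> {..<n}" by simp
  next
    fix i assume "i \<in> {..<n}"
    then show "i \<in> S" using not_less_Least[of i "\<lambda>n. n \<notin> S"] unfolding n_def by blast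
  qed
  then show ?thesis by simp
qed

text \<open>The cell with index \<open>a\<close> consists of the weights \<open>exp (- v)\<close> with
  \<open>v\<close> in the half-open interval from \<open>\<delta> * (a - 1)\<close> (excluded) to \<open>\<delta> * a\<close>.\<close>
definition cell :: "real \<Rightarrow> nat \<Rightarrow> real set" where
  "cell \<delta> a = {w. exp (- \<delta> * real a) \<le> w \<and> w < exp (- \<delta> * (real a - 1))}"

text \<open>A weight is lowered to the least value of its cell. The cells below r reach down to exp
  (- \<delta> * (r - 1)), and smaller weights are replaced by 0.\<close>

definition round_weight :: "real \<Rightarrow> nat \<Rightarrow> real \<Rightarrow> real" where
  "round_weight \<delta> r w = (\<Sum>a<r. exp (- \<delta> * real a) * of_bool (w \<in> cell \<delta> a))"

definition norm_weights :: "nat \<Rightarrow> (nat \<Rightarrow> real) \<Rightarrow> nat \<Rightarrow> real" where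
  "norm_weights k w = (\<lambda>j. if j < k then w j / suminf w else 0)"

text \<open>Reconstructs the normalised rounded weights from the counts alone. In decreasing order
  the entries of cell a occupy the positions from the number of entries in earlier cells up to that
  number plus c a, and the denominator is the sum of all rounded weights.\<close>

definition count_weights :: "real \<Rightarrow> nat \<Rightarrow> nat \<Rightarrow> (nat \<Rightarrow> nat) \<Rightarrow> nat \<Rightarrow> real" where
  "count_weights \<delta> r k c = (\<lambda>j. if j < k then
     (\<Sum>a<r. exp (- \<delta> * real a) * of_bool ((\<Sum>b<a. c b) \<le> j \<and> j < (\<Sum>b<Suc a. c b))) / (\<Sum>a<r. real (c a) * exp (- \<delta> * real a)) else 0)"

definition cell_counts :: "real \<Rightarrow> nat \<Rightarrow> (nat \<Rightarrow> real) \<Rightarrow> nat \<Rightarrow> nat" where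
  "cell_counts \<delta> r w = (\<lambda>a. if a < r then card {i. w i \<in> cell \<delta> a} else 0)"

text \<open>Consecutive cells abut, so the first a of them form one interval when a > 0. Its upper
  end exp \<delta> exceeds 1 and hence does not constrain w; in particular the weight 1 lies in cell
  0.\<close>

lemma cell_Union:
  assumes "\<delta> > 0" "w \<le> 1"
  shows "(\<exists>b<a. w \<in> cell \<delta> b) \<longleftrightarrow> a > 0 \<and> exp (- \<delta> * (real a - 1)) \<le> w"
proof (induction a)
  case (Suc a)
  have less: "exp (- \<delta> * real a) < exp (- \<delta> * (real a - 1))" using assms by (simp add: algebra_simps)
  have one: "1 < exp \<delta>" using assms by simp
  have "(\<exists>b<Suc a. w \<in> cell \<delta> b) \<longleftrightarrow> (\<exists>b<a. w \<in> cell \<delta> b) \<or> w \<in> cell \<delta> a" by (auto simp: less_Suc_eq)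
  also have "\<dots> \<longleftrightarrow> a > 0 \<and> exp (- \<delta> * (real a - 1)) \<le> w \<or> exp (- \<delta> * real a) \<le> w \<and> w < exp (- \<delta> * (real a - 1))"
    unfolding Suc by (simp add: cell_def)
  also have "\<dots> \<longleftrightarrow> exp (- \<delta> * real a) \<le> w"
  proof (cases "a = 0")
    case True then show ?thesis using one assms(2) by auto
  next
    case False then show ?thesis using less by linarith
  qed
  finally show ?case by simp
qed simp

lemma cell_disjoint: "\<delta> > 0 \<Longrightarrow> a \<noteq> b \<Longrightarrow> cell \<delta> a \<inter> cell \<delta> b = {}"
proof (rule ccontr)
  assume \<delta>: "\<delta> > 0" "a \<noteq> b" and "cell \<delta> a \<inter> cell \<delta> b \<noteq> {}"
  then obtain w where w: "w \<in> cell \<delta> a" "w \<in> cell \<delta> b" by blast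
  then have "exp (- \<delta> * real a) < exp (- \<delta> * (real b - 1))" "exp (- \<delta> * real b) < exp (- \<delta> * (real a - 1))"
    unfolding cell_def mem_Collect_eq by linarith+
  then have "real b - 1 < real a" "real a - 1 < real b" using \<delta> by simp_all
  then show False using \<delta> by linarith
qed

lemma round_weight_eq:
  assumes "\<delta> > 0" "a < r" "w \<in> cell \<delta> a"
  shows "round_weight \<delta> r w = exp (- \<delta> * real a)"
proof -
  have "w \<notin> cell \<delta> b" if "b \<noteq> a" for b using cell_disjoint[OF assms(1) that] assms(3) by blast
  then have "round_weight \<delta> r w = (\<Sum>b<r. if b = a then exp (- \<delta> * real a) else 0)"
    unfolding round_weight_def by (intro sum.cong) (auto simp: assms)
  then show ?thesis using assms by simp
qed

text \<open>Within a cell the weights vary by a factor below exp \<delta>, so rounding loses at most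
  the fraction 1 - exp (- \<delta>) \<le> \<delta>. The second error term is the whole weight if it
  lies below the last cell.\<close>

lemma round_weight_bounds:
  assumes \<delta>: "\<delta> > 0" and w: "0 \<le> w" "w \<le> 1"
  shows "0 \<le> round_weight \<delta> r w" "round_weight \<delta> r w \<le> w"
    "w - round_weight \<delta> r w \<le> \<delta> * w + w * of_bool (w < exp (- \<delta> * (real r - 1)))"
proof -
  have *: "0 \<le> round_weight \<delta> r w \<and> round_weight \<delta> r w \<le> w \<and> w - round_weight \<delta> r w \<le> \<delta> * w + w * of_bool (w < exp (- \<delta> * (real r - 1)))"
  proof (cases "\<exists>a<r. w \<in> cell \<delta> a")
    case True
    then obtain a where a: "a < r" "w \<in> cell \<delta> a" by blast
    have e: "round_weight \<delta> r w = exp (- \<delta> * real a)" by (rule round_weight_eq[OF \<delta> a])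
    have "w * (1 - \<delta>) \<le> w * exp (- \<delta>)" using exp_ge_add_one_self[of "- \<delta>"] w by (intro mult_left_mono) auto
    also have "\<dots> \<le> exp (- \<delta> * (real a - 1)) * exp (- \<delta>)" using a by (intro mult_right_mono) (auto simp: cell_def)
    also have "\<dots> = exp (- \<delta> * real a)" by (simp add: exp_add[symmetric] algebra_simps)
    finally have "w - exp (- \<delta> * real a) \<le> \<delta> * w" by (simp add: algebra_simps)
    moreover have "0 \<le> w * of_bool (w < exp (- \<delta> * (real r - 1)))" using w by simp
    ultimately show ?thesis unfolding e using a by (auto simp: cell_def)
  next
    case False
    then have z: "round_weight \<delta> r w = 0" unfolding round_weight_def by (intro sum.neutral) auto
    show ?thesis
    proof (cases "r = 0")
      case True
      have "w < exp (- \<delta> * (real r - 1))" using True w \<delta> by (simp add: le_less_trans[OF w(2)])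
      then show ?thesis using w \<delta> z by simp
    next
      case nz: False
      have "\<not> exp (- \<delta> * (real r - 1)) \<le> w" using cell_Union[OF \<delta> w(2), of r] False nz by simp
      then show ?thesis using w \<delta> z by simp
    qed
  qed
  then show "0 \<le> round_weight \<delta> r w" "round_weight \<delta> r w \<le> w"
    "w - round_weight \<delta> r w \<le> \<delta> * w + w * of_bool (w < exp (- \<delta> * (real r - 1)))" by auto
qed

text \<open>Rounding changes both an individual weight and the sum S by at most \<delta> * S + T,
  where T collects the weights below the last cell. If the largest weight is at least exp (- b), so
  is S, and the relative errors are at most \<delta> + exp b * T each. Otherwise the two entries of
  [0, 1] are compared by the trivial bound 1.\<close>

lemma norm_weights_approx:
  assumes \<delta>: "\<delta> > 0" and w: "\<And>i. 0 \<le> w i \<and> w i \<le> 1" and dec: "\<And>i j. i \<le> j \<Longrightarrow> w j \<le> w i" and sm: "summable w"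
  shows "0 \<le> norm_weights k w j \<and> norm_weights k w j \<le> 1"
    and "0 \<le> count_weights \<delta> r k (cell_counts \<delta> r w) j \<and> count_weights \<delta> r k (cell_counts \<delta> r w) j \<le> 1"
    and "\<bar>norm_weights k w j - count_weights \<delta> r k (cell_counts \<delta> r w) j\<bar>
       \<le> 2 * \<delta> + of_bool (w 0 < exp (- b)) + 2 * exp b * (\<Sum>i. w i * of_bool (w i < exp (- \<delta> * (real r - 1))))"
proof -
  define q where "q i = round_weight \<delta> r (w i)" for i
  define S where "S = suminf w"
  define S' where "S' = suminf q"
  define tl where "tl i = w i * of_bool (w i < exp (- \<delta> * (real r - 1)))" for i
  define T where "T = suminf tl"
  have q: "0 \<le> q i" "q i \<le> w i" "w i - q i \<le> \<delta> * w i + tl i" for i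
    unfolding q_def tl_def using round_weight_bounds[OF \<delta>, of "w i" r] w by auto
  have tl: "0 \<le> tl i" "tl i \<le> w i" for i unfolding tl_def using w[of i] by auto
  have sq: "summable q" by (rule summable_comparison_test'[OF sm]) (use q in auto)
  have st: "summable tl" by (rule summable_comparison_test'[OF sm]) (use tl in auto)
  have S0: "0 \<le> S" "w i \<le> S" for i unfolding S_def
    using w sum_le_suminf[OF sm, of "{i}"] by (auto intro!: suminf_nonneg sm)
  have S'0: "0 \<le> S'" "q i \<le> S'" for i unfolding S'_def
    using q sum_le_suminf[OF sq, of "{i}"] by (auto intro!: suminf_nonneg sq)
  have T0: "0 \<le> T" "tl i \<le> T" for i unfolding T_def
    using tl sum_le_suminf[OF st, of "{i}"] by (auto intro!: suminf_nonneg st)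
  have SS: "S' \<le> S" "S - S' \<le> \<delta> * S + T"
  proof -
    show "S' \<le> S" unfolding S_def S'_def by (rule suminf_le[OF q(2) sq sm])
    have "S - S' = (\<Sum>i. w i - q i)" unfolding S_def S'_def by (rule suminf_diff[OF sm sq])
    also have "\<dots> \<le> (\<Sum>i. \<delta> * w i + tl i)" by (rule suminf_le[OF q(3)]) (intro summable_diff summable_add summable_mult sm sq st)+
    also have "\<dots> = (\<Sum>i. \<delta> * w i) + T" unfolding T_def by (rule suminf_add[symmetric]) (intro summable_mult sm st)+
    also have "(\<Sum>i. \<delta> * w i) = \<delta> * S" unfolding S_def by (rule suminf_mult[OF sm])
    finally show "S - S' \<le> \<delta> * S + T" .
  qed
  have tend0: "w \<longlonglongrightarrow> 0" using sm by (rule summable_LIMSEQ_zero)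
  have fin: "finite {i. x \<le> w i}" if "x > 0" for x
  proof -
    have "eventually (\<lambda>i. w i < x) sequentially" using tend0 that by (rule order_tendstoD)
    then obtain N where "\<And>i. i \<ge> N \<Longrightarrow> w i < x" by (auto simp: eventually_sequentially)
    then have "{i. x \<le> w i} \<subseteq> {..<N}" by (auto simp: not_less[symmetric])
    then show ?thesis by (rule finite_subset) simp
  qed
  have fincell: "finite {i. w i \<in> cell \<delta> a}" for a
    by (rule finite_subset[OF _ fin[of "exp (- \<delta> * real a)"]]) (auto simp: cell_def)
  define c where "c = cell_counts \<delta> r w"
  have c: "c a = card {i. w i \<in> cell \<delta> a}" if "a < r" for a unfolding c_def cell_counts_def using that by simp
  \<comment> \<open>Since w decreases, the indices with weight in the first a cells form an initial
    segment whose length is the sum of their counts.\<close>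
  have thr: "(\<exists>b<a. w j \<in> cell \<delta> b) \<longleftrightarrow> j < (\<Sum>b<a. c b)" if "a \<le> r" for a j
  proof -
    let ?S = "{i. \<exists>b<a. w i \<in> cell \<delta> b}"
    have e: "?S = (\<Union>b\<in>{..<a}. {i. w i \<in> cell \<delta> b})" by auto
    have f: "finite ?S" unfolding e using fincell by simp
    have "card ?S = (\<Sum>b<a. card {i. w i \<in> cell \<delta> b})" unfolding e
      by (rule card_UN_disjoint) (use fincell cell_disjoint[OF \<delta>] in auto)
    also have "\<dots> = (\<Sum>b<a. c b)" using that by (intro sum.cong) (auto simp: c)
    finally have cs: "card ?S = (\<Sum>b<a. c b)" .
    have "j \<in> ?S \<longleftrightarrow> j < card ?S"
    proof (rule finite_downset_nat[OF f])
      fix i j assume "i \<in> ?S" "j < i"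
      then show "j \<in> ?S"
        using cell_Union[OF \<delta>, of "w i" a] cell_Union[OF \<delta>, of "w j" a] w dec[of j i] by auto
    qed
    then show ?thesis unfolding cs by simp
  qed
  have incell: "w j \<in> cell \<delta> a \<longleftrightarrow> (\<Sum>b<a. c b) \<le> j \<and> j < (\<Sum>b<Suc a. c b)" if "a < r" for a j
  proof -
    have "w j \<in> cell \<delta> a \<longleftrightarrow> (\<exists>b<Suc a. w j \<in> cell \<delta> b) \<and> \<not> (\<exists>b<a. w j \<in> cell \<delta> b)"
      using cell_disjoint[OF \<delta>] by (auto simp: less_Suc_eq) (metis IntI empty_iff less_irrefl)
    moreover have "(\<exists>b<Suc a. w j \<in> cell \<delta> b) \<longleftrightarrow> j < (\<Sum>b<Suc a. c b)" "(\<exists>b<a. w j \<in> cell \<delta> b) \<longleftrightarrow> j < (\<Sum>b<a. c b)"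
      by (rule thr, use that in simp)+
    ultimately show ?thesis unfolding not_less[symmetric] by blast
  qed
  have S'c: "S' = (\<Sum>a<r. real (c a) * exp (- \<delta> * real a))"
  proof -
    have "(\<lambda>i. \<Sum>a<r. exp (- \<delta> * real a) * of_bool (w i \<in> cell \<delta> a)) sums (\<Sum>a<r. exp (- \<delta> * real a) * real (card {i. w i \<in> cell \<delta> a}))"
    proof (intro sums_sum sums_mult)
      fix a
      have "(\<lambda>i. if i \<in> {i. w i \<in> cell \<delta> a} then 1 else 0) sums (\<Sum>i\<in>{i. w i \<in> cell \<delta> a}. 1 :: real)"
        by (rule sums_If_finite_set[OF fincell])
      then show "(\<lambda>i. of_bool (w i \<in> cell \<delta> a) :: real) sums real (card {i. w i \<in> cell \<delta> a})" by (simp add: of_bool_def)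
    qed
    then have "S' = (\<Sum>a<r. exp (- \<delta> * real a) * real (card {i. w i \<in> cell \<delta> a}))"
      unfolding S'_def q_def[abs_def] round_weight_def by (rule sums_unique[symmetric])
    also have "\<dots> = (\<Sum>a<r. real (c a) * exp (- \<delta> * real a))" by (intro sum.cong) (auto simp: c)
    finally show ?thesis .
  qed
  have cw: "count_weights \<delta> r k c j = (if j < k then q j / S' else 0)" for j
  proof -
    have "q j = (\<Sum>a<r. exp (- \<delta> * real a) * of_bool ((\<Sum>b<a. c b) \<le> j \<and> j < (\<Sum>b<Suc a. c b)))"
      unfolding q_def round_weight_def by (intro sum.cong refl) (simp only: lessThan_iff incell)
    then show ?thesis unfolding count_weights_def S'c by simp
  qed
  have nw: "norm_weights k w j = (if j < k then w j / S else 0)" for j unfolding norm_weights_def S_def ..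
  have n01: "0 \<le> norm_weights k w j \<and> norm_weights k w j \<le> 1"
    unfolding nw using w[of j] S0(1) S0(2)[of j] by (auto simp: divide_le_eq_1)
  have c01: "0 \<le> count_weights \<delta> r k c j \<and> count_weights \<delta> r k c j \<le> 1"
    unfolding cw using q(1)[of j] S'0(1) S'0(2)[of j] by (auto simp: divide_le_eq_1)
  show "0 \<le> norm_weights k w j \<and> norm_weights k w j \<le> 1" by (rule n01)
  show "0 \<le> count_weights \<delta> r k (cell_counts \<delta> r w) j \<and> count_weights \<delta> r k (cell_counts \<delta> r w) j \<le> 1"
    using c01 unfolding c_def .
  have "\<bar>norm_weights k w j - count_weights \<delta> r k c j\<bar> \<le> 2 * \<delta> + of_bool (w 0 < exp (- b)) + 2 * exp b * T"
  proof (cases "w 0 < exp (- b)")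
    case True
    have T': "0 \<le> 2 * exp b * T" using T0(1) by simp
    have "of_bool (w 0 < exp (- b)) = (1 :: real)" using True by simp
    then show ?thesis using conjunct1[OF n01] conjunct2[OF n01] conjunct1[OF c01] conjunct2[OF c01] \<delta> T' by linarith
  next
    case False
    then have Sb: "exp (- b) \<le> S" using S0(2)[of 0] by simp
    have Sp: "S > 0" using Sb exp_gt_zero[of "- b"] by linarith
    have TS: "T / S \<le> exp b * T"
    proof -
      have "T / S \<le> T / exp (- b)" using Sb T0(1) Sp by (intro divide_left_mono) auto
      then show ?thesis by (simp add: exp_minus field_simps)
    qed
    have main: "\<bar>w j / S - q j / S'\<bar> \<le> 2 * \<delta> + 2 * (T / S)"
    proof -
      have w1: "(w j - q j) / S \<le> \<delta> + T / S"
      proof -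
        have "\<delta> * w j \<le> \<delta> * S" using S0(2)[of j] \<delta> by (intro mult_left_mono) auto
        then have "w j - q j \<le> \<delta> * S + T" using q(3)[of j] T0(2)[of j] \<delta> by linarith
        then have "(w j - q j) / S \<le> (\<delta> * S + T) / S" using Sp by (intro divide_right_mono) auto
        then show ?thesis using Sp by (simp add: add_divide_distrib)
      qed
      \<comment> \<open>Changing the denominator costs q j / S' times (S - S') / S, where the first
        factor is at most 1. If S' = 0, then q j = 0 and both quotients are 0.\<close>
      have w2: "q j / S' - q j / S \<le> \<delta> + T / S \<and> q j / S \<le> q j / S' "
      proof (cases "S' = 0")
        case True
        then have "q j = 0" using q(1)[of j] S'0(2)[of j] by simp
        then show ?thesis using \<delta> T0(1) Sp by simp
      next
        case False
        then have S'p: "S' > 0" using S'0(1) by simp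
        have "q j / S' - q j / S = (q j / S') * ((S - S') / S)" using S'p Sp by (simp add: field_simps)
        also have "\<dots> \<le> 1 * ((S - S') / S)"
          using S'p S'0(2)[of j] SS(1) Sp by (intro mult_right_mono) auto
        also have "\<dots> \<le> (\<delta> * S + T) / S" using SS(2) Sp by (simp add: divide_right_mono)
        also have "\<dots> = \<delta> + T / S" using Sp by (simp add: add_divide_distrib)
        finally show ?thesis using q(1)[of j] SS(1) S'p by (auto intro!: divide_left_mono)
      qed
      have "0 \<le> (w j - q j) / S" using q(2)[of j] Sp by simp
      moreover have "w j / S - q j / S' = (w j - q j) / S - (q j / S' - q j / S)" by (simp add: diff_divide_distrib)
      moreover have "0 \<le> \<delta> + T / S" using \<delta> T0(1) Sp by simp
      ultimately show ?thesis using w1 w2 by linarith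
    qed
    have "0 \<le> 2 * \<delta> + 2 * (exp b * T)" using \<delta> T0(1) by simp
    then show ?thesis unfolding nw cw using main TS False by auto
  qed
  then show "\<bar>norm_weights k w j - count_weights \<delta> r k (cell_counts \<delta> r w) j\<bar>
       \<le> 2 * \<delta> + of_bool (w 0 < exp (- b)) + 2 * exp b * (\<Sum>i. w i * of_bool (w i < exp (- \<delta> * (real r - 1))))"
    unfolding c_def T_def tl_def[abs_def] .
qed

section \<open>Continuity on the infinite-dimensional cube\<close>

text \<open>The cube is compact in the product topology, so f is uniformly continuous on it.
  Arguments that are far apart are covered by the bound on f, rewritten as a multiple of their
  distance. The result is linear in the coordinate differences and so survives taking
  expectations.\<close>

lemma continuous_modulus_finite_coordinates:
  fixes f :: "(nat \<Rightarrow> real) \<Rightarrow> real"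
  assumes f: "continuous_on UNIV f" and B: "\<And>z. \<bar>f z\<bar> \<le> B" and "\<epsilon> > 0"
  obtains L where "L \<ge> 0"
    "\<And>z z'. (\<And>j. 0 \<le> z j \<and> z j \<le> 1 \<and> 0 \<le> z' j \<and> z' j \<le> 1) \<Longrightarrow> (\<And>j. k \<le> j \<Longrightarrow> z j = 0 \<and> z' j = 0) \<Longrightarrow>
       \<bar>f z - f z'\<bar> \<le> \<epsilon> + L * (\<Sum>j<k. \<bar>z j - z' j\<bar>)"
proof -
  define Q where "Q = PiE UNIV (\<lambda>_::nat. {0..1::real})"
  have "compactin (product_topology (\<lambda>_::nat. euclidean) UNIV) Q" unfolding Q_def by (subst compactin_PiE) auto
  then have "compact Q" by (simp add: euclidean_product_topology)
  then have "uniformly_continuous_on Q f"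
    using f by (intro compact_uniformly_continuous) (auto intro: continuous_on_subset)
  then obtain d where d: "d > 0" "\<And>z z'. z \<in> Q \<Longrightarrow> z' \<in> Q \<Longrightarrow> dist z' z < d \<Longrightarrow> dist (f z') (f z) < \<epsilon>"
    unfolding uniformly_continuous_on_def using \<open>\<epsilon> > 0\<close> by metis
  obtain N where N: "(1/2::real) ^ N < d / 2" using real_arch_pow_inv[of "d/2" "1/2"] d(1) by auto
  have B0: "B \<ge> 0" using B[of undefined] by simp
  \<comment> \<open>When the coordinates differ by at least d / 4 in total, the trivial bound 2 * B
    equals 8 * B / d times d / 4.\<close>
  show thesis
  proof (rule that[of "8 * B / d"])
    show "8 * B / d \<ge> 0" using B0 d(1) by simp
    fix z z' :: "nat \<Rightarrow> real"
    assume b: "\<And>j. 0 \<le> z j \<and> z j \<le> 1 \<and> 0 \<le> z' j \<and> z' j \<le> 1" and z: "\<And>j. k \<le> j \<Longrightarrow> z j = 0 \<and> z' j = 0"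
    define s where "s = (\<Sum>j<k. \<bar>z j - z' j\<bar>)"
    have s0: "s \<ge> 0" unfolding s_def by (intro sum_nonneg) auto
    have zs: "\<bar>z j - z' j\<bar> \<le> s" for j
    proof (cases "j < k")
      case True then show ?thesis unfolding s_def by (intro member_le_sum) auto
    next
      case False then show ?thesis using z[of j] s0 by simp
    qed
    show "\<bar>f z - f z'\<bar> \<le> \<epsilon> + 8 * B / d * s"
    proof (cases "s < d / 4")
      case True
      \<comment> \<open>The distance of two functions is at most twice the maximum over the first
        coordinates plus (1/2) ^ N; with s < d / 4 each of the two parts is below d / 2.\<close>
      have "Max {dist (z (from_nat n)) (z' (from_nat n)) |n. n \<le> N} \<le> s"
        using zs by (subst Max_le_iff) (auto simp: dist_real_def)
      then have "dist z z' < d" using dist_fun_le_dist_first_terms[of z z' N] N True by linarith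
      moreover have "z \<in> Q" "z' \<in> Q" unfolding Q_def by (simp_all add: PiE_iff b)
      ultimately have "dist (f z) (f z') < \<epsilon>" using d(2)[of z' z] by blast
      moreover have "0 \<le> 8 * B / d * s" using s0 B0 d(1) by simp
      ultimately show ?thesis by (simp add: dist_real_def)
    next
      case False
      have "\<bar>f z - f z'\<bar> \<le> 2 * B" using B[of z] B[of z'] by linarith
      also have "\<dots> = 8 * B / d * (d / 4)" using d(1) by simp
      also have "\<dots> \<le> 8 * B / d * s" using False B0 d(1) by (intro mult_left_mono) auto
      finally show ?thesis using \<open>\<epsilon> > 0\<close> by simp
    qed
  qed
qed

subsection \<open>Densities on the sphere\<close>

lemma AE_sphere_measure: "AE x in (sphere_measure :: (real^2^'l::finite) measure). x \<in> sphere 0 1"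
proof -
  let ?f = "\<lambda>x. ennreal (real (dimd TYPE('l))) * indicator (cball 0 1 - {0}) (x :: real^2^'l)"
  have fm: "?f \<in> borel_measurable lborel"
    by (intro borel_measurable_times_ennreal borel_measurable_const borel_measurable_indicator) auto
  have m: "(\<lambda>x. x /\<^sub>R norm x) \<in> measurable (density lborel ?f) (borel :: (real^2^'l) measure)" by simp
  have s: "{x \<in> space borel. x \<in> sphere 0 (1::real)} \<in> sets (borel :: (real^2^'l) measure)"
    using borel_closed[OF closed_sphere, of "0 :: real^2^'l" 1] by simp
  have "AE x in density lborel ?f. x /\<^sub>R norm x \<in> sphere 0 1"
    by (subst AE_density[OF fm], rule AE_I2) (auto simp: indicator_def)
  then show ?thesis unfolding sphere_measure_def by (subst AE_distr_iff[OF m s])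
qed

lemma sets_sphere_measure [simp, measurable_cong]: "sets sphere_measure = sets borel"
  by (simp add: sphere_measure_def)

text \<open>For u = 0 and t = 1 the cap condition holds everywhere, and the sector is the punctured
  unit ball, whose volume is finite.\<close>

lemma finite_measure_sphere_measure: "finite_measure (sphere_measure :: (real^2^'l::finite) measure)"
proof
  have "{x. 1 - inner (0 :: real^2^'l) x \<le> 1} = UNIV" by simp
  then have "emeasure sphere_measure (UNIV :: (real^2^'l) set) = ennreal (real DIM(real^2^'l)) * emeasure lborel (sector (0 :: real^2^'l) 1)"
    using emeasure_sphere_measure_cap[of "0 :: real^2^'l" 1] by simp
  moreover have "emeasure lborel (sector (0 :: real^2^'l) 1) \<le> emeasure lborel (cball (0 :: real^2^'l) 1)"
    by (rule emeasure_mono) (auto simp: sector_def)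
  then have "emeasure lborel (sector (0 :: real^2^'l) 1) < \<infinity>"
    using emeasure_lborel_cball_finite[of "0 :: real^2^'l" 1] by (rule le_less_trans)
  ultimately show "emeasure sphere_measure (space sphere_measure :: (real^2^'l) set) \<noteq> \<infinity>"
    by (simp add: sphere_measure_def ennreal_mult_eq_top_iff less_top)
qed

lemma dist_unit_vectors:
  fixes u x :: "'a::real_inner"
  assumes "norm u = 1" "norm x = 1" shows "(dist x u)\<^sup>2 = 2 * (1 - inner u x)"
proof -
  have "u \<bullet> u = 1" "x \<bullet> x = 1" using assms by (simp_all add: norm_eq_1)
  then show ?thesis by (simp add: dist_norm power2_norm_eq_inner inner_diff_left inner_diff_right inner_commute)
qed

text \<open>A closed tube around K still fits into U, and its intersection with S is compact. Hence
  g is uniformly continuous there, and one radius serves all points of K.\<close>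

lemma compact_neighborhood_uniform:
  fixes K :: "'a::heine_borel set" and g :: "'a \<Rightarrow> real"
  assumes K: "compact K" "K \<noteq> {}" and U: "open U" "K \<subseteq> U" and S: "closed S" "K \<subseteq> S"
    and g: "continuous_on (U \<inter> S) g" and "\<eta> > 0"
  obtains d where "d > 0" "\<And>u x. u \<in> K \<Longrightarrow> x \<in> S \<Longrightarrow> dist x u < d \<Longrightarrow> x \<in> U \<and> \<bar>g x - g u\<bar> < \<eta>"
proof -
  obtain e where e: "e > 0" "{x. infdist x K \<le> e} \<subseteq> U" using compact_in_open_separated[OF K(2,1) U] .
  define C where "C = {x. infdist x K \<le> e} \<inter> S"
  have "compact C" unfolding C_def by (intro compact_Int_closed S compact_infdist_le K e)
  moreover have "continuous_on C g" by (rule continuous_on_subset[OF g]) (use e in \<open>auto simp: C_def\<close>)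
  ultimately have "uniformly_continuous_on C g" by (intro compact_uniformly_continuous)
  then obtain d where d: "d > 0" "\<And>x u. u \<in> C \<Longrightarrow> x \<in> C \<Longrightarrow> dist x u < d \<Longrightarrow> dist (g x) (g u) < \<eta>"
    unfolding uniformly_continuous_on_def using \<open>\<eta> > 0\<close> by metis
  show thesis
  proof (rule that[of "min d e"])
    fix u x assume u: "u \<in> K" and x: "x \<in> S" and dx: "dist x u < min d e"
    have "infdist x K \<le> e" using infdist_le[OF u, of x] dx by simp
    then have "x \<in> C" using x by (simp add: C_def)
    moreover have "u \<in> C" using u S e(1) by (auto simp: C_def)
    ultimately show "x \<in> U \<and> \<bar>g x - g u\<bar> < \<eta>" using d(2)[of u x] dx e(2) by (auto simp: C_def dist_real_def)
  qed (use d e in simp)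
qed

definition cap :: "real^2^'l::finite \<Rightarrow> real \<Rightarrow> (real^2^'l) set" where
  "cap u t = {x. 1 - inner u x \<le> t}"

lemma cap_borel [measurable]: "cap u t \<in> sets borel"
  unfolding cap_def by measurable

lemma dist_in_cap:
  assumes "norm u = 1" "norm x = 1" "x \<in> cap u t" "2 * t < d\<^sup>2" "d > 0"
  shows "dist x u < d"
proof -
  have "(dist x u)\<^sup>2 \<le> 2 * t" using assms by (simp add: dist_unit_vectors cap_def)
  then have "(dist x u)\<^sup>2 < d\<^sup>2" using assms by linarith
  then show ?thesis by (rule power2_less_imp_less) (use assms in simp)
qed

text \<open>A cap of height t around a point of the orbit closure has radius sqrt (2 * t). For small
  t the density is there within \<eta> of its value at the centre, uniformly in the centre, so the
  mass is that value times the surface measure up to controlled errors.\<close>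

lemma density_cap_asymp:
  fixes q :: "real^2^'l::finite" and \<rho> :: "real^2^'l \<Rightarrow> real"
  assumes q: "q \<in> sphere 0 1" and meas: "\<rho> \<in> borel_measurable borel"
    and nonneg: "\<And>x. x \<in> sphere 0 1 \<Longrightarrow> \<rho> x \<ge> 0"
    and U: "open U" "orbit_closure freq q \<subseteq> U" "continuous_on (U \<inter> sphere 0 1) \<rho>" and \<epsilon>: "\<epsilon> > 0"
  obtains t0 where "0 < t0" "\<And>t u. 0 < t \<Longrightarrow> t < t0 \<Longrightarrow> u \<in> orbit_closure freq q \<Longrightarrow>
     \<bar>measure (density sphere_measure (\<lambda>x. ennreal (\<rho> x))) (cap u t) - \<rho> u * cap_const TYPE('l) * t powr (1 / alphaR TYPE('l))\<bar>
       \<le> \<epsilon> * t powr (1 / alphaR TYPE('l))"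
proof -
  define p where "p = 1 / alphaR TYPE('l)"
  define \<kappa> where "\<kappa> = cap_const TYPE('l)"
  define OC where "OC = orbit_closure freq q"
  have Oc: "compact OC" "OC \<subseteq> sphere 0 1" unfolding OC_def using compact_orbit_closure[OF q] orbit_closure_subset_sphere[OF q] by auto
  have One: "OC \<noteq> {}" unfolding OC_def using rope_u_in_orbit_closure by blast
  have cO: "continuous_on OC \<rho>" by (rule continuous_on_subset[OF U(3)]) (use U(2) Oc in \<open>auto simp: OC_def\<close>)
  obtain R where R: "R \<ge> 0" "\<And>u. u \<in> OC \<Longrightarrow> \<rho> u \<le> R"
  proof -
    obtain x where x: "x \<in> OC" "\<And>u. u \<in> OC \<Longrightarrow> \<rho> u \<le> \<rho> x" using continuous_attains_sup[OF Oc(1) One cO] by blast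
    then show thesis using that[of "\<rho> x"] nonneg Oc(2) by blast
  qed
  have \<kappa>0: "\<kappa> \<ge> 0" unfolding \<kappa>_def cap_const_eq by simp
  \<comment> \<open>The oscillation of the density costs at most \<eta> * (\<kappa> + 1), the cap
    asymptotics at most \<eta> * R; together they have to stay below \<epsilon>.\<close>
  define \<eta> where "\<eta> = min 1 (\<epsilon> / (\<kappa> + 1 + R))"
  have \<eta>: "\<eta> > 0" "\<eta> \<le> 1" "\<eta> * (\<kappa> + 1 + R) \<le> \<epsilon>"
  proof -
    show "\<eta> > 0" "\<eta> \<le> 1" using \<epsilon> \<kappa>0 R(1) by (auto simp: \<eta>_def)
    have "\<eta> \<le> \<epsilon> / (\<kappa> + 1 + R)" by (simp add: \<eta>_def)
    then show "\<eta> * (\<kappa> + 1 + R) \<le> \<epsilon>" using \<kappa>0 R(1) by (simp add: pos_le_divide_eq)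
  qed
  obtain d where d: "d > 0" "\<And>u x. u \<in> OC \<Longrightarrow> x \<in> sphere 0 1 \<Longrightarrow> dist x u < d \<Longrightarrow> x \<in> U \<and> \<bar>\<rho> x - \<rho> u\<bar> < \<eta>"
    using compact_neighborhood_uniform[OF Oc(1) One U(1) _ closed_sphere Oc(2) U(3) \<eta>(1)] U(2) unfolding OC_def by metis
  obtain t1 where t1: "0 < t1" "\<forall>t u. 0 < t \<longrightarrow> t < t1 \<longrightarrow> norm (u::real^2^'l) = 1 \<longrightarrow>
       emeasure sphere_measure (cap u t) < \<infinity> \<and> \<bar>measure sphere_measure (cap u t) - \<kappa> * t powr p\<bar> \<le> \<eta> * t powr p"
    using sphere_cap_asymp[OF \<eta>(1)] unfolding cap_def \<kappa>_def p_def by metis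
  show thesis
  proof (rule that[of "min t1 (d\<^sup>2 / 2)"])
    show "0 < min t1 (d\<^sup>2 / 2)" using t1 d by simp
    fix t u assume t: "0 < t" "t < min t1 (d\<^sup>2 / 2)" and "u \<in> orbit_closure freq q"
    then have u: "u \<in> OC" by (simp add: OC_def)
    have nu: "norm u = 1" using u Oc(2) by auto
    define s where "s = measure sphere_measure (cap u t)"
    have cu: "emeasure sphere_measure (cap u t) < \<infinity> \<and> \<bar>measure sphere_measure (cap u t) - \<kappa> * t powr p\<bar> \<le> \<eta> * t powr p"
      using t1(2) t nu by simp
    have se: "emeasure sphere_measure (cap u t) = ennreal s" unfolding s_def
      by (rule finite_measure.emeasure_eq_measure[OF finite_measure_sphere_measure])
    have s0: "s \<ge> 0" by (simp add: s_def)
    have sb: "\<bar>s - \<kappa> * t powr p\<bar> \<le> \<eta> * t powr p" unfolding s_def using cu by blast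
    have near: "\<bar>\<rho> x - \<rho> u\<bar> < \<eta>" if "x \<in> cap u t" "x \<in> sphere 0 1" for x
      using d(2)[OF u that(2)] dist_in_cap[OF nu _ that(1), of d] that(2) t d(1) by auto
    let ?D = "density sphere_measure (\<lambda>x. ennreal (\<rho> x))"
    have De: "emeasure ?D (cap u t) = (\<integral>\<^sup>+x. ennreal (\<rho> x) * indicator (cap u t) x \<partial>sphere_measure)"
      by (rule emeasure_density) (use meas in simp_all)
    have up: "emeasure ?D (cap u t) \<le> ennreal ((\<rho> u + \<eta>) * s)"
    proof -
      have "emeasure ?D (cap u t) \<le> (\<integral>\<^sup>+x. ennreal (\<rho> u + \<eta>) * indicator (cap u t) x \<partial>sphere_measure)"
        unfolding De
      proof (rule nn_integral_mono_AE, use AE_sphere_measure in eventually_elim)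
        case (elim x)
        then show ?case using near[of x] by (auto simp: indicator_def intro!: ennreal_leI)
      qed
      also have "\<dots> = ennreal (\<rho> u + \<eta>) * ennreal s" unfolding se[symmetric] by (rule nn_integral_cmult_indicator) simp
      also have "\<dots> = ennreal ((\<rho> u + \<eta>) * s)"
        using nonneg[of u] nu \<eta>(1) s0 by (intro ennreal_mult[symmetric]) auto
      finally show ?thesis .
    qed
    have lo: "ennreal ((\<rho> u - \<eta>) * s) \<le> emeasure ?D (cap u t)"
    proof -
      have "ennreal ((\<rho> u - \<eta>) * s) = ennreal (\<rho> u - \<eta>) * ennreal s" using s0 by (rule ennreal_mult'')
      also have "\<dots> = (\<integral>\<^sup>+x. ennreal (\<rho> u - \<eta>) * indicator (cap u t) x \<partial>sphere_measure)"
        unfolding se[symmetric] by (rule nn_integral_cmult_indicator[symmetric]) simp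
      also have "\<dots> \<le> emeasure ?D (cap u t)" unfolding De
      proof (rule nn_integral_mono_AE, use AE_sphere_measure in eventually_elim)
        case (elim x)
        then show ?case using near[of x] by (auto simp: indicator_def intro!: ennreal_leI)
      qed
      finally show ?thesis .
    qed
    define P where "P = measure ?D (cap u t)"
    have Pe: "emeasure ?D (cap u t) = ennreal P" unfolding P_def
      using up by (intro emeasure_eq_ennreal_measure) (auto simp: top_unique)
    have P0: "P \<ge> 0" by (simp add: P_def)
    have "P \<le> (\<rho> u + \<eta>) * s" using up nonneg[of u] nu \<eta>(1) s0 unfolding Pe by (simp add: ennreal_le_iff)
    moreover have "(\<rho> u - \<eta>) * s \<le> P" using lo P0 unfolding Pe by (auto simp: ennreal_le_iff2)
    ultimately have 1: "\<bar>P - \<rho> u * s\<bar> \<le> \<eta> * s"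
      unfolding abs_le_iff left_diff_distrib distrib_right by linarith
    have 2: "\<eta> * s \<le> \<eta> * ((\<kappa> + 1) * t powr p)"
    proof (rule mult_left_mono)
      have "\<eta> * t powr p \<le> 1 * t powr p" using \<eta> by (intro mult_right_mono) auto
      then show "s \<le> (\<kappa> + 1) * t powr p" using sb by (simp add: algebra_simps abs_le_iff)
    qed (use \<eta> in simp)
    have 3: "\<bar>\<rho> u * s - \<rho> u * (\<kappa> * t powr p)\<bar> \<le> R * (\<eta> * t powr p)"
    proof -
      have "\<bar>\<rho> u * s - \<rho> u * (\<kappa> * t powr p)\<bar> = \<rho> u * \<bar>s - \<kappa> * t powr p\<bar>"
        using nonneg[of u] nu by (simp add: right_diff_distrib[symmetric] abs_mult)
      also have "\<dots> \<le> R * (\<eta> * t powr p)" using R u sb nonneg[of u] nu by (intro mult_mono) auto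
      finally show ?thesis .
    qed
    have "\<bar>P - \<rho> u * (\<kappa> * t powr p)\<bar> \<le> \<eta> * ((\<kappa> + 1) * t powr p) + R * (\<eta> * t powr p)"
      using 1 2 3 by linarith
    also have "\<dots> = \<eta> * (\<kappa> + 1 + R) * t powr p" by (simp add: algebra_simps)
    also have "\<dots> \<le> \<epsilon> * t powr p" by (intro mult_right_mono \<eta>) simp
    finally show "\<bar>measure ?D (cap u t) - \<rho> u * cap_const TYPE('l) * t powr (1 / alphaR TYPE('l))\<bar> \<le> \<epsilon> * t powr (1 / alphaR TYPE('l))"
      unfolding P_def \<kappa>_def p_def by (simp add: mult.assoc)
  qed
qed

text \<open>For small t the product of the two caps, restricted to the spheres, lies in the
  neighbourhood where the joint density is bounded. The mass is then a constant times the product of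
  the two surface measures, each of order t powr (1 / \<alpha>).\<close>

lemma pair_density_cap_bound:
  fixes q :: "real^2^'l::finite" and f :: "(real^2^'l) \<times> (real^2^'l) \<Rightarrow> ennreal"
  assumes q: "q \<in> sphere 0 1" and f: "f \<in> borel_measurable (sphere_measure \<Otimes>\<^sub>M sphere_measure)"
    and U: "open U" "orbit_closure freq q \<times> orbit_closure freq q \<subseteq> U"
      "\<forall>z\<in>U \<inter> (sphere 0 1 \<times> sphere 0 1). f z \<le> ennreal B"
  obtains t0 C where "0 < t0" "C \<ge> 0" "\<And>t u v. 0 < t \<Longrightarrow> t < t0 \<Longrightarrow> u \<in> orbit_closure freq q \<Longrightarrow> v \<in> orbit_closure freq q \<Longrightarrow>
     emeasure (density (sphere_measure \<Otimes>\<^sub>M sphere_measure) f) (cap u t \<times> cap v t) \<le> ennreal (C * (t powr (1 / alphaR TYPE('l)))\<^sup>2)"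
proof -
  define p where "p = 1 / alphaR TYPE('l)"
  define \<kappa> where "\<kappa> = cap_const TYPE('l)"
  define OC where "OC = orbit_closure freq q"
  have Oc: "compact OC" "OC \<subseteq> sphere 0 1" unfolding OC_def using compact_orbit_closure[OF q] orbit_closure_subset_sphere[OF q] by auto
  have One: "OC \<times> OC \<noteq> {}" unfolding OC_def using rope_u_in_orbit_closure by blast
  \<comment> \<open>Applied to the constant function 0, since only a uniform radius inside U is
    wanted.\<close>
  obtain d where d: "d > 0" "\<And>u x. u \<in> OC \<times> OC \<Longrightarrow> x \<in> sphere 0 1 \<times> sphere 0 1 \<Longrightarrow> dist x u < d \<Longrightarrow> x \<in> U \<and> \<bar>(0::real) - 0\<bar> < 1"
    using compact_neighborhood_uniform[OF compact_Times[OF Oc(1) Oc(1)] One U(1) U(2)[folded OC_def]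
        closed_Times[OF closed_sphere closed_sphere] Sigma_mono[OF Oc(2) Oc(2)] continuous_on_const zero_less_one, of 0] by blast
  obtain t1 where t1: "0 < t1" "\<forall>t u. 0 < t \<longrightarrow> t < t1 \<longrightarrow> norm (u::real^2^'l) = 1 \<longrightarrow>
       emeasure sphere_measure (cap u t) < \<infinity> \<and> \<bar>measure sphere_measure (cap u t) - \<kappa> * t powr p\<bar> \<le> 1 * t powr p"
    using sphere_cap_asymp[of 1] unfolding cap_def \<kappa>_def p_def by (metis zero_less_one)
  have \<kappa>0: "\<kappa> \<ge> 0" unfolding \<kappa>_def cap_const_eq by simp
  show thesis
  \<comment> \<open>The bound d^2 / 8 on t puts each coordinate within d / 2 of its centre, hence
    the pair within d. The absolute value is taken because B may be negative.\<close>
  proof (rule that[of "min t1 (d\<^sup>2 / 8)" "\<bar>B\<bar> * (\<kappa> + 1)\<^sup>2"])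
    show "0 < min t1 (d\<^sup>2 / 8)" "0 \<le> \<bar>B\<bar> * (\<kappa> + 1)\<^sup>2" using t1 d by auto
    fix t u v assume t: "0 < t" "t < min t1 (d\<^sup>2 / 8)" and uv: "u \<in> orbit_closure freq q" "v \<in> orbit_closure freq q"
    have nu: "norm u = 1" "norm v = 1" using uv Oc(2) unfolding OC_def by auto
    have cb: "emeasure sphere_measure (cap w t) \<le> ennreal ((\<kappa> + 1) * t powr p)" if "norm w = 1" for w :: "real^2^'l"
    proof -
      have w: "emeasure sphere_measure (cap w t) < \<infinity> \<and> \<bar>measure sphere_measure (cap w t) - \<kappa> * t powr p\<bar> \<le> 1 * t powr p"
        using t1(2) t that by simp
      have "emeasure sphere_measure (cap w t) = ennreal (measure sphere_measure (cap w t))"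
        by (rule finite_measure.emeasure_eq_measure[OF finite_measure_sphere_measure])
      also have "\<dots> \<le> ennreal ((\<kappa> + 1) * t powr p)" using w by (intro ennreal_leI) (simp add: algebra_simps abs_le_iff)
      finally show ?thesis .
    qed
    interpret S: finite_measure "sphere_measure :: (real^2^'l) measure" by (rule finite_measure_sphere_measure)
    interpret SS: pair_sigma_finite "sphere_measure :: (real^2^'l) measure" "sphere_measure :: (real^2^'l) measure" ..
    have AEz: "AE z in sphere_measure \<Otimes>\<^sub>M sphere_measure. z \<in> sphere (0::real^2^'l) (1::real) \<times> sphere (0::real^2^'l) (1::real)"
    proof (rule SS.AE_pair_measure)
      have "sphere (0::real^2^'l) (1::real) \<times> sphere (0::real^2^'l) (1::real) \<in> sets (sphere_measure \<Otimes>\<^sub>M (sphere_measure :: (real^2^'l) measure))"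
        by (intro pair_measureI) (simp_all add: borel_closed)
      then show "{z \<in> space (sphere_measure \<Otimes>\<^sub>M sphere_measure). z \<in> sphere (0::real^2^'l) (1::real) \<times> sphere (0::real^2^'l) (1::real)} \<in> sets (sphere_measure \<Otimes>\<^sub>M sphere_measure)"
        by (simp add: space_pair_measure sphere_measure_def)
      show "AE x in sphere_measure. AE y in sphere_measure. (x, y) \<in> sphere (0::real^2^'l) (1::real) \<times> sphere (0::real^2^'l) (1::real)"
        using AE_sphere_measure
      proof eventually_elim
        case (elim x)
        show ?case using AE_sphere_measure by eventually_elim (use elim in auto)
      qed
    qed
    have cs: "cap u t \<times> cap v t \<in> sets (sphere_measure \<Otimes>\<^sub>M sphere_measure)" by (intro pair_measureI) simp_all
    have "emeasure (density (sphere_measure \<Otimes>\<^sub>M sphere_measure) f) (cap u t \<times> cap v t)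
       = (\<integral>\<^sup>+z. f z * indicator (cap u t \<times> cap v t) z \<partial>(sphere_measure \<Otimes>\<^sub>M sphere_measure))"
      by (rule emeasure_density[OF f cs])
    also have "\<dots> \<le> (\<integral>\<^sup>+z. ennreal \<bar>B\<bar> * indicator (cap u t \<times> cap v t) z \<partial>(sphere_measure \<Otimes>\<^sub>M sphere_measure))"
    proof (rule nn_integral_mono_AE, use AEz in eventually_elim)
      case (elim z)
      show ?case
      proof (cases "z \<in> cap u t \<times> cap v t")
        case True
        obtain x y where z: "z = (x, y)" by (cases z)
        have h: "2 * t < (d/2)\<^sup>2" "d/2 > 0" using t d(1) by (auto simp: power_divide)
        have "dist x u < d/2" by (rule dist_in_cap[OF nu(1) _ _ h]) (use True elim z in simp_all)
        moreover have "dist y v < d/2" by (rule dist_in_cap[OF nu(2) _ _ h]) (use True elim z in simp_all)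
        moreover have "dist z (u, v) \<le> dist x u + dist y v" unfolding z dist_Pair_Pair by (rule sqrt_sum_squares_le_sum) auto
        ultimately have "dist z (u, v) < d" by linarith
        moreover have "(u, v) \<in> OC \<times> OC" using uv by (simp add: OC_def)
        ultimately have "z \<in> U" using d(2) elim by blast
        then have "f z \<le> ennreal B" using U(3) elim by blast
        also have "\<dots> \<le> ennreal \<bar>B\<bar>" by (intro ennreal_leI) simp
        finally show ?thesis using True by simp
      qed simp
    qed
    also have "\<dots> = ennreal \<bar>B\<bar> * (emeasure sphere_measure (cap u t) * emeasure sphere_measure (cap v t))"
      by (subst nn_integral_cmult_indicator[OF cs]) (simp add: S.emeasure_pair_measure_Times)
    also have "\<dots> \<le> ennreal \<bar>B\<bar> * (ennreal ((\<kappa> + 1) * t powr p) * ennreal ((\<kappa> + 1) * t powr p))"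
      by (intro mult_left_mono mult_mono cb nu) auto
    also have "\<dots> = ennreal (\<bar>B\<bar> * (\<kappa> + 1)\<^sup>2 * (t powr p)\<^sup>2)"
      using \<kappa>0 by (simp add: ennreal_mult[symmetric] power2_eq_square mult.assoc mult.left_commute)
    finally show "emeasure (density (sphere_measure \<Otimes>\<^sub>M sphere_measure) f) (cap u t \<times> cap v t) \<le> ennreal (\<bar>B\<bar> * (\<kappa> + 1)\<^sup>2 * (t powr (1 / alphaR TYPE('l)))\<^sup>2)"
      unfolding p_def .
  qed
qed

subsection \<open>Decreasing rearrangements\<close>

text \<open>Zero padding turns the decreasing rearrangement into an infinite sequence, so that
  samples and the Poisson sequence obey the same estimates.\<close>

definition sorted_weights :: "real list \<Rightarrow> nat \<Rightarrow> real" where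
  "sorted_weights xs j = (if j < length xs then desc_stat xs j else 0)"

lemma desc_stat_in_set: "j < length xs \<Longrightarrow> desc_stat xs j \<in> set xs"
proof -
  assume "j < length xs"
  then have "rev (sort xs) ! j \<in> set (rev (sort xs))" by (intro nth_mem) simp
  then show ?thesis unfolding desc_stat_def by simp
qed

lemma desc_stat_antimono: "i \<le> j \<Longrightarrow> j < length xs \<Longrightarrow> desc_stat xs j \<le> desc_stat xs i"
  unfolding desc_stat_def by (simp add: rev_nth) (intro sorted_nth_mono, auto)

lemma desc_stat_divide:
  assumes "c > 0" "j < length xs"
  shows "desc_stat (map (\<lambda>x. x / c) xs) j = desc_stat xs j / c"
proof -
  have "sorted (map (\<lambda>x. x / c) (sort xs))"
    unfolding sorted_map by (rule sorted_wrt_mono_rel[OF _ sorted_sort]) (use assms in \<open>simp add: divide_right_mono\<close>)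
  then have "sort (map (\<lambda>x. x / c) xs) = map (\<lambda>x. x / c) (sort xs)"
    by (rule properties_for_sort[rotated]) simp
  then show ?thesis using assms(2) unfolding desc_stat_def by (simp add: rev_map)
qed

lemma sorted_weights_unit: "set xs \<subseteq> {0..1} \<Longrightarrow> 0 \<le> sorted_weights xs i \<and> sorted_weights xs i \<le> 1"
  using desc_stat_in_set[of i xs] by (auto simp: sorted_weights_def)

lemma sorted_weights_antimono: "set xs \<subseteq> {0..1} \<Longrightarrow> i \<le> j \<Longrightarrow> sorted_weights xs j \<le> sorted_weights xs i"
  using desc_stat_antimono[of i j xs] sorted_weights_unit[of xs i] by (auto simp: sorted_weights_def)

text \<open>Sorting preserves the multiset of entries; the condition on 0 keeps the padding out of
  the count.\<close>

lemma sorted_weights_card: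
  assumes "0 \<notin> A"
  shows "card {i. sorted_weights xs i \<in> A} = card {i. i < length xs \<and> xs ! i \<in> A}"
proof -
  let ?ys = "rev (sort xs)"
  have "{i. sorted_weights xs i \<in> A} = {i. i < length ?ys \<and> ?ys ! i \<in> A}"
    using assms by (auto simp: sorted_weights_def desc_stat_def)
  then have "card {i. sorted_weights xs i \<in> A} = length (filter (\<lambda>x. x \<in> A) ?ys)"
    by (simp only: length_filter_conv_card)
  also have "\<dots> = size (filter_mset (\<lambda>x. x \<in> A) (mset ?ys))" by (simp only: mset_filter[symmetric] size_mset)
  also have "mset ?ys = mset xs" by simp
  also have "size (filter_mset (\<lambda>x. x \<in> A) (mset xs)) = length (filter (\<lambda>x. x \<in> A) xs)" by (simp only: mset_filter[symmetric] size_mset)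
  also have "\<dots> = card {i. i < length xs \<and> xs ! i \<in> A}" by (rule length_filter_conv_card)
  finally show ?thesis .
qed

lemma sorted_weights_sums:
  assumes "h 0 = (0::real)"
  shows "(\<lambda>i. h (sorted_weights xs i)) sums (\<Sum>i<length xs. h (xs ! i))"
proof -
  let ?ys = "rev (sort xs)"
  have "(\<lambda>i. h (sorted_weights xs i)) sums (\<Sum>i<length xs. h (sorted_weights xs i))"
    by (rule sums_finite) (auto simp: sorted_weights_def assms)
  also have "(\<Sum>i<length xs. h (sorted_weights xs i)) = sum_list (map h ?ys)"
    by (simp add: sum_list_sum_nth sorted_weights_def desc_stat_def atLeast0LessThan)
  also have "\<dots> = sum_mset (image_mset h (mset ?ys))" by (simp only: sum_mset_sum_list[symmetric] mset_map)
  also have "mset ?ys = mset xs" by simp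
  also have "sum_mset (image_mset h (mset xs)) = sum_list (map h xs)" by (simp only: sum_mset_sum_list[symmetric] mset_map)
  also have "\<dots> = (\<Sum>i<length xs. h (xs ! i))" by (simp add: sum_list_sum_nth atLeast0LessThan)
  finally show ?thesis .
qed

text \<open>For t > 0 the entry at position j is at least t exactly if more than j of the variables
  are, and the number of such variables is a finite sum of measurable indicators.\<close>

lemma measurable_sorted_weights:
  assumes x [measurable]: "\<And>i. x i \<in> borel_measurable M" and x01: "\<And>i \<omega>. \<omega> \<in> space M \<Longrightarrow> 0 \<le> x i \<omega> \<and> x i \<omega> \<le> (1::real)"
  shows "(\<lambda>\<omega>. sorted_weights (map (\<lambda>i. x i \<omega>) [0..<n]) j) \<in> borel_measurable M"
proof (subst borel_measurable_iff_ge, rule allI)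
  fix t :: real
  let ?w = "\<lambda>\<omega>. sorted_weights (map (\<lambda>i. x i \<omega>) [0..<n])"
  have unit: "set (map (\<lambda>i. x i \<omega>) [0..<n]) \<subseteq> {0..1}" if "\<omega> \<in> space M" for \<omega> using x01[OF that] by auto
  show "{\<omega> \<in> space M. t \<le> ?w \<omega> j} \<in> sets M"
  proof (cases "t \<le> 0")
    case True
    then have "{\<omega> \<in> space M. t \<le> ?w \<omega> j} = space M"
      using sorted_weights_unit[OF unit] by (auto intro: order_trans)
    then show ?thesis by simp
  next
    case False
    have "t \<le> ?w \<omega> j \<longleftrightarrow> j < (\<Sum>i<n. of_bool (t \<le> x i \<omega>))" if w: "\<omega> \<in> space M" for \<omega>
    proof -
      let ?S = "{i. ?w \<omega> i \<in> {t..}}"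
      have "j \<in> ?S \<longleftrightarrow> j < card ?S"
      proof (rule finite_downset_nat)
        show "finite ?S" by (rule finite_subset[of _ "{..<n}"]) (use False in \<open>auto simp: sorted_weights_def split: if_splits\<close>)
        show "\<And>i j. i \<in> ?S \<Longrightarrow> j < i \<Longrightarrow> j \<in> ?S"
          using sorted_weights_antimono[OF unit[OF w]] by (auto intro: order_trans less_imp_le)
      qed
      also have "card ?S = card {i. i < n \<and> t \<le> x i \<omega>}"
        using False by (subst sorted_weights_card) (auto intro!: arg_cong[where f=card])
      also have "\<dots> = (\<Sum>i\<in>{i\<in>{..<n}. t \<le> x i \<omega>}. 1)" by (simp add: conj_commute)
      also have "\<dots> = (\<Sum>i<n. if t \<le> x i \<omega> then 1 else 0)" by (rule sum.inter_filter) simp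
      finally show ?thesis by (simp add: of_bool_def)
    qed
    then have "{\<omega> \<in> space M. t \<le> ?w \<omega> j} = {\<omega> \<in> space M. j < (\<Sum>i<n. of_bool (t \<le> x i \<omega>))}" by blast
    also have "\<dots> \<in> sets M" by measurable
    finally show ?thesis .
  qed
qed

section \<open>Expected total of the small weights\<close>

text \<open>From ln z \<le> z at z = x / (2 * p). The polynomial growth of the expected counts is
  paid for with half of the exponential decay of the weights.\<close>

lemma powr_le_exp_half:
  fixes x p :: real
  assumes "x > 0" "p > 0"
  shows "x powr p \<le> (2 * p) powr p * exp (x / 2)"
proof -
  have "ln (x / (2 * p)) \<le> x / (2 * p)" using assms by (intro ln_bound) simp
  then have "p * ln (x / (2 * p)) \<le> x / 2" using mult_left_mono[of _ "x / (2 * p)" p] assms by fastforce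
  then have "exp (p * ln (x / (2 * p))) \<le> exp (x / 2)" by simp
  then have "(x / (2 * p)) powr p \<le> exp (x / 2)" using assms by (simp add: powr_def)
  then show ?thesis using assms by (simp add: powr_divide field_simps)
qed

lemma ennreal_suminf_swap: "(\<Sum>i. \<Sum>j. f i j) = (\<Sum>j. \<Sum>i. f i j)" for f :: "nat \<Rightarrow> nat \<Rightarrow> ennreal"
proof -
  have "(\<Sum>i. \<Sum>j. f i j) = (\<integral>\<^sup>+i. (\<Sum>j. f i j) \<partial>count_space UNIV)"
    by (rule nn_integral_count_space_nat[symmetric])
  also have "\<dots> = (\<Sum>j. \<integral>\<^sup>+i. f i j \<partial>count_space UNIV)" by (rule nn_integral_suminf) simp
  finally show ?thesis by (simp only: nn_integral_count_space_nat)
qed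

text \<open>The constant of \<open>powr_le_exp_half\<close>, times exp (1/2) for the shift by one in
  the argument, times the sum of the geometric series with ratio exp (- 1/2).\<close>

definition tail_const :: "real \<Rightarrow> real" where
  "tail_const p = (2 * p) powr p * exp (1/2) / (1 - exp (- 1/2))"

text \<open>Small weights are layered by the integer part of their negative logarithm. In layer K +
  a a weight is at most exp (- (K + a)), and the expected number of weights is at most D * (K + a +
  1) powr p, so the layers are dominated by a geometric series. The count hypothesis is the only
  input from the model.\<close>

lemma tail_weight_expectation:
  assumes w [measurable]: "\<And>i. w i \<in> borel_measurable M" and w01: "\<And>i \<omega>. \<omega> \<in> space M \<Longrightarrow> 0 \<le> w i \<omega> \<and> w i \<omega> \<le> 1"
    and p: "p > 0" and D: "D \<ge> 0"
    and cnt: "\<And>y. y \<ge> 1 \<Longrightarrow> (\<Sum>i. emeasure M {\<omega>\<in>space M. exp (- y) \<le> w i \<omega>}) \<le> ennreal (D * y powr p)"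
  shows "(\<integral>\<^sup>+\<omega>. (\<Sum>i. ennreal (w i \<omega> * of_bool (w i \<omega> < exp (- real K)))) \<partial>M) \<le> ennreal (D * tail_const p * exp (- real K / 2))"
proof -
  define c where "c a = exp (- real (K + a))" for a
  define E where "E i a = {\<omega>\<in>space M. exp (- (real (K + a) + 1)) \<le> w i \<omega>}" for i a
  have Em [measurable]: "E i a \<in> sets M" for i a unfolding E_def by measurable
  have pt: "ennreal (w i \<omega> * of_bool (w i \<omega> < exp (- real K))) \<le> (\<Sum>a. ennreal (c a) * indicator (E i a) \<omega>)"
    if \<omega>: "\<omega> \<in> space M" for i \<omega>
  proof (cases "0 < w i \<omega> \<and> w i \<omega> < exp (- real K)")
    case True
    define v where "v = - ln (w i \<omega>)"
    have wv: "w i \<omega> = exp (- v)" unfolding v_def using True by simp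
    have vK: "real K < v" using True unfolding wv by simp
    \<comment> \<open>The unit layer above K that contains v, the negative logarithm of the
      weight.\<close>
    define a where "a = nat \<lfloor>v\<rfloor> - K"
    have fl: "real (nat \<lfloor>v\<rfloor>) \<le> v" "v < real (nat \<lfloor>v\<rfloor>) + 1" "K \<le> nat \<lfloor>v\<rfloor>"
      using vK by (auto simp: le_nat_floor)
    have Ka: "K + a = nat \<lfloor>v\<rfloor>" unfolding a_def using fl(3) by simp
    have "exp (- (real (nat \<lfloor>v\<rfloor>) + 1)) \<le> w i \<omega>" unfolding wv using fl(2) by simp
    then have "\<omega> \<in> E i a" unfolding E_def Ka using \<omega> by blast
    have "w i \<omega> \<le> c a" unfolding c_def Ka wv using fl by simp
    then have "ennreal (w i \<omega> * of_bool (w i \<omega> < exp (- real K))) \<le> ennreal (c a) * indicator (E i a) \<omega>"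
      using True \<open>\<omega> \<in> E i a\<close> by (simp add: ennreal_leI)
    also have "\<dots> = (\<Sum>b\<in>{a}. ennreal (c b) * indicator (E i b) \<omega>)"
      by (simp only: sum.insert[OF finite.emptyI] empty_iff not_False_eq_True sum.empty add_0_right)
    also have "\<dots> \<le> (\<Sum>a. ennreal (c a) * indicator (E i a) \<omega>)" by (rule sum_le_suminf) auto
    finally show ?thesis .
  next
    case False
    then have z: "w i \<omega> * of_bool (w i \<omega> < exp (- real K)) = 0" using w01[OF \<omega>, of i] by auto
    show ?thesis unfolding z by simp
  qed
  have r: "0 < exp (- 1/2 :: real)" "exp (- 1/2 :: real) < 1" by auto
  have trm: "c a * (D * (real (K + a) + 1) powr p) \<le> D * ((2 * p) powr p * exp (1/2)) * exp (- real K / 2) * exp (- 1/2) ^ a" for a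
  proof -
    have "c a * (D * (real (K + a) + 1) powr p) \<le> c a * (D * ((2 * p) powr p * exp ((real (K + a) + 1) / 2)))"
      unfolding c_def using D by (intro mult_left_mono powr_le_exp_half p) auto
    also have "\<dots> = D * (2 * p) powr p * (exp (- real (K + a)) * exp ((real (K + a) + 1) / 2))" by (simp add: c_def)
    also have "exp (- real (K + a)) * exp ((real (K + a) + 1) / 2) = exp (1/2) * exp (- real K / 2) * exp (- 1/2) ^ a"
      by (simp add: exp_add[symmetric] exp_of_nat_mult[symmetric] field_simps)
    finally show ?thesis by (simp add: mult.assoc)
  qed
  have "(\<integral>\<^sup>+\<omega>. (\<Sum>i. ennreal (w i \<omega> * of_bool (w i \<omega> < exp (- real K)))) \<partial>M)
      = (\<Sum>i. \<integral>\<^sup>+\<omega>. ennreal (w i \<omega> * of_bool (w i \<omega> < exp (- real K))) \<partial>M)"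
    by (rule nn_integral_suminf) measurable
  also have "\<dots> \<le> (\<Sum>i. \<Sum>a. ennreal (c a) * emeasure M (E i a))"
  proof (rule suminf_le)
    fix i
    have "(\<integral>\<^sup>+\<omega>. ennreal (w i \<omega> * of_bool (w i \<omega> < exp (- real K))) \<partial>M) \<le> (\<integral>\<^sup>+\<omega>. (\<Sum>a. ennreal (c a) * indicator (E i a) \<omega>) \<partial>M)"
      by (rule nn_integral_mono) (rule pt)
    also have "\<dots> = (\<Sum>a. ennreal (c a) * emeasure M (E i a))"
      by (subst nn_integral_suminf) (auto simp: nn_integral_cmult_indicator)
    finally show "(\<integral>\<^sup>+\<omega>. ennreal (w i \<omega> * of_bool (w i \<omega> < exp (- real K))) \<partial>M) \<le> (\<Sum>a. ennreal (c a) * emeasure M (E i a))" .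
  qed auto
  also have "\<dots> = (\<Sum>a. ennreal (c a) * (\<Sum>i. emeasure M (E i a)))"
    by (subst ennreal_suminf_swap) (simp add: ennreal_suminf_cmult)
  also have "\<dots> \<le> (\<Sum>a. ennreal (D * ((2 * p) powr p * exp (1/2)) * exp (- real K / 2) * exp (- 1/2) ^ a))"
  proof (rule suminf_le)
    fix a
    have "ennreal (c a) * (\<Sum>i. emeasure M (E i a)) \<le> ennreal (c a) * ennreal (D * (real (K + a) + 1) powr p)"
      unfolding E_def by (intro mult_left_mono cnt) auto
    also have "\<dots> = ennreal (c a * (D * (real (K + a) + 1) powr p))"
      using D by (intro ennreal_mult[symmetric]) (auto simp: c_def)
    also have "\<dots> \<le> ennreal (D * ((2 * p) powr p * exp (1/2)) * exp (- real K / 2) * exp (- 1/2) ^ a)"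
      by (intro ennreal_leI trm)
    finally show "ennreal (c a) * (\<Sum>i. emeasure M (E i a)) \<le> ennreal (D * ((2 * p) powr p * exp (1/2)) * exp (- real K / 2) * exp (- 1/2) ^ a)" .
  qed auto
  also have "\<dots> = ennreal (D * tail_const p * exp (- real K / 2))"
  proof (rule suminf_ennreal_eq)
    have "(\<lambda>a. D * ((2 * p) powr p * exp (1/2)) * exp (- real K / 2) * exp (- 1/2) ^ a)
       sums (D * ((2 * p) powr p * exp (1/2)) * exp (- real K / 2) * (1 / (1 - exp (- 1/2))))"
      by (intro sums_mult geometric_sums) (use r in simp)
    then show "(\<lambda>a. D * ((2 * p) powr p * exp (1/2)) * exp (- real K / 2) * exp (- 1/2) ^ a) sums (D * tail_const p * exp (- real K / 2))"
      by (simp add: tail_const_def)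
  qed (use D in auto)
  finally show ?thesis .
qed

text \<open>The integrated form of the pointwise comparison between true and rounded weights. It is
  used twice, for the ordered sample and for the Poisson weights. The errors come from the modulus
  of f, the width of the cells, the event of a small maximal weight, and the weights below the last
  cell.\<close>

lemma (in probability) expectation_norm_weights_approx:
  fixes f :: "(nat \<Rightarrow> real) \<Rightarrow> real"
  assumes w [measurable]: "\<And>i. w i \<in> borel_measurable M"
    and AE_w: "AE \<omega> in M. (\<forall>i. 0 \<le> w i \<omega> \<and> w i \<omega> \<le> 1) \<and> (\<forall>i j. i \<le> j \<longrightarrow> w j \<omega> \<le> w i \<omega>) \<and> summable (\<lambda>i. w i \<omega>)"
    and C: "(\<lambda>\<omega>. cell_counts \<delta> r (\<lambda>i. w i \<omega>)) \<in> measurable M (count_space {c. \<forall>a\<ge>r. c a = 0})"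
    and \<delta>: "\<delta> > 0" "\<delta> * (real r - 1) = K" and \<tau>: "\<tau> \<ge> 0"
    and tail: "(\<integral>\<^sup>+\<omega>. (\<Sum>i. ennreal (w i \<omega> * of_bool (w i \<omega> < exp (- K)))) \<partial>M) \<le> ennreal \<tau>"
    and f: "continuous_on UNIV f" and B: "\<And>z. \<bar>f z\<bar> \<le> B" and L: "L \<ge> 0"
    and mod: "\<And>z z'. (\<And>j. 0 \<le> z j \<and> z j \<le> 1 \<and> 0 \<le> z' j \<and> z' j \<le> 1) \<Longrightarrow> (\<And>j. k \<le> j \<Longrightarrow> z j = 0 \<and> z' j = 0) \<Longrightarrow>
       \<bar>f z - f z'\<bar> \<le> \<epsilon> + L * (\<Sum>j<k. \<bar>z j - z' j\<bar>)"
  shows "\<bar>expectation (\<lambda>\<omega>. f (norm_weights k (\<lambda>i. w i \<omega>))) - expectation (\<lambda>\<omega>. f (count_weights \<delta> r k (cell_counts \<delta> r (\<lambda>i. w i \<omega>))))\<bar>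
    \<le> \<epsilon> + L * real k * (2 * \<delta> + prob {\<omega>\<in>space M. w 0 \<omega> < exp (- b)} + 2 * exp b * \<tau>)"
proof -
  define Z where "Z \<omega> = norm_weights k (\<lambda>i. w i \<omega>)" for \<omega>
  define Z' where "Z' \<omega> = count_weights \<delta> r k (cell_counts \<delta> r (\<lambda>i. w i \<omega>))" for \<omega>
  define T where "T \<omega> = (\<Sum>i. w i \<omega> * of_bool (w i \<omega> < exp (- K)))" for \<omega>
  have fm: "f \<in> borel_measurable borel" using f by (rule borel_measurable_continuous_onI)
  have Zm: "Z \<in> borel_measurable M" unfolding Z_def norm_weights_def
    by (rule measurable_coordinatewise_then_product) measurable
  have fZm: "(\<lambda>\<omega>. f (Z \<omega>)) \<in> borel_measurable M" by (rule measurable_compose[OF Zm fm])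
  have fZ'm: "(\<lambda>\<omega>. f (Z' \<omega>)) \<in> borel_measurable M" unfolding Z'_def by (rule measurable_compose[OF C]) simp
  have Tm [measurable]: "T \<in> borel_measurable M" unfolding T_def by measurable
  have iZ: "integrable M (\<lambda>\<omega>. f (Z \<omega>))" and iZ': "integrable M (\<lambda>\<omega>. f (Z' \<omega>))"
    by (auto intro!: integrable_const_bound[of _ B] fZm fZ'm simp: B)
  have T0: "AE \<omega> in M. 0 \<le> T \<omega> \<and> ennreal (T \<omega>) = (\<Sum>i. ennreal (w i \<omega> * of_bool (w i \<omega> < exp (- K))))"
    using AE_w
  proof eventually_elim
    case (elim \<omega>)
    have s: "summable (\<lambda>i. w i \<omega> * of_bool (w i \<omega> < exp (- K)))"
      by (rule summable_comparison_test'[of "\<lambda>i. w i \<omega>"]) (use elim in auto)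
    show ?case unfolding T_def using elim by (subst suminf_ennreal2[OF _ s]) (auto intro!: suminf_nonneg s)
  qed
  have "(\<integral>\<^sup>+\<omega>. ennreal (T \<omega>) \<partial>M) = (\<integral>\<^sup>+\<omega>. (\<Sum>i. ennreal (w i \<omega> * of_bool (w i \<omega> < exp (- K)))) \<partial>M)"
    by (rule nn_integral_cong_AE) (use T0 in eventually_elim, auto)
  then have nT: "(\<integral>\<^sup>+\<omega>. ennreal (T \<omega>) \<partial>M) \<le> ennreal \<tau>" using tail by simp
  have Tae: "AE \<omega> in M. 0 \<le> T \<omega>" using T0 by eventually_elim simp
  have iT: "integrable M T"
    by (rule integrableI_nonneg[OF Tm Tae]) (use nT in \<open>auto intro: le_less_trans\<close>)
  have "ennreal (expectation T) \<le> ennreal \<tau>" using nT unfolding nn_integral_eq_integral[OF iT Tae] .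
  then have ET: "expectation T \<le> \<tau>" using \<tau> by (simp only: ennreal_le_iff)
  have ind: "integrable M (\<lambda>\<omega>. of_bool (w 0 \<omega> < exp (- b)) :: real)"
    by (rule integrable_const_bound[of _ 1]) auto
  have Eind: "expectation (\<lambda>\<omega>. of_bool (w 0 \<omega> < exp (- b))) = prob {\<omega>\<in>space M. w 0 \<omega> < exp (- b)}"
  proof -
    have "expectation (\<lambda>\<omega>. of_bool (w 0 \<omega> < exp (- b))) = expectation (indicator {\<omega>\<in>space M. w 0 \<omega> < exp (- b)})"
      by (rule Bochner_Integration.integral_cong) (auto simp: indicator_def)
    also have "\<dots> = prob ({\<omega>\<in>space M. w 0 \<omega> < exp (- b)} \<inter> space M)" by (rule Bochner_Integration.integral_indicator)
    also have "{\<omega>\<in>space M. w 0 \<omega> < exp (- b)} \<inter> space M = {\<omega>\<in>space M. w 0 \<omega> < exp (- b)}" by blast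
    finally show ?thesis .
  qed
  define G where "G \<omega> = \<epsilon> + L * real k * (2 * \<delta> + of_bool (w 0 \<omega> < exp (- b)) + 2 * exp b * T \<omega>)" for \<omega>
  have iG: "integrable M G" unfolding G_def using ind iT by simp
  have EG: "expectation G = \<epsilon> + L * real k * (2 * \<delta> + prob {\<omega>\<in>space M. w 0 \<omega> < exp (- b)} + 2 * exp b * expectation T)"
    unfolding G_def using ind iT Eind by (simp add: prob_space)
  have "\<bar>expectation (\<lambda>\<omega>. f (Z \<omega>)) - expectation (\<lambda>\<omega>. f (Z' \<omega>))\<bar> = \<bar>expectation (\<lambda>\<omega>. f (Z \<omega>) - f (Z' \<omega>))\<bar>"
    using iZ iZ' by simp
  also have "\<dots> \<le> expectation (\<lambda>\<omega>. \<bar>f (Z \<omega>) - f (Z' \<omega>)\<bar>)" by (rule integral_abs_bound)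
  also have "\<dots> \<le> expectation G"
  proof (rule integral_mono_AE)
    show "integrable M (\<lambda>\<omega>. \<bar>f (Z \<omega>) - f (Z' \<omega>)\<bar>)" using iZ iZ' by simp
    show "AE \<omega> in M. \<bar>f (Z \<omega>) - f (Z' \<omega>)\<bar> \<le> G \<omega>" using AE_w
    proof eventually_elim
      case (elim \<omega>)
      have w: "\<And>i. 0 \<le> w i \<omega> \<and> w i \<omega> \<le> 1" "\<And>i j. i \<le> j \<Longrightarrow> w j \<omega> \<le> w i \<omega>" "summable (\<lambda>i. w i \<omega>)" using elim by auto
      have K: "- \<delta> * (real r - 1) = - K" using \<delta>(2) by simp
      have "\<bar>f (Z \<omega>) - f (Z' \<omega>)\<bar> \<le> \<epsilon> + L * (\<Sum>j<k. \<bar>Z \<omega> j - Z' \<omega> j\<bar>)"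
      proof (rule mod)
        show "0 \<le> Z \<omega> j \<and> Z \<omega> j \<le> 1 \<and> 0 \<le> Z' \<omega> j \<and> Z' \<omega> j \<le> 1" for j
          unfolding Z_def Z'_def using norm_weights_approx(1,2)[OF \<delta>(1) w] by blast
        show "Z \<omega> j = 0 \<and> Z' \<omega> j = 0" if "k \<le> j" for j
          using that by (simp add: Z_def Z'_def norm_weights_def count_weights_def)
      qed
      also have "\<dots> \<le> \<epsilon> + L * (\<Sum>j<k. 2 * \<delta> + of_bool (w 0 \<omega> < exp (- b)) + 2 * exp b * T \<omega>)"
        unfolding Z_def Z'_def T_def K[symmetric]
        by (intro add_left_mono mult_left_mono sum_mono norm_weights_approx(3) \<delta>(1) w L)
      also have "\<dots> = G \<omega>" by (simp add: G_def mult.assoc)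
      finally show ?case .
    qed
  qed (rule iG)
  also have "\<dots> \<le> \<epsilon> + L * real k * (2 * \<delta> + prob {\<omega>\<in>space M. w 0 \<omega> < exp (- b)} + 2 * exp b * \<tau>)"
    unfolding EG using ET L by (intro add_left_mono mult_left_mono) auto
  finally show ?thesis unfolding Z_def Z'_def .
qed

subsection \<open>Poisson processes with power intensity\<close>

text \<open>With \<open>max y 0\<close> the function vanishes on the negative half-line, which makes
  it a continuous nondecreasing function on the whole line, as \<open>interval_measure\<close>
  requires.\<close>

definition intensity :: "real \<Rightarrow> real \<Rightarrow> real \<Rightarrow> real \<Rightarrow> real" where
  "intensity c \<gamma> p y = c * (max y 0 / \<gamma>) powr p"

lemma intensity_nonneg: "c \<ge> 0 \<Longrightarrow> 0 \<le> intensity c \<gamma> p y"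
  by (simp add: intensity_def)

lemma intensity_nonpos_arg: "y \<le> 0 \<Longrightarrow> intensity c \<gamma> p y = 0"
  by (simp add: intensity_def max_def)

lemma intensity_mono:
  assumes "c \<ge> 0" "\<gamma> > 0" "p \<ge> 0" "x \<le> y" shows "intensity c \<gamma> p x \<le> intensity c \<gamma> p y"
  unfolding intensity_def using assms by (intro mult_left_mono powr_mono2 divide_right_mono) auto

lemma emeasure_intensity:
  assumes c: "c \<ge> 0" and \<gamma>: "\<gamma> > 0" and p: "p > 0" and ab: "a \<le> b"
  shows "emeasure (interval_measure (intensity c \<gamma> p)) {a<..b} = ennreal (intensity c \<gamma> p b - intensity c \<gamma> p a)"
proof (rule emeasure_interval_measure_Ioc[OF ab])
  show "\<And>x y. x \<le> y \<Longrightarrow> intensity c \<gamma> p x \<le> intensity c \<gamma> p y" using intensity_mono[OF c \<gamma>] p by simp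
  fix x
  have "continuous_on UNIV (intensity c \<gamma> p)"
    unfolding intensity_def using p \<gamma> by (intro continuous_intros continuous_on_powr') auto
  then show "continuous (at_right x) (intensity c \<gamma> p)"
    by (simp add: continuous_on_eq_continuous_within continuous_at_imp_continuous_within)
qed

lemma poisson_weight_mean: "(\<lambda>k. real k * poisson_weight l k) sums l"
proof -
  have "poisson_weight l sums 1" using poisson_weight_sums[of l 1] by simp
  then have "(\<lambda>k. l * poisson_weight l k) sums (l * 1)" by (rule sums_mult)
  moreover have "l * poisson_weight l k = real (Suc k) * poisson_weight l (Suc k)" for k
    by (simp add: poisson_weight_def field_simps del: of_nat_Suc)
  ultimately have "(\<lambda>k. real (Suc k) * poisson_weight l (Suc k)) sums l" by simp
  then show ?thesis by (subst (asm) sums_Suc_iff) simp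
qed

lemma poisson_pp_atomsD:
  fixes B :: "nat \<Rightarrow> real set"
  assumes ppp: "poisson_pp_atoms N Y Lam" and B: "\<And>j. j < r \<Longrightarrow> B j \<in> sets borel \<and> emeasure Lam (B j) < \<infinity>"
    and dis: "disjoint_family_on B {..<r}"
  shows "\<And>j. j < r \<Longrightarrow> AE \<omega> in N. finite {i. Y i \<omega> \<in> B j}"
    and "prob_space.indep_vars N (\<lambda>_. count_space UNIV) (\<lambda>j \<omega>. card {i. Y i \<omega> \<in> B j}) {..<r}"
    and "\<And>j c. j < r \<Longrightarrow> measure N {\<omega>\<in>space N. card {i. Y i \<omega> \<in> B j} = c} = poisson_weight (measure Lam (B j)) c"
proof -
  have "(\<forall>j<r. B j \<in> sets borel \<and> emeasure Lam (B j) < \<infinity>) \<and> disjoint_family_on B {..<r}"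
    using B dis by blast
  note D = ppp[unfolded poisson_pp_atoms_def, THEN conjunct2, THEN conjunct2, rule_format, OF this]
  show "\<And>j. j < r \<Longrightarrow> AE \<omega> in N. finite {i. Y i \<omega> \<in> B j}" using D by simp
  show "prob_space.indep_vars N (\<lambda>_. count_space UNIV) (\<lambda>j \<omega>. card {i. Y i \<omega> \<in> B j}) {..<r}" using D by simp
  show "\<And>j c. j < r \<Longrightarrow> measure N {\<omega>\<in>space N. card {i. Y i \<omega> \<in> B j} = c} = poisson_weight (measure Lam (B j)) c"
    using D by (simp add: poisson_weight_def)
qed

lemma poisson_pp_finite:
  assumes "poisson_pp_atoms N Y Lam" "B \<in> sets borel" "emeasure Lam B < \<infinity>"
  shows "AE \<omega> in N. finite {i. Y i \<omega> \<in> B}"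
  using poisson_pp_atomsD(1)[OF assms(1), of 1 "\<lambda>_. B" 0] assms(2,3) by (simp add: disjoint_family_on_def)

lemma
  fixes B :: "nat \<Rightarrow> real set"
  assumes ppp: "poisson_pp_atoms N Y Lam" and B: "\<And>j. j < r \<Longrightarrow> B j \<in> sets borel \<and> emeasure Lam (B j) < \<infinity>"
    and dis: "disjoint_family_on B {..<r}"
  shows poisson_pp_joint: "measure N {\<omega>\<in>space N. \<forall>a<r. card {i. Y i \<omega> \<in> B a} = c a} = (\<Prod>a<r. poisson_weight (measure Lam (B a)) (c a))"
    and poisson_pp_measurable: "\<And>a. a < r \<Longrightarrow> (\<lambda>\<omega>. card {i. Y i \<omega> \<in> B a}) \<in> measurable N (count_space UNIV)"
proof -
  interpret prob_space N using ppp by (simp add: poisson_pp_atoms_def)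
  note iv = poisson_pp_atomsD(2)[OF ppp B dis] and pw = poisson_pp_atomsD(3)[OF ppp B dis]
  show "\<And>a. a < r \<Longrightarrow> (\<lambda>\<omega>. card {i. Y i \<omega> \<in> B a}) \<in> measurable N (count_space UNIV)"
    using iv by (auto simp: indep_vars_def)
  show "prob {\<omega>\<in>space N. \<forall>a<r. card {i. Y i \<omega> \<in> B a} = c a} = (\<Prod>a<r. poisson_weight (measure Lam (B a)) (c a))"
  proof (cases "r = 0")
    case False
    have "prob (\<Inter>a\<in>{..<r}. (\<lambda>\<omega>. card {i. Y i \<omega> \<in> B a}) -` {c a} \<inter> space N) = (\<Prod>a<r. prob ((\<lambda>\<omega>. card {i. Y i \<omega> \<in> B a}) -` {c a} \<inter> space N))"
      by (rule indep_varsD[OF iv]) (use False in auto)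
    also have "(\<Inter>a\<in>{..<r}. (\<lambda>\<omega>. card {i. Y i \<omega> \<in> B a}) -` {c a} \<inter> space N) = {\<omega>\<in>space N. \<forall>a<r. card {i. Y i \<omega> \<in> B a} = c a}"
      using False by auto
    also have "(\<Prod>a<r. prob ((\<lambda>\<omega>. card {i. Y i \<omega> \<in> B a}) -` {c a} \<inter> space N)) = (\<Prod>a<r. poisson_weight (measure Lam (B a)) (c a))"
    proof (rule prod.cong)
      fix a assume "a \<in> {..<r}"
      moreover have "(\<lambda>\<omega>. card {i. Y i \<omega> \<in> B a}) -` {c a} \<inter> space N = {\<omega>\<in>space N. card {i. Y i \<omega> \<in> B a} = c a}" by auto
      ultimately show "prob ((\<lambda>\<omega>. card {i. Y i \<omega> \<in> B a}) -` {c a} \<inter> space N) = poisson_weight (measure Lam (B a)) (c a)"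
        using pw by simp
    qed simp
    finally show ?thesis .
  qed (simp add: prob_space)
qed

lemma poisson_pp_single:
  assumes ppp: "poisson_pp_atoms N Y Lam" and B: "B \<in> sets borel" "emeasure Lam B < \<infinity>"
  shows "measure N {\<omega>\<in>space N. card {i. Y i \<omega> \<in> B} = c} = poisson_weight (measure Lam B) c"
    and "(\<lambda>\<omega>. card {i. Y i \<omega> \<in> B}) \<in> measurable N (count_space UNIV)"
  using poisson_pp_joint[OF ppp, of 1 "\<lambda>_. B" "\<lambda>_. c"] poisson_pp_measurable[OF ppp, of 1 "\<lambda>_. B" 0] B
  by (auto simp: disjoint_family_on_def)

text \<open>Campbell's formula for an indicator: exchange sum and integral, then compute the mean of
  a Poisson variable from its point masses. It supplies the count hypothesis of the tail estimate on
  the Poisson side.\<close>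

lemma poisson_pp_expected_count:
  assumes ppp: "poisson_pp_atoms N Y Lam" and B: "B \<in> sets borel" "emeasure Lam B < \<infinity>"
  shows "(\<Sum>i. emeasure N {\<omega>\<in>space N. Y i \<omega> \<in> B}) = ennreal (measure Lam B)"
proof -
  interpret prob_space N using ppp by (simp add: poisson_pp_atoms_def)
  have Ym: "Y i \<in> borel_measurable N" for i using ppp by (simp add: poisson_pp_atoms_def)
  have Es [measurable]: "{\<omega>\<in>space N. Y i \<omega> \<in> B} \<in> sets N" for i
    using measurable_sets[OF Ym B(1), of i] by (simp add: vimage_def Int_def conj_commute)
  define X where "X \<omega> = card {i. Y i \<omega> \<in> B}" for \<omega>
  have Xm: "X \<in> measurable N (count_space UNIV)" unfolding X_def by (rule poisson_pp_single(2)[OF ppp B])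
  have Xs [measurable]: "{\<omega>\<in>space N. X \<omega> = c} \<in> sets N" for c
    using measurable_sets[OF Xm, of "{c}"] by (simp add: vimage_def Int_def conj_commute)
  have "(\<Sum>i. emeasure N {\<omega>\<in>space N. Y i \<omega> \<in> B}) = (\<Sum>i. \<integral>\<^sup>+\<omega>. indicator {\<omega>\<in>space N. Y i \<omega> \<in> B} \<omega> \<partial>N)" by simp
  also have "\<dots> = (\<integral>\<^sup>+\<omega>. (\<Sum>i. indicator {\<omega>\<in>space N. Y i \<omega> \<in> B} \<omega>) \<partial>N)"
    by (rule nn_integral_suminf[symmetric]) measurable
  also have "\<dots> = (\<integral>\<^sup>+\<omega>. (\<Sum>c. ennreal (real c) * indicator {\<omega>\<in>space N. X \<omega> = c} \<omega>) \<partial>N)"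
  proof (rule nn_integral_cong_AE)
    \<comment> \<open>Almost sure finiteness matters here: the cardinality of an infinite set is 0
      by convention, whereas the sum of indicators would be infinite.\<close>
    show "AE \<omega> in N. (\<Sum>i. indicator {\<omega>\<in>space N. Y i \<omega> \<in> B} \<omega> :: ennreal) = (\<Sum>c. ennreal (real c) * indicator {\<omega>\<in>space N. X \<omega> = c} \<omega>)"
      using poisson_pp_finite[OF ppp B] AE_space
    proof eventually_elim
      case (elim \<omega>)
      have "(\<Sum>i. indicator {\<omega>\<in>space N. Y i \<omega> \<in> B} \<omega> :: ennreal) = (\<Sum>i\<in>{i. Y i \<omega> \<in> B}. indicator {\<omega>\<in>space N. Y i \<omega> \<in> B} \<omega>)"
        by (rule suminf_finite[OF elim(1)]) auto
      also have "\<dots> = (\<Sum>i\<in>{i. Y i \<omega> \<in> B}. 1)" by (rule sum.cong) (use elim in auto)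
      also have "\<dots> = ennreal (real (X \<omega>))" by (simp add: X_def ennreal_of_nat_eq_real_of_nat)
      also have "\<dots> = (\<Sum>c\<in>{X \<omega>}. ennreal (real c) * indicator {\<omega>\<in>space N. X \<omega> = c} \<omega>)"
        using elim by (subst sum.insert) (auto simp: indicator_def)
      also have "\<dots> = (\<Sum>c. ennreal (real c) * indicator {\<omega>\<in>space N. X \<omega> = c} \<omega>)"
        by (rule suminf_finite[symmetric]) auto
      finally show ?case .
    qed
  qed
  also have "\<dots> = (\<Sum>c. ennreal (real c) * emeasure N {\<omega>\<in>space N. X \<omega> = c})"
    by (subst nn_integral_suminf) (auto simp: nn_integral_cmult_indicator)
  also have "\<dots> = (\<Sum>c. ennreal (real c * poisson_weight (measure Lam B) c))"
    unfolding X_def emeasure_eq_measure poisson_pp_single(1)[OF ppp B]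
    by (simp add: ennreal_mult poisson_weight_nonneg)
  also have "\<dots> = ennreal (measure Lam B)"
    by (rule suminf_ennreal_eq[OF _ poisson_weight_mean]) (simp add: poisson_weight_nonneg)
  finally show ?thesis .
qed

subsection \<open>Losses and weights in the RoPE setup\<close>

locale rope_setup = probability M
  for M :: "'w measure" +
  fixes q :: "real^2^'l::finite"
    and freq :: "'l \<Rightarrow> real"
    and X :: "int \<Rightarrow> 'w \<Rightarrow> real^2^'l"
    and m :: nat
    and \<rho> :: "real^2^'l \<Rightarrow> real"
    and \<beta> :: "nat \<Rightarrow> real"
    and \<gamma> :: real
  assumes q_sphere: "q \<in> sphere 0 1"
    and X_meas: "\<And>i. X i \<in> borel_measurable M"
    and X_sphere: "\<And>i \<omega>. \<omega> \<in> space M \<Longrightarrow> X i \<omega> \<in> sphere 0 1"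
    and stationary: "\<And>(s::int) (J::int set). finite J \<Longrightarrow>
          distr M (PiM J (\<lambda>_. borel)) (\<lambda>\<omega>. \<lambda>j\<in>J. X (j + s) \<omega>)
        = distr M (PiM J (\<lambda>_. borel)) (\<lambda>\<omega>. \<lambda>j\<in>J. X j \<omega>)"
    and m_dependent: "\<And>n::int. indep_var
          (PiM {..n} (\<lambda>_. borel)) (\<lambda>\<omega>. \<lambda>i\<in>{..n}. X i \<omega>)
          (PiM {n + int m + 1..} (\<lambda>_. borel)) (\<lambda>\<omega>. \<lambda>i\<in>{n + int m + 1..}. X i \<omega>)"
    and rho_meas: "\<rho> \<in> borel_measurable borel"
    and rho_nonneg: "\<And>x. x \<in> sphere 0 1 \<Longrightarrow> \<rho> x \<ge> 0"
    and density_X: "\<And>i. distr M borel (X i) = density sphere_measure (\<lambda>x. ennreal (\<rho> x))"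
    and rho_cont_pos: "\<exists>U. open U \<and> orbit_closure freq q \<subseteq> U \<and>
          continuous_on (U \<inter> sphere 0 1) \<rho> \<and> (\<forall>x\<in>U \<inter> sphere 0 1. \<rho> x > 0)"
    and pair_density: "\<And>l::nat. 1 \<le> l \<Longrightarrow> l \<le> m \<Longrightarrow>
          \<exists>f. f \<in> borel_measurable (sphere_measure \<Otimes>\<^sub>M sphere_measure) \<and>
            distr M (borel \<Otimes>\<^sub>M borel) (\<lambda>\<omega>. (X 0 \<omega>, X (int l) \<omega>))
              = density (sphere_measure \<Otimes>\<^sub>M sphere_measure) f \<and>
            (\<exists>U B. open U \<and> orbit_closure freq q \<times> orbit_closure freq q \<subseteq> U \<and>
               (\<forall>z\<in>U \<inter> (sphere 0 1 \<times> sphere 0 1). f z \<le> ennreal B))"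
    and beta_lim: "(\<lambda>n. \<beta> n * real n powr (- alphaR TYPE('l))) \<longlonglongrightarrow> \<gamma>"
    and gamma_pos: "0 < \<gamma>"
begin

definition pexp :: real where "pexp = 1 / alphaR TYPE('l)"

definition loss :: "int \<Rightarrow> 'w \<Rightarrow> real" where
  "loss i \<omega> = U_val freq q (\<lambda>i. X i \<omega>) i"

text \<open>Index i stands for token i + 1, so that i < n runs through the tokens 1 to n.\<close>

definition scaled_loss :: "nat \<Rightarrow> nat \<Rightarrow> 'w \<Rightarrow> real" where
  "scaled_loss n i \<omega> = \<beta> n * loss (int (Suc i)) \<omega>"

lemma pexp_pos: "pexp > 0"
  unfolding pexp_def by (rule inverse_alphaR_pos)

lemma loss_measurable [measurable]: "loss i \<in> borel_measurable M"
proof -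
  note [measurable] = X_meas
  show ?thesis unfolding loss_def U_val_def by measurable
qed

lemma scaled_loss_measurable [measurable]: "scaled_loss n i \<in> borel_measurable M"
  unfolding scaled_loss_def by measurable

lemma orbit_norm: "u \<in> orbit_closure freq q \<Longrightarrow> norm u = 1"
  using orbit_closure_subset_sphere[OF q_sphere, of freq] by auto

lemma loss_nonneg: "\<omega> \<in> space M \<Longrightarrow> 0 \<le> loss i \<omega>"
proof -
  assume "\<omega> \<in> space M"
  then have "norm (X i \<omega>) = 1" using X_sphere[of \<omega> i] by simp
  moreover have "norm (rope_u freq q i) = 1" using orbit_norm[OF rope_u_in_orbit_closure] .
  ultimately have "rope_u freq q i \<bullet> X i \<omega> \<le> 1" using norm_cauchy_schwarz[of "rope_u freq q i" "X i \<omega>"] by simp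
  then show ?thesis by (simp add: loss_def U_val_def)
qed

lemma prob_loss: "prob {\<omega>\<in>space M. loss i \<omega> \<le> t} = measure (density sphere_measure (\<lambda>x. ennreal (\<rho> x))) (cap (rope_u freq q i) t)"
proof -
  have "prob {\<omega>\<in>space M. loss i \<omega> \<le> t} = prob (X i -` cap (rope_u freq q i) t \<inter> space M)"
    by (rule arg_cong[where f=prob]) (auto simp: loss_def U_val_def cap_def)
  also have "\<dots> = measure (distr M borel (X i)) (cap (rope_u freq q i) t)"
    by (rule measure_distr[symmetric, OF X_meas cap_borel])
  finally show ?thesis unfolding density_X .
qed

lemma loss_asymp:
  assumes "\<epsilon> > 0"
  obtains t0 where "t0 > 0" "\<And>t i. 0 < t \<Longrightarrow> t < t0 \<Longrightarrow>
     \<bar>prob {\<omega>\<in>space M. loss i \<omega> \<le> t} - \<rho> (rope_u freq q i) * cap_const TYPE('l) * t powr pexp\<bar> \<le> \<epsilon> * t powr pexp"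
proof -
  obtain U where U: "open U" "orbit_closure freq q \<subseteq> U" "continuous_on (U \<inter> sphere 0 1) \<rho>" using rho_cont_pos by blast
  show thesis
  proof (rule density_cap_asymp[OF q_sphere rho_meas rho_nonneg U assms])
    fix t0 :: real assume t0: "0 < t0" and h: "\<And>t u. 0 < t \<Longrightarrow> t < t0 \<Longrightarrow> u \<in> orbit_closure freq q \<Longrightarrow>
     \<bar>measure (density sphere_measure (\<lambda>x. ennreal (\<rho> x))) (cap u t) - \<rho> u * cap_const TYPE('l) * t powr (1 / alphaR TYPE('l))\<bar>
       \<le> \<epsilon> * t powr (1 / alphaR TYPE('l))"
    show thesis
      by (rule that[OF t0]) (unfold prob_loss pexp_def, rule h, auto simp: rope_u_in_orbit_closure)
  qed
qed

lemma rho_facts: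
  shows "continuous_on (orbit_closure freq q) \<rho>" "\<And>x. x \<in> orbit_closure freq q \<Longrightarrow> \<rho> x > 0"
proof -
  obtain U where U: "open U" "orbit_closure freq q \<subseteq> U" "continuous_on (U \<inter> sphere 0 1) \<rho>" "\<forall>x\<in>U \<inter> sphere 0 1. \<rho> x > 0"
    using rho_cont_pos by blast
  have s: "orbit_closure freq q \<subseteq> U \<inter> sphere 0 1" using U(2) orbit_closure_subset_sphere[OF q_sphere] by blast
  show "continuous_on (orbit_closure freq q) \<rho>" by (rule continuous_on_subset[OF U(3) s])
  show "\<And>x. x \<in> orbit_closure freq q \<Longrightarrow> \<rho> x > 0" using U(4) s by blast
qed

lemma rho_orbit_bound: obtains R where "R > 0" "\<And>i. \<rho> (rope_u freq q i) \<le> R"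
proof -
  have "orbit_closure freq q \<noteq> {}" using rope_u_in_orbit_closure by blast
  then obtain x where x: "x \<in> orbit_closure freq q" "\<And>u. u \<in> orbit_closure freq q \<Longrightarrow> \<rho> u \<le> \<rho> x"
    using continuous_attains_sup[OF compact_orbit_closure[OF q_sphere] _ rho_facts(1)] by blast
  show thesis by (rule that[OF rho_facts(2)[OF x(1)] x(2)[OF rope_u_in_orbit_closure]])
qed

lemma cap_const_pos: "cap_const TYPE('l) > 0"
  unfolding cap_const_eq by simp

text \<open>The tail estimate looks at losses of every size, so a bound valid for all t is wanted
  and not only an asymptotic one.\<close>

lemma loss_bound:
  obtains C where "C > 0" "\<And>t i. 0 \<le> t \<Longrightarrow> prob {\<omega>\<in>space M. loss i \<omega> \<le> t} \<le> C * t powr pexp"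
proof -
  obtain R where R: "R > 0" "\<And>i. \<rho> (rope_u freq q i) \<le> R" using rho_orbit_bound by blast
  obtain t0 where t0: "t0 > 0" "\<And>t i. 0 < t \<Longrightarrow> t < t0 \<Longrightarrow>
     \<bar>prob {\<omega>\<in>space M. loss i \<omega> \<le> t} - \<rho> (rope_u freq q i) * cap_const TYPE('l) * t powr pexp\<bar> \<le> 1 * t powr pexp"
    by (rule loss_asymp[of 1]) auto
  \<comment> \<open>The first entry covers t < t0; the second makes C * t powr pexp at least 1 from
    t0 on.\<close>
  define C where "C = max (R * cap_const TYPE('l) + 1) (1 / t0 powr pexp)"
  have Cp: "C > 0" using t0(1) by (simp add: C_def less_max_iff_disj)
  have pos: "prob {\<omega>\<in>space M. loss i \<omega> \<le> t} \<le> C * t powr pexp" if t: "0 < t" for t i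
  proof (cases "t < t0")
    case True
    have "prob {\<omega>\<in>space M. loss i \<omega> \<le> t} \<le> (\<rho> (rope_u freq q i) * cap_const TYPE('l) + 1) * t powr pexp"
      using t0(2)[OF t True, of i] by (simp add: abs_le_iff distrib_right)
    also have "\<dots> \<le> (R * cap_const TYPE('l) + 1) * t powr pexp"
      using R(2)[of i] cap_const_pos by (intro mult_right_mono add_right_mono) auto
    also have "\<dots> \<le> C * t powr pexp" by (intro mult_right_mono) (auto simp: C_def)
    finally show ?thesis .
  next
    case False
    have "prob {\<omega>\<in>space M. loss i \<omega> \<le> t} \<le> 1" by simp
    also have "1 = 1 / t0 powr pexp * t0 powr pexp" using t0(1) by simp
    also have "\<dots> \<le> C * t powr pexp"
      using False t0(1) pexp_pos Cp by (intro mult_mono powr_mono2) (auto simp: C_def)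
    finally show ?thesis .
  qed
  show thesis
  proof (rule that[OF Cp])
    fix t :: real and i assume "0 \<le> t"
    show "prob {\<omega>\<in>space M. loss i \<omega> \<le> t} \<le> C * t powr pexp"
    proof (cases "t = 0")
      case True
      \<comment> \<open>At t = 0 the claim is that a loss vanishes with probability zero; it follows
        from the bound at s > 0 as s tends to 0.\<close>
      have "((\<lambda>s. C * s powr pexp) \<longlongrightarrow> C * 0 powr pexp) (at_right 0)"
        using pexp_pos by (intro tendsto_intros tendsto_powr') (auto simp: eventually_at_right_field intro!: exI[of _ 1])
      moreover have "eventually (\<lambda>s. prob {\<omega>\<in>space M. loss i \<omega> \<le> 0} \<le> C * s powr pexp) (at_right 0)"
        unfolding eventually_at_right_field
      proof (intro exI[of _ 1] conjI allI impI)
        fix s :: real assume "0 < s" "s < 1"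
        have "prob {\<omega>\<in>space M. loss i \<omega> \<le> 0} \<le> prob {\<omega>\<in>space M. loss i \<omega> \<le> s}"
          using \<open>0 < s\<close> by (intro finite_measure_mono) auto
        also have "\<dots> \<le> C * s powr pexp" by (rule pos[OF \<open>0 < s\<close>])
        finally show "prob {\<omega>\<in>space M. loss i \<omega> \<le> 0} \<le> C * s powr pexp" .
      qed simp
      ultimately have "prob {\<omega>\<in>space M. loss i \<omega> \<le> 0} \<le> C * 0 powr pexp"
        by (rule tendsto_lowerbound) simp
      then show ?thesis using True by simp
    next
      case False then show ?thesis using pos \<open>0 \<le> t\<close> by simp
    qed
  qed
qed

text \<open>Stationarity on the index set consisting of 0 and l; it transports the joint density
  assumed at the origin to every pair at lag l.\<close>

lemma pair_distr_shift:
  assumes "0 < l"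
  shows "distr M (borel \<Otimes>\<^sub>M borel) (\<lambda>\<omega>. (X i \<omega>, X (i + l) \<omega>)) = distr M (borel \<Otimes>\<^sub>M borel) (\<lambda>\<omega>. (X 0 \<omega>, X l \<omega>))"
proof -
  define J where "J = {0, l}"
  define g where "g = (\<lambda>f :: int \<Rightarrow> real^2^'l. (f 0, f l))"
  have gm: "g \<in> measurable (PiM J (\<lambda>_. borel)) (borel \<Otimes>\<^sub>M borel)"
    unfolding g_def by (intro measurable_Pair measurable_component_singleton) (auto simp: J_def)
  have hm: "(\<lambda>\<omega>. \<lambda>j\<in>J. X (j + s) \<omega>) \<in> measurable M (PiM J (\<lambda>_. borel))" for s
    by (intro measurable_restrict X_meas)
  have "distr M (borel \<Otimes>\<^sub>M borel) (g \<circ> (\<lambda>\<omega>. \<lambda>j\<in>J. X (j + i) \<omega>)) = distr (distr M (PiM J (\<lambda>_. borel)) (\<lambda>\<omega>. \<lambda>j\<in>J. X (j + i) \<omega>)) (borel \<Otimes>\<^sub>M borel) g"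
    by (rule distr_distr[symmetric, OF gm hm])
  also have "\<dots> = distr (distr M (PiM J (\<lambda>_. borel)) (\<lambda>\<omega>. \<lambda>j\<in>J. X j \<omega>)) (borel \<Otimes>\<^sub>M borel) g"
    by (subst stationary) (simp_all add: J_def)
  also have "\<dots> = distr M (borel \<Otimes>\<^sub>M borel) (g \<circ> (\<lambda>\<omega>. \<lambda>j\<in>J. X j \<omega>))"
    using hm[of 0] by (intro distr_distr[OF gm]) simp
  finally show ?thesis by (simp add: g_def J_def o_def add.commute)
qed

lemma pair_bound_single:
  assumes "1 \<le> l" "l \<le> m"
  shows "\<exists>t0 C. 0 < t0 \<and> 0 \<le> C \<and> (\<forall>t i. 0 < t \<longrightarrow> t < t0 \<longrightarrow>
     prob {\<omega>\<in>space M. loss i \<omega> \<le> t \<and> loss (i + int l) \<omega> \<le> t} \<le> C * (t powr pexp)\<^sup>2)"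
proof -
  obtain f U B where f: "f \<in> borel_measurable (sphere_measure \<Otimes>\<^sub>M (sphere_measure :: (real^2^'l) measure))"
    and d: "distr M (borel \<Otimes>\<^sub>M borel) (\<lambda>\<omega>. (X 0 \<omega>, X (int l) \<omega>)) = density (sphere_measure \<Otimes>\<^sub>M sphere_measure) f"
    and U: "open U" "orbit_closure freq q \<times> orbit_closure freq q \<subseteq> U" "\<forall>z\<in>U \<inter> (sphere 0 1 \<times> sphere 0 1). f z \<le> ennreal B"
    using pair_density[OF assms] by blast
  show ?thesis
  proof (rule pair_density_cap_bound[OF q_sphere f U])
    fix t0 C :: real assume t0: "0 < t0" and C: "0 \<le> C" and h: "\<And>t u v. 0 < t \<Longrightarrow> t < t0 \<Longrightarrow> u \<in> orbit_closure freq q \<Longrightarrow> v \<in> orbit_closure freq q \<Longrightarrow>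
     emeasure (density (sphere_measure \<Otimes>\<^sub>M sphere_measure) f) (cap u t \<times> cap v t) \<le> ennreal (C * (t powr (1 / alphaR TYPE('l)))\<^sup>2)"
    have "prob {\<omega>\<in>space M. loss i \<omega> \<le> t \<and> loss (i + int l) \<omega> \<le> t} \<le> C * (t powr pexp)\<^sup>2" if t: "0 < t" "t < t0" for t i
    proof -
      let ?u = "rope_u freq q i" and ?v = "rope_u freq q (i + int l)"
      have pm: "(\<lambda>\<omega>. (X i \<omega>, X (i + int l) \<omega>)) \<in> measurable M (borel \<Otimes>\<^sub>M borel)" by (intro measurable_Pair X_meas)
      have cs: "cap ?u t \<times> cap ?v t \<in> sets (borel \<Otimes>\<^sub>M borel)" by (intro pair_measureI cap_borel)
      have "emeasure M {\<omega>\<in>space M. loss i \<omega> \<le> t \<and> loss (i + int l) \<omega> \<le> t}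
         = emeasure M ((\<lambda>\<omega>. (X i \<omega>, X (i + int l) \<omega>)) -` (cap ?u t \<times> cap ?v t) \<inter> space M)"
        by (rule arg_cong[where f="emeasure M"]) (auto simp: loss_def U_val_def cap_def)
      also have "\<dots> = emeasure (distr M (borel \<Otimes>\<^sub>M borel) (\<lambda>\<omega>. (X i \<omega>, X (i + int l) \<omega>))) (cap ?u t \<times> cap ?v t)"
        by (rule emeasure_distr[symmetric, OF pm cs])
      also have "\<dots> = emeasure (density (sphere_measure \<Otimes>\<^sub>M sphere_measure) f) (cap ?u t \<times> cap ?v t)"
        using assms by (subst pair_distr_shift) (simp_all add: d)
      also have "\<dots> \<le> ennreal (C * (t powr pexp)\<^sup>2)" unfolding pexp_def by (rule h[OF t]) (rule rope_u_in_orbit_closure)+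
      finally show ?thesis using C by (simp add: emeasure_eq_measure ennreal_le_iff)
    qed
    then show ?thesis using t0 C by blast
  qed
qed

text \<open>Only lags 1 to m occur, so a common threshold and a common constant are collected by
  induction over the lags.\<close>

lemma pair_bound:
  obtains t0 C where "0 < t0" "0 \<le> C" "\<And>t i j. 0 < t \<Longrightarrow> t < t0 \<Longrightarrow> i < j \<Longrightarrow> j \<le> i + int m \<Longrightarrow>
     prob {\<omega>\<in>space M. loss i \<omega> \<le> t \<and> loss j \<omega> \<le> t} \<le> C * (t powr pexp)\<^sup>2"
proof -
  have "k \<le> m \<Longrightarrow> \<exists>t0 C. 0 < t0 \<and> 0 \<le> C \<and> (\<forall>t i l. 0 < t \<longrightarrow> t < t0 \<longrightarrow> 1 \<le> l \<longrightarrow> l \<le> k \<longrightarrow>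
     prob {\<omega>\<in>space M. loss i \<omega> \<le> t \<and> loss (i + int l) \<omega> \<le> t} \<le> C * (t powr pexp)\<^sup>2)" for k
  proof (induction k)
    case 0
    show ?case by (intro exI[of _ 1]) auto
  next
    case (Suc k)
    obtain t0 C where 1: "0 < t0" "0 \<le> C" "\<And>t i l. 0 < t \<Longrightarrow> t < t0 \<Longrightarrow> 1 \<le> l \<Longrightarrow> l \<le> k \<Longrightarrow>
     prob {\<omega>\<in>space M. loss i \<omega> \<le> t \<and> loss (i + int l) \<omega> \<le> t} \<le> C * (t powr pexp)\<^sup>2" using Suc by auto
    obtain t1 C1 where 2: "0 < t1" "0 \<le> C1" "\<And>t i. 0 < t \<Longrightarrow> t < t1 \<Longrightarrow>
     prob {\<omega>\<in>space M. loss i \<omega> \<le> t \<and> loss (i + int (Suc k)) \<omega> \<le> t} \<le> C1 * (t powr pexp)\<^sup>2"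
      using pair_bound_single[of "Suc k"] Suc.prems by auto
    have "prob {\<omega>\<in>space M. loss i \<omega> \<le> t \<and> loss (i + int l) \<omega> \<le> t} \<le> max C C1 * (t powr pexp)\<^sup>2"
      if "0 < t" "t < min t0 t1" "1 \<le> l" "l \<le> Suc k" for t i l
    proof (cases "l \<le> k")
      case True
      have "prob {\<omega>\<in>space M. loss i \<omega> \<le> t \<and> loss (i + int l) \<omega> \<le> t} \<le> C * (t powr pexp)\<^sup>2" by (rule 1(3)) (use that True in auto)
      also have "\<dots> \<le> max C C1 * (t powr pexp)\<^sup>2" by (intro mult_right_mono) auto
      finally show ?thesis .
    next
      case False
      then have l: "l = Suc k" using that by simp
      have "prob {\<omega>\<in>space M. loss i \<omega> \<le> t \<and> loss (i + int l) \<omega> \<le> t} \<le> C1 * (t powr pexp)\<^sup>2" unfolding l by (rule 2(3)) (use that in auto)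
      also have "\<dots> \<le> max C C1 * (t powr pexp)\<^sup>2" by (intro mult_right_mono) auto
      finally show ?thesis .
    qed
    then show ?case using 1(1,2) 2(1,2) by (intro exI[of _ "min t0 t1"] exI[of _ "max C C1"]) auto
  qed
  from this[of m] obtain t0 C where h: "0 < t0" "0 \<le> C" "\<And>t i l. 0 < t \<Longrightarrow> t < t0 \<Longrightarrow> 1 \<le> l \<Longrightarrow> l \<le> m \<Longrightarrow>
     prob {\<omega>\<in>space M. loss i \<omega> \<le> t \<and> loss (i + int l) \<omega> \<le> t} \<le> C * (t powr pexp)\<^sup>2" by auto
  show thesis
  proof (rule that[OF h(1,2)])
    fix t i j assume a: "0 < t" "t < t0" "i < j" "j \<le> i + int m"
    have "j = i + int (nat (j - i))" using a by simp
    then show "prob {\<omega>\<in>space M. loss i \<omega> \<le> t \<and> loss j \<omega> \<le> t} \<le> C * (t powr pexp)\<^sup>2"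
      using h(3)[of t "nat (j - i)" i] a by simp
  qed
qed

lemma alpha_pexp: "alphaR TYPE('l) * pexp = 1" "alphaR TYPE('l) > 0"
proof -
  show a: "alphaR TYPE('l) > 0" using inverse_alphaR_pos[where 'l='l] by simp
  then show "alphaR TYPE('l) * pexp = 1" by (simp add: pexp_def)
qed

lemma beta_pos: "eventually (\<lambda>n. \<beta> n > 0) sequentially"
proof -
  have "eventually (\<lambda>n. \<beta> n * real n powr (- alphaR TYPE('l)) > 0) sequentially"
    by (rule order_tendstoD(1)[OF beta_lim gamma_pos])
  then show ?thesis by eventually_elim (auto simp: zero_less_mult_iff)
qed

text \<open>As \<open>alphaR\<close> and \<open>pexp\<close> are reciprocal, n is the
  \<open>pexp\<close>-th power of n powr \<alpha>, and the sequence is a continuous function of the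
  one assumed to converge. This is the scaling that makes the expected counts converge.\<close>

lemma scaling_lim: "(\<lambda>n. real n * (1 / \<beta> n) powr pexp) \<longlonglongrightarrow> (1 / \<gamma>) powr pexp"
proof -
  have "(\<lambda>n. (1 / (\<beta> n * real n powr (- alphaR TYPE('l)))) powr pexp) \<longlonglongrightarrow> (1 / \<gamma>) powr pexp"
    using gamma_pos by (intro tendsto_intros beta_lim) auto
  moreover have "eventually (\<lambda>n. (1 / (\<beta> n * real n powr (- alphaR TYPE('l)))) powr pexp = real n * (1 / \<beta> n) powr pexp) sequentially"
    using beta_pos eventually_gt_at_top[of 0]
  proof eventually_elim
    case (elim n)
    have e: "1 / (\<beta> n * real n powr (- alphaR TYPE('l))) = 1 / \<beta> n * real n powr alphaR TYPE('l)"
      by (simp add: powr_minus_divide)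
    have "(1 / (\<beta> n * real n powr (- alphaR TYPE('l)))) powr pexp = (1 / \<beta> n) powr pexp * (real n powr alphaR TYPE('l)) powr pexp"
      unfolding e using elim by (subst powr_mult; simp)
    also have "(real n powr alphaR TYPE('l)) powr pexp = real n"
      using elim by (simp add: powr_powr alpha_pexp)
    finally show ?case by simp
  qed
  ultimately show ?thesis by (rule Lim_transform_eventually)
qed

lemma inverse_beta_lim: "(\<lambda>n. 1 / \<beta> n) \<longlonglongrightarrow> 0"
proof -
  have "(\<lambda>n. real n powr (- alphaR TYPE('l))) \<longlonglongrightarrow> 0"
    using alpha_pexp(2) by (intro tendsto_neg_powr filterlim_real_sequentially) simp
  moreover have "(\<lambda>n. inverse (\<beta> n * real n powr (- alphaR TYPE('l)))) \<longlonglongrightarrow> inverse \<gamma>"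
    using gamma_pos by (intro tendsto_inverse beta_lim) auto
  ultimately have "(\<lambda>n. real n powr (- alphaR TYPE('l)) * inverse (\<beta> n * real n powr (- alphaR TYPE('l)))) \<longlonglongrightarrow> 0 * inverse \<gamma>"
    by (intro tendsto_mult)
  moreover have "eventually (\<lambda>n. real n powr (- alphaR TYPE('l)) * inverse (\<beta> n * real n powr (- alphaR TYPE('l))) = 1 / \<beta> n) sequentially"
    using eventually_gt_at_top[of 0] by eventually_elim (simp add: divide_inverse)
  ultimately show ?thesis using Lim_transform_eventually by fastforce
qed

end

section \<open>Limit of the expected counts and Poisson convergence\<close>

context rope_setup
begin

definition lam :: "real \<Rightarrow> real" where
  "lam = intensity (Cbar freq q \<rho>) \<gamma> pexp"

lemma Cbar_eq: "Cbar freq q \<rho> = cap_const TYPE('l) * (\<integral>u. \<rho> u \<partial>pi_q freq q)"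
  by (simp add: Cbar_def cap_const_def)

lemma Cbar_pos: "Cbar freq q \<rho> > 0"
  unfolding Cbar_eq by (intro mult_pos_pos cap_const_pos integral_pi_q_pos[OF q_sphere rho_meas rho_facts])

lemma lam_nonneg: "0 \<le> lam y"
  unfolding lam_def using Cbar_pos by (intro intensity_nonneg) simp

lemma lam_mono: "x \<le> y \<Longrightarrow> lam x \<le> lam y"
  unfolding lam_def using Cbar_pos gamma_pos pexp_pos by (intro intensity_mono) auto

lemma prob_scaled_loss: "\<beta> n > 0 \<Longrightarrow> prob {\<omega>\<in>space M. scaled_loss n i \<omega> \<le> y} = prob {\<omega>\<in>space M. loss (int (Suc i)) \<omega> \<le> y / \<beta> n}"
  unfolding scaled_loss_def by (simp add: pos_le_divide_eq mult.commute)

lemma rho_average_shift: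
  "(\<lambda>n. (\<Sum>i<n. \<rho> (rope_u freq q (int (Suc i)))) / real n) \<longlonglongrightarrow> (\<integral>u. \<rho> u \<partial>pi_q freq q)"
  using rope_average[OF q_sphere rho_meas rho_facts] by (simp only: sum.atLeast1_atMost_eq One_nat_def)

text \<open>The uniformity in i of the cap asymptotics is essential: n individual errors add up to e
  * (n * s n powr pexp), and the bracket stays bounded. What remains is the average of \<rho> along
  the orbit times factors that converge.\<close>

lemma intensity_limit: "(\<lambda>n. \<Sum>i<n. prob {\<omega>\<in>space M. scaled_loss n i \<omega> \<le> y}) \<longlonglongrightarrow> lam y"
proof (cases "y > 0")
  case False
  obtain C where C: "C > 0" "\<And>t i. 0 \<le> t \<Longrightarrow> prob {\<omega>\<in>space M. loss i \<omega> \<le> t} \<le> C * t powr pexp" using loss_bound by blast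
  have z: "prob {\<omega>\<in>space M. scaled_loss n i \<omega> \<le> y} = 0" if "\<beta> n > 0" for n i
  proof -
    have "y / \<beta> n \<le> 0" using False that by (simp add: divide_le_0_iff)
    then have "prob {\<omega>\<in>space M. loss (int (Suc i)) \<omega> \<le> y / \<beta> n} \<le> prob {\<omega>\<in>space M. loss (int (Suc i)) \<omega> \<le> 0}"
      by (intro finite_measure_mono) auto
    also have "\<dots> \<le> 0" using C(2)[of 0 "int (Suc i)"] by simp
    finally show ?thesis unfolding prob_scaled_loss[OF that] using measure_nonneg[of M "{\<omega>\<in>space M. loss (int (Suc i)) \<omega> \<le> y / \<beta> n}"] by linarith
  qed
  have "eventually (\<lambda>n. (\<Sum>i<n. prob {\<omega>\<in>space M. scaled_loss n i \<omega> \<le> y}) = lam y) sequentially"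
    using beta_pos by eventually_elim (use False in \<open>simp add: z lam_def intensity_nonpos_arg\<close>)
  then show ?thesis by (rule tendsto_eventually)
next
  case True
  define s where "s n = y / \<beta> n" for n
  define g where "g = (y / \<gamma>) powr pexp"
  define a where "a n = (\<Sum>i<n. \<rho> (rope_u freq q (int (Suc i))) * cap_const TYPE('l) * s n powr pexp)" for n
  define P where "P n = (\<Sum>i<n. prob {\<omega>\<in>space M. scaled_loss n i \<omega> \<le> y})" for n
  have g0: "g \<ge> 0" by (simp add: g_def)
  have sp: "s n powr pexp = y powr pexp * (1 / \<beta> n) powr pexp" if "\<beta> n > 0" for n
    using True that powr_mult[of y "1 / \<beta> n" pexp] by (simp add: s_def)
  have nsp: "(\<lambda>n. real n * s n powr pexp) \<longlonglongrightarrow> g"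
  proof (rule Lim_transform_eventually)
    have "(\<lambda>n. y powr pexp * (real n * (1 / \<beta> n) powr pexp)) \<longlonglongrightarrow> y powr pexp * (1 / \<gamma>) powr pexp"
      by (intro tendsto_mult_left scaling_lim)
    also have "y powr pexp * (1 / \<gamma>) powr pexp = g" using True gamma_pos powr_mult[of y "1 / \<gamma>" pexp] by (simp add: g_def)
    finally show "(\<lambda>n. y powr pexp * (real n * (1 / \<beta> n) powr pexp)) \<longlonglongrightarrow> g" .
    show "eventually (\<lambda>n. y powr pexp * (real n * (1 / \<beta> n) powr pexp) = real n * s n powr pexp) sequentially"
      using beta_pos by eventually_elim (simp add: sp)
  qed
  have s0: "s \<longlonglongrightarrow> 0"
  proof -
    have "(\<lambda>n. y * (1 / \<beta> n)) \<longlonglongrightarrow> y * 0" by (intro tendsto_mult_left inverse_beta_lim)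
    then show ?thesis by (simp add: s_def[abs_def])
  qed
  have alim: "a \<longlonglongrightarrow> lam y"
  proof (rule Lim_transform_eventually)
    let ?avg = "\<lambda>n. (\<Sum>i<n. \<rho> (rope_u freq q (int (Suc i)))) / real n"
    have "(\<lambda>n. cap_const TYPE('l) * (real n * s n powr pexp) * ?avg n) \<longlonglongrightarrow> cap_const TYPE('l) * g * (\<integral>u. \<rho> u \<partial>pi_q freq q)"
      by (intro tendsto_mult tendsto_const nsp rho_average_shift)
    also have "cap_const TYPE('l) * g * (\<integral>u. \<rho> u \<partial>pi_q freq q) = lam y"
      using True by (simp add: lam_def intensity_def Cbar_eq g_def max_def)
    finally show "(\<lambda>n. cap_const TYPE('l) * (real n * s n powr pexp) * ?avg n) \<longlonglongrightarrow> lam y" .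
    show "eventually (\<lambda>n. cap_const TYPE('l) * (real n * s n powr pexp) * ?avg n = a n) sequentially"
      using eventually_gt_at_top[of 0]
    proof eventually_elim
      case (elim n)
      have "a n = (\<Sum>i<n. \<rho> (rope_u freq q (int (Suc i)))) * (cap_const TYPE('l) * s n powr pexp)"
        unfolding a_def sum_distrib_right by (simp add: mult.assoc)
      then show ?case using elim by simp
    qed
  qed
  have diff: "(\<lambda>n. P n - a n) \<longlonglongrightarrow> 0"
  proof (rule LIMSEQ_I)
    fix \<epsilon> :: real assume "\<epsilon> > 0"
    \<comment> \<open>Eventually n * s n powr pexp is below g + 1, so the total error is at most
      \<epsilon> / 2.\<close>
    define e where "e = \<epsilon> / (2 * (g + 1))"
    have e: "e > 0" using \<open>\<epsilon> > 0\<close> g0 by (simp add: e_def)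
    obtain t0 where t0: "t0 > 0" "\<And>t i. 0 < t \<Longrightarrow> t < t0 \<Longrightarrow>
       \<bar>prob {\<omega>\<in>space M. loss i \<omega> \<le> t} - \<rho> (rope_u freq q i) * cap_const TYPE('l) * t powr pexp\<bar> \<le> e * t powr pexp"
      using loss_asymp[OF e] by blast
    have "eventually (\<lambda>n. real n * s n powr pexp < g + 1) sequentially" by (rule order_tendstoD(2)[OF nsp]) simp
    moreover have "eventually (\<lambda>n. s n < t0) sequentially" by (rule order_tendstoD(2)[OF s0 t0(1)])
    ultimately have "eventually (\<lambda>n. norm (P n - a n - 0) < \<epsilon>) sequentially" using beta_pos
    proof eventually_elim
      case (elim n)
      have sp: "0 < s n" using True elim(3) by (simp add: s_def)
      have "\<bar>P n - a n\<bar> = \<bar>\<Sum>i<n. prob {\<omega>\<in>space M. loss (int (Suc i)) \<omega> \<le> s n} - \<rho> (rope_u freq q (int (Suc i))) * cap_const TYPE('l) * s n powr pexp\<bar>"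
        unfolding P_def a_def prob_scaled_loss[OF elim(3)] s_def[symmetric] by (simp only: sum_subtractf)
      also have "\<dots> \<le> (\<Sum>i<n. e * s n powr pexp)"
        by (rule order_trans[OF sum_abs], rule sum_mono, rule t0(2)[OF sp elim(2)])
      also have "\<dots> = e * (real n * s n powr pexp)" by simp
      also have "\<dots> \<le> e * (g + 1)" using elim(1) e by (intro mult_left_mono) auto
      also have "\<dots> = \<epsilon> / 2" using g0 by (simp add: e_def divide_simps)
      also have "\<dots> < \<epsilon>" using \<open>\<epsilon> > 0\<close> by simp
      finally show ?case by simp
    qed
    then show "\<exists>no. \<forall>n\<ge>no. norm (P n - a n - 0) < \<epsilon>" by (simp add: eventually_sequentially)
  qed
  have "(\<lambda>n. (P n - a n) + a n) \<longlonglongrightarrow> 0 + lam y" by (intro tendsto_add diff alim)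
  then show ?thesis by (simp add: P_def)
qed

lemma scaled_loss_indep:
  assumes g: "g \<in> borel_measurable borel" and g01: "\<And>v. 0 \<le> g v \<and> g v \<le> (1::real)"
  shows "expectation (\<lambda>\<omega>. (1 - g (scaled_loss n j \<omega>)) * (\<Prod>i<j-m. g (scaled_loss n i \<omega>)))
    = expectation (\<lambda>\<omega>. 1 - g (scaled_loss n j \<omega>)) * expectation (\<lambda>\<omega>. \<Prod>i<j-m. g (scaled_loss n i \<omega>))"
proof -
  \<comment> \<open>Factors with i < j - m involve tokens up to k = j - m, and the loss with index j
    involves token j + 1 = k + m + 1, so the gap is exactly the one in \<open>m_dependent\<close>.
    For j < m the product is empty and k is negative.\<close>
  define k where "k = int j - int m"
  define h where "h = (\<lambda>i (x :: int \<Rightarrow> real^2^'l). g (\<beta> n * (1 - inner (rope_u freq q i) (x i))))"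
  define Y1 where "Y1 x = (\<Prod>i<j-m. h (int (Suc i)) x)" for x
  define Y2 where "Y2 x = 1 - h (int (Suc j)) x" for x
  have hm: "h i \<in> borel_measurable (PiM J (\<lambda>_. borel))" if "i \<in> J" for i J
  proof -
    have "(\<lambda>x. x i) \<in> measurable (PiM J (\<lambda>_. borel)) (borel :: (real^2^'l) measure)"
      using that by (rule measurable_component_singleton)
    moreover have "(\<lambda>v. g (\<beta> n * (1 - inner (rope_u freq q i) v))) \<in> borel_measurable borel"
      by (rule measurable_compose[OF _ g]) measurable
    ultimately show ?thesis unfolding h_def by (rule measurable_compose)
  qed
  have Y1m: "Y1 \<in> borel_measurable (PiM {..k} (\<lambda>_. borel))"
    unfolding Y1_def by (intro borel_measurable_prod hm) (auto simp: k_def)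
  have Y2m: "Y2 \<in> borel_measurable (PiM {k + int m + 1..} (\<lambda>_. borel))"
    unfolding Y2_def by (intro borel_measurable_diff borel_measurable_const hm) (auto simp: k_def)
  have ind: "indep_var borel (Y1 \<circ> (\<lambda>\<omega>. \<lambda>i\<in>{..k}. X i \<omega>)) borel (Y2 \<circ> (\<lambda>\<omega>. \<lambda>i\<in>{k + int m + 1..}. X i \<omega>))"
    by (rule indep_var_compose[OF m_dependent Y1m Y2m])
  have e1: "Y1 \<circ> (\<lambda>\<omega>. \<lambda>i\<in>{..k}. X i \<omega>) = (\<lambda>\<omega>. \<Prod>i<j-m. g (scaled_loss n i \<omega>))"
    unfolding Y1_def h_def by (auto simp: fun_eq_iff scaled_loss_def loss_def U_val_def k_def intro!: prod.cong)
  have e2: "Y2 \<circ> (\<lambda>\<omega>. \<lambda>i\<in>{k + int m + 1..}. X i \<omega>) = (\<lambda>\<omega>. 1 - g (scaled_loss n j \<omega>))"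
    unfolding Y2_def h_def by (auto simp: fun_eq_iff scaled_loss_def loss_def U_val_def k_def)
  note [measurable] = g
  have b: "0 \<le> (\<Prod>i<j-m. g (scaled_loss n i \<omega>)) \<and> (\<Prod>i<j-m. g (scaled_loss n i \<omega>)) \<le> 1" for \<omega>
    using g01 by (auto intro!: prod_nonneg prod_le_1)
  have "expectation (\<lambda>\<omega>. (\<Prod>i<j-m. g (scaled_loss n i \<omega>)) * (1 - g (scaled_loss n j \<omega>)))
    = expectation (\<lambda>\<omega>. \<Prod>i<j-m. g (scaled_loss n i \<omega>)) * expectation (\<lambda>\<omega>. 1 - g (scaled_loss n j \<omega>))"
  proof (rule indep_var_lebesgue_integral[OF ind[unfolded e1 e2]])
    show "integrable M (\<lambda>\<omega>. \<Prod>i<j-m. g (scaled_loss n i \<omega>))"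
      by (rule integrable_const_bound[of _ 1]) (use b in auto)
    show "integrable M (\<lambda>\<omega>. 1 - g (scaled_loss n j \<omega>))"
      by (rule integrable_const_bound[of _ 1]) (use g01 in auto)
  qed
  then show ?thesis by (simp only: mult.commute)
qed

text \<open>All sets lie below y, so hitting one of them forces an unscaled loss below s = y /
  \<beta> n. This has probability O(s powr pexp) = O(1 / n), and for two tokens at distance at most
  m it is O(1 / n^2).\<close>

lemma scaled_loss_counts_limit:
  fixes B :: "nat \<Rightarrow> real set"
  assumes B: "\<And>a. B a \<in> sets borel" and dis: "disjoint_family_on B {..<r}" and sub: "\<And>a. a < r \<Longrightarrow> B a \<subseteq> {..y}" and y: "y > 0"
    and l: "\<And>a. l a \<ge> 0" and intens: "\<And>a. a < r \<Longrightarrow> (\<lambda>n. \<Sum>i<n. prob {\<omega>\<in>space M. scaled_loss n i \<omega> \<in> B a}) \<longlonglongrightarrow> l a"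
  shows "(\<lambda>n. prob {\<omega>\<in>space M. \<forall>a<r. card {i. i < n \<and> scaled_loss n i \<omega> \<in> B a} = c a}) \<longlonglongrightarrow> (\<Prod>a<r. poisson_weight (l a) (c a))"
proof -
  obtain C0 where C0: "C0 > 0" "\<And>t i. 0 \<le> t \<Longrightarrow> prob {\<omega>\<in>space M. loss i \<omega> \<le> t} \<le> C0 * t powr pexp" using loss_bound by blast
  obtain t0 C1 where C1: "0 < t0" "0 \<le> C1" "\<And>t i j. 0 < t \<Longrightarrow> t < t0 \<Longrightarrow> i < j \<Longrightarrow> j \<le> i + int m \<Longrightarrow>
     prob {\<omega>\<in>space M. loss i \<omega> \<le> t \<and> loss j \<omega> \<le> t} \<le> C1 * (t powr pexp)\<^sup>2" using pair_bound by blast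
  define G where "G = y powr pexp * ((1 / \<gamma>) powr pexp + 1)"
  define K where "K = max (C0 * G) (C1 * G\<^sup>2)"
  have G0: "G \<ge> 0" by (simp add: G_def)
  define s where "s n = y / \<beta> n" for n
  have ev: "eventually (\<lambda>n. 0 < n \<and> \<beta> n > 0 \<and> 0 < s n \<and> s n < t0 \<and> s n powr pexp \<le> G / real n) sequentially"
  proof -
    have "(\<lambda>n. y * (1 / \<beta> n)) \<longlonglongrightarrow> y * 0" by (intro tendsto_mult_left inverse_beta_lim)
    then have "eventually (\<lambda>n. s n < t0) sequentially" by (intro order_tendstoD(2)[OF _ C1(1)]) (simp add: s_def[abs_def])
    moreover have "eventually (\<lambda>n. real n * (1 / \<beta> n) powr pexp < (1 / \<gamma>) powr pexp + 1) sequentially"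
      by (rule order_tendstoD(2)[OF scaling_lim]) simp
    ultimately show ?thesis using beta_pos eventually_gt_at_top[of 0]
    proof eventually_elim
      case (elim n)
      have "s n powr pexp = y powr pexp * (1 / \<beta> n) powr pexp"
        using y elim powr_mult[of y "1 / \<beta> n" pexp] by (simp add: s_def)
      also have "real n * \<dots> = y powr pexp * (real n * (1 / \<beta> n) powr pexp)" by simp
      also have "\<dots> \<le> G" unfolding G_def using elim by (intro mult_left_mono) auto
      finally have "s n powr pexp \<le> G / real n" using elim by (simp add: pos_le_divide_eq mult.commute)
      then show ?case using elim y by (simp add: s_def)
    qed
  qed
  have inU: "scaled_loss n i \<omega> \<in> (\<Union>a<r. B a) \<Longrightarrow> \<beta> n > 0 \<Longrightarrow> loss (int (Suc i)) \<omega> \<le> s n" for n i \<omega>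
    using sub unfolding s_def scaled_loss_def by (force simp: pos_le_divide_eq mult.commute)
  show ?thesis
  proof (rule counts_tendsto_poisson[where V=scaled_loss and B=B and r=r and l=l and m=m and K=K])
    show "\<And>n i. scaled_loss n i \<in> borel_measurable M" by (rule scaled_loss_measurable)
    show "\<And>a. B a \<in> sets borel" by (rule B)
    show "disjoint_family_on B {..<r}" by (rule dis)
    show "\<And>a. 0 \<le> l a" by (rule l)
    show "\<And>a. a < r \<Longrightarrow> (\<lambda>n. \<Sum>i<n. prob {\<omega>\<in>space M. scaled_loss n i \<omega> \<in> B a}) \<longlonglongrightarrow> l a" by (rule intens)
    show "expectation (\<lambda>\<omega>. (1 - g (scaled_loss n j \<omega>)) * (\<Prod>i<j-m. g (scaled_loss n i \<omega>)))
      = expectation (\<lambda>\<omega>. 1 - g (scaled_loss n j \<omega>)) * expectation (\<lambda>\<omega>. \<Prod>i<j-m. g (scaled_loss n i \<omega>))"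
      if "g \<in> borel_measurable borel" "\<And>v. 0 \<le> g v \<and> g v \<le> (1::real)" for n j g by (rule scaled_loss_indep[OF that])
    show "eventually (\<lambda>n. \<forall>i<n. prob {\<omega>\<in>space M. scaled_loss n i \<omega> \<in> (\<Union>a<r. B a)} \<le> K / real n) sequentially"
      using ev
    proof eventually_elim
      case (elim n)
      show ?case
      proof (intro allI impI)
        fix i
        have "prob {\<omega>\<in>space M. scaled_loss n i \<omega> \<in> (\<Union>a<r. B a)} \<le> prob {\<omega>\<in>space M. loss (int (Suc i)) \<omega> \<le> s n}"
          using inU elim by (intro finite_measure_mono) auto
        also have "\<dots> \<le> C0 * s n powr pexp" using elim by (intro C0(2)) simp
        also have "\<dots> \<le> C0 * (G / real n)" using elim C0(1) by (intro mult_left_mono) auto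
        also have "\<dots> \<le> K / real n" by (simp add: K_def divide_right_mono)
        finally show "prob {\<omega>\<in>space M. scaled_loss n i \<omega> \<in> (\<Union>a<r. B a)} \<le> K / real n" .
      qed
    qed
    show "eventually (\<lambda>n. \<forall>i j. i < j \<longrightarrow> j < n \<longrightarrow> j \<le> i + m \<longrightarrow> prob {\<omega>\<in>space M. scaled_loss n i \<omega> \<in> (\<Union>a<r. B a) \<and> scaled_loss n j \<omega> \<in> (\<Union>a<r. B a)} \<le> K / (real n)\<^sup>2) sequentially"
      using ev
    proof eventually_elim
      case (elim n)
      show ?case
      proof (intro allI impI)
        fix i j assume ij: "i < j" "j < n" "j \<le> i + m"
        have "prob {\<omega>\<in>space M. scaled_loss n i \<omega> \<in> (\<Union>a<r. B a) \<and> scaled_loss n j \<omega> \<in> (\<Union>a<r. B a)}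
            \<le> prob {\<omega>\<in>space M. loss (int (Suc i)) \<omega> \<le> s n \<and> loss (int (Suc j)) \<omega> \<le> s n}"
          using inU elim by (intro finite_measure_mono) auto
        also have "\<dots> \<le> C1 * (s n powr pexp)\<^sup>2" using elim ij by (intro C1(3)) auto
        also have "\<dots> \<le> C1 * (G / real n)\<^sup>2" using elim C1(2) by (intro mult_left_mono power_mono) auto
        also have "\<dots> = C1 * G\<^sup>2 / (real n)\<^sup>2" by (simp add: power_divide)
        also have "\<dots> \<le> K / (real n)\<^sup>2" by (simp add: K_def divide_right_mono)
        finally show "prob {\<omega>\<in>space M. scaled_loss n i \<omega> \<in> (\<Union>a<r. B a) \<and> scaled_loss n j \<omega> \<in> (\<Union>a<r. B a)} \<le> K / (real n)\<^sup>2" .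
      qed
    qed
  qed
qed

end

section \<open>Cell counts and tails of the sample weights\<close>

text \<open>The cells on the scale of losses. They are open on the left, the form in which
  \<open>interval_measure\<close> is a difference of values of its generating function.\<close>

definition log_cell :: "real \<Rightarrow> nat \<Rightarrow> real set" where
  "log_cell \<delta> a = {\<delta> * (real a - 1)<..\<delta> * real a}"

lemma exp_in_cell: "exp (- v) \<in> cell \<delta> a \<longleftrightarrow> v \<in> log_cell \<delta> a"
  by (auto simp: cell_def log_cell_def)

lemma log_cell_borel [measurable]: "log_cell \<delta> a \<in> sets borel"
  by (simp add: log_cell_def)

lemma log_cell_disjoint: "\<delta> > 0 \<Longrightarrow> disjoint_family_on (log_cell \<delta>) {..<r}"
proof (unfold disjoint_family_on_def, intro ballI impI)
  fix a b :: nat assume "\<delta> > 0" "a \<noteq> b"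
  then show "log_cell \<delta> a \<inter> log_cell \<delta> b = {}"
    using cell_disjoint[of \<delta> a b] unfolding disjoint_iff exp_in_cell[symmetric] by blast
qed

context rope_setup
begin

lemma log_cell_counts_limit:
  assumes \<delta>: "\<delta> > 0"
  shows "(\<lambda>n. prob {\<omega>\<in>space M. \<forall>a<r. card {i. i < n \<and> scaled_loss n i \<omega> \<in> log_cell \<delta> a} = c a})
    \<longlonglongrightarrow> (\<Prod>a<r. poisson_weight (lam (\<delta> * real a) - lam (\<delta> * (real a - 1))) (c a))"
proof (rule scaled_loss_counts_limit)
  show "log_cell \<delta> a \<subseteq> {..\<delta> * real r + 1}" if "a < r" for a
  proof -
    have "\<delta> * real a \<le> \<delta> * real r" using that \<delta> by simp
    then show ?thesis by (auto simp: log_cell_def)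
  qed
  show "\<delta> * real r + 1 > 0" using \<delta> by (simp add: add_nonneg_pos)
  show "0 \<le> lam (\<delta> * real a) - lam (\<delta> * (real a - 1))" for a using lam_mono \<delta> by simp
  fix a
  have d: "prob {\<omega>\<in>space M. scaled_loss n i \<omega> \<in> log_cell \<delta> a} = prob {\<omega>\<in>space M. scaled_loss n i \<omega> \<le> \<delta> * real a} - prob {\<omega>\<in>space M. scaled_loss n i \<omega> \<le> \<delta> * (real a - 1)}" for n i
  proof -
    have e: "{\<omega>\<in>space M. scaled_loss n i \<omega> \<in> log_cell \<delta> a} = {\<omega>\<in>space M. scaled_loss n i \<omega> \<le> \<delta> * real a} - {\<omega>\<in>space M. scaled_loss n i \<omega> \<le> \<delta> * (real a - 1)}"
      by (auto simp: log_cell_def)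
    have "\<delta> * (real a - 1) \<le> \<delta> * real a" using \<delta> by simp
    then have sub: "{\<omega>\<in>space M. scaled_loss n i \<omega> \<le> \<delta> * (real a - 1)} \<subseteq> {\<omega>\<in>space M. scaled_loss n i \<omega> \<le> \<delta> * real a}"
      by auto
    show ?thesis unfolding e by (rule finite_measure_Diff[OF _ _ sub]) measurable
  qed
  show "(\<lambda>n. \<Sum>i<n. prob {\<omega>\<in>space M. scaled_loss n i \<omega> \<in> log_cell \<delta> a}) \<longlonglongrightarrow> lam (\<delta> * real a) - lam (\<delta> * (real a - 1))"
    unfolding d sum_subtractf by (intro tendsto_diff intensity_limit)
qed (use \<delta> in \<open>auto intro: log_cell_disjoint\<close>)

text \<open>The case of a single set. It controls the event that even the largest weight is below
  exp (- b).\<close>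

lemma no_small_loss_limit: "(\<lambda>n. prob {\<omega>\<in>space M. card {i. i < n \<and> scaled_loss n i \<omega> \<in> {..b}} = 0}) \<longlonglongrightarrow> exp (- lam b)"
proof -
  have "(\<lambda>n. prob {\<omega>\<in>space M. \<forall>a<Suc 0. card {i. i < n \<and> scaled_loss n i \<omega> \<in> {..b}} = (\<lambda>_. 0) a}) \<longlonglongrightarrow> (\<Prod>a<Suc 0. poisson_weight ((\<lambda>_. lam b) a) ((\<lambda>_. 0) a))"
    by (rule scaled_loss_counts_limit[where y="max b 1"]) (auto simp: disjoint_family_on_def lam_nonneg intensity_limit)
  then show ?thesis by (simp add: poisson_weight_def)
qed

definition raw_weight :: "nat \<Rightarrow> nat \<Rightarrow> 'w \<Rightarrow> real" where
  "raw_weight n i \<omega> = (if i < n then exp (- scaled_loss n i \<omega>) else 0)"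

lemma raw_weight_measurable [measurable]: "raw_weight n i \<in> borel_measurable M"
  unfolding raw_weight_def by (cases "i < n") simp_all

lemma raw_weight_unit: "\<beta> n > 0 \<Longrightarrow> \<omega> \<in> space M \<Longrightarrow> 0 \<le> raw_weight n i \<omega> \<and> raw_weight n i \<omega> \<le> 1"
  using loss_nonneg[of \<omega> "int (Suc i)"] by (simp add: raw_weight_def scaled_loss_def)

text \<open>The expected number of scaled losses up to y is at most C0 * y powr pexp times n * (1 /
  \<beta> n) powr pexp, which converges. D is fixed before K, because K is later chosen in terms of
  D.\<close>

lemma raw_weight_tail:
  obtains D where "D \<ge> 0" "\<And>K. eventually (\<lambda>n. (\<integral>\<^sup>+\<omega>. (\<Sum>i. ennreal (raw_weight n i \<omega> * of_bool (raw_weight n i \<omega> < exp (- real K)))) \<partial>M) \<le> ennreal (D * tail_const pexp * exp (- real K / 2))) sequentially"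
proof -
  obtain C0 where C0: "C0 > 0" "\<And>t i. 0 \<le> t \<Longrightarrow> prob {\<omega>\<in>space M. loss i \<omega> \<le> t} \<le> C0 * t powr pexp" using loss_bound by blast
  define G where "G = (1 / \<gamma>) powr pexp + 1"
  have G0: "G \<ge> 0" by (simp add: G_def)
  show thesis
  proof (rule that[of "C0 * G"])
    show "C0 * G \<ge> 0" using C0 G0 by simp
    fix K :: nat
    have "eventually (\<lambda>n. real n * (1 / \<beta> n) powr pexp < G) sequentially"
      unfolding G_def by (rule order_tendstoD(2)[OF scaling_lim]) simp
    then show "eventually (\<lambda>n. (\<integral>\<^sup>+\<omega>. (\<Sum>i. ennreal (raw_weight n i \<omega> * of_bool (raw_weight n i \<omega> < exp (- real K)))) \<partial>M) \<le> ennreal (C0 * G * tail_const pexp * exp (- real K / 2))) sequentially"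
      using beta_pos
    proof eventually_elim
      case (elim n)
      show ?case
      proof (rule tail_weight_expectation[OF raw_weight_measurable raw_weight_unit[OF elim(2)] pexp_pos])
        show "C0 * G \<ge> 0" using C0 G0 by simp
        fix y :: real assume y: "1 \<le> y"
        have "(\<Sum>i. emeasure M {\<omega>\<in>space M. exp (- y) \<le> raw_weight n i \<omega>}) = (\<Sum>i<n. emeasure M {\<omega>\<in>space M. exp (- y) \<le> raw_weight n i \<omega>})"
          by (rule suminf_finite) (auto simp: raw_weight_def not_le)
        also have "\<dots> = (\<Sum>i<n. ennreal (prob {\<omega>\<in>space M. scaled_loss n i \<omega> \<le> y}))"
          by (rule sum.cong) (simp_all add: raw_weight_def emeasure_eq_measure)
        also have "\<dots> \<le> (\<Sum>i<n. ennreal (C0 * (y / \<beta> n) powr pexp))"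
          unfolding prob_scaled_loss[OF elim(2)] using y elim by (intro sum_mono ennreal_leI C0(2)) simp
        also have "\<dots> = ennreal (real n * (C0 * (y / \<beta> n) powr pexp))"
          using C0(1) by (subst sum_ennreal) auto
        also have "\<dots> \<le> ennreal (C0 * G * y powr pexp)"
        proof (rule ennreal_leI)
          have "(y / \<beta> n) powr pexp = y powr pexp * (1 / \<beta> n) powr pexp"
            using y elim powr_mult[of y "1 / \<beta> n" pexp] by simp
          then have "real n * (C0 * (y / \<beta> n) powr pexp) = C0 * (real n * (1 / \<beta> n) powr pexp) * y powr pexp" by simp
          also have "\<dots> \<le> C0 * G * y powr pexp" using elim C0(1) by (intro mult_right_mono mult_left_mono) auto
          finally show "real n * (C0 * (y / \<beta> n) powr pexp) \<le> C0 * G * y powr pexp" .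
        qed
        finally show "(\<Sum>i. emeasure M {\<omega>\<in>space M. exp (- y) \<le> raw_weight n i \<omega>}) \<le> ennreal (C0 * G * y powr pexp)" .
      qed
    qed
  qed
qed

end

section \<open>Cell counts and tails of the Poisson weights\<close>

lemma cell_counts_exp:
  "cell_counts \<delta> r (\<lambda>i. exp (- y i)) = (\<lambda>a. if a < r then card {i. y i \<in> log_cell \<delta> a} else 0)"
  unfolding cell_counts_def exp_in_cell ..

lemma measure_intensity:
  assumes "c \<ge> 0" "\<gamma> > 0" "p > 0" "a \<le> b"
  shows "measure (interval_measure (intensity c \<gamma> p)) {a<..b} = intensity c \<gamma> p b - intensity c \<gamma> p a"
proof -
  have "0 \<le> intensity c \<gamma> p b - intensity c \<gamma> p a" using intensity_mono[of c \<gamma> p a b] assms by simp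
  then show ?thesis unfolding measure_def emeasure_intensity[OF assms] by (rule enn2real_ennreal)
qed

lemma
  fixes Y :: "nat \<Rightarrow> 'v \<Rightarrow> real"
  assumes ppp: "poisson_pp_atoms N Y (interval_measure (intensity c \<gamma> p))" and c: "c \<ge> 0" and \<gamma>: "\<gamma> > 0" and p: "p > 0" and \<delta>: "\<delta> > 0"
  shows poisson_pp_cell_counts: "\<forall>a\<ge>r. n a = 0 \<Longrightarrow> measure N {\<omega>\<in>space N. cell_counts \<delta> r (\<lambda>i. exp (- Y i \<omega>)) = n}
      = (\<Prod>a<r. poisson_weight (intensity c \<gamma> p (\<delta> * real a) - intensity c \<gamma> p (\<delta> * (real a - 1))) (n a))"
    and poisson_pp_cell_counts_measurable: "(\<lambda>\<omega>. cell_counts \<delta> r (\<lambda>i. exp (- Y i \<omega>))) \<in> measurable N (count_space {c. \<forall>a\<ge>r. c a = 0})"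
proof -
  have N: "prob_space N" using ppp by (simp add: poisson_pp_atoms_def)
  have ab: "\<delta> * (real a - 1) \<le> \<delta> * real a" for a using \<delta> by simp
  have B: "log_cell \<delta> a \<in> sets borel \<and> emeasure (interval_measure (intensity c \<gamma> p)) (log_cell \<delta> a) < \<infinity>" for a
    unfolding log_cell_def emeasure_intensity[OF c \<gamma> p ab] by simp
  have ml: "measure (interval_measure (intensity c \<gamma> p)) (log_cell \<delta> a) = intensity c \<gamma> p (\<delta> * real a) - intensity c \<gamma> p (\<delta> * (real a - 1))" for a
    unfolding log_cell_def by (rule measure_intensity[OF c \<gamma> p ab])
  note joint = poisson_pp_joint[OF ppp B log_cell_disjoint[OF \<delta>], of r] and meas = poisson_pp_measurable[OF ppp B log_cell_disjoint[OF \<delta>], of _ r]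
  show "measure N {\<omega>\<in>space N. cell_counts \<delta> r (\<lambda>i. exp (- Y i \<omega>)) = n}
      = (\<Prod>a<r. poisson_weight (intensity c \<gamma> p (\<delta> * real a) - intensity c \<gamma> p (\<delta> * (real a - 1))) (n a))" if n: "\<forall>a\<ge>r. n a = 0"
  proof -
    have "{\<omega>\<in>space N. cell_counts \<delta> r (\<lambda>i. exp (- Y i \<omega>)) = n} = {\<omega>\<in>space N. \<forall>a<r. card {i. Y i \<omega> \<in> log_cell \<delta> a} = n a}"
      unfolding cell_counts_exp using n by (auto simp: fun_eq_iff)
    then show ?thesis using joint[of n] unfolding ml by simp
  qed
  show "(\<lambda>\<omega>. cell_counts \<delta> r (\<lambda>i. exp (- Y i \<omega>))) \<in> measurable N (count_space {c. \<forall>a\<ge>r. c a = 0})"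
    unfolding cell_counts_exp by (rule probability.measurable_count_vector[OF probability.intro[OF N]]) (auto intro: meas)
qed

text \<open>The Poisson instance of the comparison. Campbell's formula bounds the tail, and the
  probability of no atom up to b bounds that of a small maximal weight.\<close>

lemma poisson_pp_weights_approx:
  fixes Y :: "nat \<Rightarrow> 'v \<Rightarrow> real" and f :: "(nat \<Rightarrow> real) \<Rightarrow> real"
  assumes ppp: "poisson_pp_atoms N Y (interval_measure (intensity c \<gamma> p))" and c: "c \<ge> 0" and \<gamma>: "\<gamma> > 0" and p: "p > 0"
    and ord: "\<And>\<omega>. \<omega> \<in> space N \<Longrightarrow> 0 < Y 0 \<omega> \<and> strict_mono (\<lambda>i. Y i \<omega>)"
    and \<delta>: "\<delta> > 0" "\<delta> * (real r - 1) = real K" and b: "b \<ge> 0"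
    and f: "continuous_on UNIV f" and B: "\<And>z. \<bar>f z\<bar> \<le> B" and L: "L \<ge> 0"
    and mod: "\<And>z z'. (\<And>j. 0 \<le> z j \<and> z j \<le> 1 \<and> 0 \<le> z' j \<and> z' j \<le> 1) \<Longrightarrow> (\<And>j. k \<le> j \<Longrightarrow> z j = 0 \<and> z' j = 0) \<Longrightarrow>
       \<bar>f z - f z'\<bar> \<le> \<epsilon> + L * (\<Sum>j<k. \<bar>z j - z' j\<bar>)"
  shows "\<bar>(\<integral>\<omega>. f (norm_weights k (\<lambda>i. exp (- Y i \<omega>))) \<partial>N) - (\<integral>\<omega>. f (count_weights \<delta> r k (cell_counts \<delta> r (\<lambda>i. exp (- Y i \<omega>)))) \<partial>N)\<bar>
    \<le> \<epsilon> + L * real k * (2 * \<delta> + exp (- intensity c \<gamma> p b) + 2 * exp b * (c * (1 / \<gamma>) powr p * tail_const p * exp (- real K / 2)))"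
proof -
  interpret probability N using ppp by (simp add: poisson_pp_atoms_def probability_def)
  define D where "D = c * (1 / \<gamma>) powr p"
  define w where "w i \<omega> = exp (- Y i \<omega>)" for i \<omega>
  have Ym [measurable]: "Y i \<in> borel_measurable N" for i using ppp by (simp add: poisson_pp_atoms_def)
  have wm: "w i \<in> borel_measurable N" for i unfolding w_def by measurable
  have Ypos: "0 < Y i \<omega>" if "\<omega> \<in> space N" for i \<omega>
    using ord[OF that] strict_mono_less_eq[of "\<lambda>i. Y i \<omega>" 0 i] by force
  have w01: "0 \<le> w i \<omega> \<and> w i \<omega> \<le> 1" if "\<omega> \<in> space N" for i \<omega> using Ypos[OF that, of i] by (simp add: w_def)
  have D: "D \<ge> 0" using c by (simp add: D_def)
  have fin: "emeasure (interval_measure (intensity c \<gamma> p)) {0<..y} < \<infinity>" and ms: "measure (interval_measure (intensity c \<gamma> p)) {0<..y} = intensity c \<gamma> p y"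
    if "y \<ge> 0" for y
    using emeasure_intensity[OF c \<gamma> p that] measure_intensity[OF c \<gamma> p that] by (simp_all add: intensity_nonpos_arg)
  have cnt: "(\<Sum>i. emeasure N {\<omega>\<in>space N. exp (- y) \<le> w i \<omega>}) \<le> ennreal (D * y powr p)" if y: "y \<ge> 1" for y
  proof -
    have "{\<omega>\<in>space N. exp (- y) \<le> w i \<omega>} = {\<omega>\<in>space N. Y i \<omega> \<in> {0<..y}}" for i
      using Ypos by (auto simp: w_def)
    then have "(\<Sum>i. emeasure N {\<omega>\<in>space N. exp (- y) \<le> w i \<omega>}) = ennreal (intensity c \<gamma> p y)"
      using poisson_pp_expected_count[OF ppp _ fin, of y] ms[of y] y by simp
    also have "intensity c \<gamma> p y = D * y powr p"
      using y \<gamma> powr_mult[of "1 / \<gamma>" y p] by (simp add: intensity_def D_def max_def)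
    finally show ?thesis by simp
  qed
  note tail = tail_weight_expectation[OF wm w01 p D cnt]
  \<comment> \<open>All weights are below 1, so the tail estimate at K = 0 bounds the expected sum
    of all weights; finite expectation gives almost sure summability.\<close>
  have AEw: "AE \<omega> in N. (\<forall>i. 0 \<le> w i \<omega> \<and> w i \<omega> \<le> 1) \<and> (\<forall>i j. i \<le> j \<longrightarrow> w j \<omega> \<le> w i \<omega>) \<and> summable (\<lambda>i. w i \<omega>)"
  proof -
    have m: "(\<lambda>\<omega>. \<Sum>i. ennreal (w i \<omega> * of_bool (w i \<omega> < exp (- real 0)))) \<in> borel_measurable N"
      using wm by measurable
    have "(\<integral>\<^sup>+\<omega>. (\<Sum>i. ennreal (w i \<omega> * of_bool (w i \<omega> < exp (- real 0)))) \<partial>N) \<noteq> \<infinity>"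
      using tail[of 0] by (auto simp: top_unique)
    then have "AE \<omega> in N. (\<Sum>i. ennreal (w i \<omega> * of_bool (w i \<omega> < exp (- real 0)))) \<noteq> \<infinity>"
      by (rule nn_integral_PInf_AE[OF m])
    then show ?thesis using AE_space
    proof eventually_elim
      case (elim \<omega>)
      have eq: "w i \<omega> * of_bool (w i \<omega> < exp (- real 0)) = w i \<omega>" for i using Ypos[OF elim(2), of i] by (simp add: w_def)
      have "(\<Sum>i. ennreal (w i \<omega>)) \<noteq> top" using elim(1) unfolding eq by simp
      then have "summable (\<lambda>i. w i \<omega>)" by (rule summable_suminf_not_top[rotated]) (simp add: w_def)
      moreover have "w j \<omega> \<le> w i \<omega>" if "i \<le> j" for i j
        using ord[OF elim(2)] that strict_mono_less_eq[of "\<lambda>i. Y i \<omega>" i j] by (simp add: w_def)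
      ultimately show ?case using w01[OF elim(2)] by blast
    qed
  qed
  have Cm: "(\<lambda>\<omega>. cell_counts \<delta> r (\<lambda>i. w i \<omega>)) \<in> measurable N (count_space {c. \<forall>a\<ge>r. c a = 0})"
    unfolding w_def by (rule poisson_pp_cell_counts_measurable[OF ppp c \<gamma> p \<delta>(1)])
  have Bb: "{0<..b} \<in> sets borel" by simp
  \<comment> \<open>If the largest weight is below exp (- b), the smallest atom exceeds b, and the
    interval up to b contains none.\<close>
  have "prob {\<omega>\<in>space N. w 0 \<omega> < exp (- b)} \<le> prob {\<omega>\<in>space N. card {i. Y i \<omega> \<in> {0<..b}} = 0}"
  proof (rule finite_measure_mono)
    show "{\<omega>\<in>space N. w 0 \<omega> < exp (- b)} \<subseteq> {\<omega>\<in>space N. card {i. Y i \<omega> \<in> {0<..b}} = 0}"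
    proof safe
      fix \<omega> assume \<omega>: "\<omega> \<in> space N" "w 0 \<omega> < exp (- b)"
      have "b < Y i \<omega>" for i
        using ord[OF \<omega>(1)] strict_mono_less_eq[of "\<lambda>i. Y i \<omega>" 0 i] \<omega>(2) by (force simp: w_def)
      then have "{i. Y i \<omega> \<in> {0<..b}} = {}" by (auto simp: not_le)
      then show "card {i. Y i \<omega> \<in> {0<..b}} = 0" by (simp only: card.empty)
    qed
    have "(\<lambda>\<omega>. card {i. Y i \<omega> \<in> {0<..b}}) -` {0} \<inter> space N \<in> sets N"
      by (rule measurable_sets[OF poisson_pp_single(2)[OF ppp Bb fin[OF b]]]) simp
    moreover have "(\<lambda>\<omega>. card {i. Y i \<omega> \<in> {0<..b}}) -` {0} \<inter> space N = {\<omega>\<in>space N. card {i. Y i \<omega> \<in> {0<..b}} = 0}" by blast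
    ultimately show "{\<omega>\<in>space N. card {i. Y i \<omega> \<in> {0<..b}} = 0} \<in> sets N" by (simp only:)
  qed
  also have "\<dots> = exp (- intensity c \<gamma> p b)"
    using poisson_pp_single(1)[OF ppp Bb fin[OF b], of 0] by (simp add: poisson_weight_def ms[OF b])
  finally have P0: "prob {\<omega>\<in>space N. w 0 \<omega> < exp (- b)} \<le> exp (- intensity c \<gamma> p b)" .
  have \<tau>: "0 \<le> D * tail_const p * exp (- real K / 2)" using D by (simp add: tail_const_def)
  have "\<bar>(\<integral>\<omega>. f (norm_weights k (\<lambda>i. w i \<omega>)) \<partial>N) - (\<integral>\<omega>. f (count_weights \<delta> r k (cell_counts \<delta> r (\<lambda>i. w i \<omega>))) \<partial>N)\<bar>
    \<le> \<epsilon> + L * real k * (2 * \<delta> + prob {\<omega>\<in>space N. w 0 \<omega> < exp (- b)} + 2 * exp b * (D * tail_const p * exp (- real K / 2)))"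
    by (rule expectation_norm_weights_approx[OF wm AEw Cm \<delta> \<tau> tail f B L mod])
  also have "\<dots> \<le> \<epsilon> + L * real k * (2 * \<delta> + exp (- intensity c \<gamma> p b) + 2 * exp b * (D * tail_const p * exp (- real K / 2)))"
    using P0 L by (intro add_left_mono mult_left_mono add_right_mono) auto
  finally show ?thesis unfolding w_def D_def .
qed

section \<open>Attention weights of the sample\<close>

context rope_setup
begin

definition sorted_loss_weights :: "nat \<Rightarrow> nat \<Rightarrow> 'w \<Rightarrow> real" where
  "sorted_loss_weights n j \<omega> = sorted_weights (map (\<lambda>i. raw_weight n i \<omega>) [0..<n]) j"

definition loss_counts :: "real \<Rightarrow> nat \<Rightarrow> nat \<Rightarrow> 'w \<Rightarrow> nat \<Rightarrow> nat" where
  "loss_counts \<delta> r n \<omega> = (\<lambda>a. if a < r then card {i. i < n \<and> scaled_loss n i \<omega> \<in> log_cell \<delta> a} else 0)"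

text \<open>All exponentials are divided by the same positive sum S, so normalising commutes with
  sorting, and the zero-padded rearrangement still has sum S.\<close>

lemma attention_weights_eq:
  "(\<lambda>j. if j < k \<and> j < n then desc_stat (map (A_weight (\<beta> n) n freq q (\<lambda>i. X i \<omega>)) [1..<n+1]) j else 0)
    = norm_weights k (\<lambda>j. sorted_loss_weights n j \<omega>)"
proof -
  define xs where "xs = map (\<lambda>i. raw_weight n i \<omega>) [0..<n]"
  define S where "S = (\<Sum>i<n. raw_weight n i \<omega>)"
  have "(\<lambda>j. (\<lambda>x. x) (sorted_weights xs j)) sums (\<Sum>i<length xs. (\<lambda>x. x) (xs ! i))" by (rule sorted_weights_sums) simp
  then have S: "suminf (sorted_weights xs) = S" by (simp add: sums_iff S_def xs_def)
  have raw: "raw_weight n i \<omega> = exp (- \<beta> n * U_val freq q (\<lambda>i. X i \<omega>) (int (Suc i)))" if "i < n" for i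
    using that by (simp add: raw_weight_def scaled_loss_def loss_def)
  have "map (A_weight (\<beta> n) n freq q (\<lambda>i. X i \<omega>)) [1..<n+1] = map (A_weight (\<beta> n) n freq q (\<lambda>i. X i \<omega>) \<circ> Suc) [0..<n]"
    using map_Suc_upt[of 0 n] by (simp flip: map_map)
  also have "\<dots> = map (\<lambda>i. raw_weight n i \<omega> / S) [0..<n]"
  proof (rule map_cong)
    fix i assume "i \<in> set [0..<n]"
    moreover have "(\<Sum>j=1..n. exp (- \<beta> n * U_val freq q (\<lambda>i. X i \<omega>) (int j))) = S"
      unfolding S_def sum.atLeast1_atMost_eq One_nat_def using raw by simp
    ultimately show "(A_weight (\<beta> n) n freq q (\<lambda>i. X i \<omega>) \<circ> Suc) i = raw_weight n i \<omega> / S"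
      using raw by (simp add: A_weight_def)
  qed simp
  also have "\<dots> = map (\<lambda>x. x / S) xs" by (simp add: xs_def)
  finally have A: "map (A_weight (\<beta> n) n freq q (\<lambda>i. X i \<omega>)) [1..<n+1] = map (\<lambda>x. x / S) xs" .
  have len: "length xs = n" by (simp add: xs_def)
  have "(if j < k \<and> j < n then desc_stat (map (\<lambda>x. x / S) xs) j else 0) = norm_weights k (sorted_weights xs) j" for j
  proof (cases "j < n")
    case True
    have "S > 0" unfolding S_def using True by (intro sum_pos) (auto simp: raw_weight_def)
    then show ?thesis using True desc_stat_divide[of S j xs] len by (simp add: norm_weights_def S) (simp add: sorted_weights_def len)
  next
    case False
    then show ?thesis by (simp add: norm_weights_def sorted_weights_def len)
  qed
  then show ?thesis unfolding A sorted_loss_weights_def xs_def[symmetric] by (simp add: fun_eq_iff)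
qed

lemma sorted_loss_weights_cell_counts: "cell_counts \<delta> r (\<lambda>j. sorted_loss_weights n j \<omega>) = loss_counts \<delta> r n \<omega>"
proof -
  have "card {j. sorted_loss_weights n j \<omega> \<in> cell \<delta> a} = card {i. i < n \<and> scaled_loss n i \<omega> \<in> log_cell \<delta> a}" for a
  proof -
    have z: "0 \<notin> cell \<delta> a" by (simp add: cell_def not_le)
    have "{i. i < length (map (\<lambda>i. raw_weight n i \<omega>) [0..<n]) \<and> map (\<lambda>i. raw_weight n i \<omega>) [0..<n] ! i \<in> cell \<delta> a} = {i. i < n \<and> scaled_loss n i \<omega> \<in> log_cell \<delta> a}"
      by (auto simp: raw_weight_def exp_in_cell)
    then show ?thesis unfolding sorted_loss_weights_def sorted_weights_card[OF z] by simp
  qed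
  then show ?thesis by (auto simp: fun_eq_iff cell_counts_def loss_counts_def)
qed

lemma loss_counts_measurable: "loss_counts \<delta> r n \<in> measurable M (count_space {c. \<forall>a\<ge>r. c a = 0})"
proof (rule measurable_count_vector)
  fix a assume "a < r"
  have "card {i. i < n \<and> scaled_loss n i \<omega> \<in> log_cell \<delta> a} = (\<Sum>i<n. if scaled_loss n i \<omega> \<in> log_cell \<delta> a then 1 else 0)" for \<omega>
  proof -
    have "{i. i < n \<and> scaled_loss n i \<omega> \<in> log_cell \<delta> a} = {i\<in>{..<n}. scaled_loss n i \<omega> \<in> log_cell \<delta> a}" by auto
    then have "card {i. i < n \<and> scaled_loss n i \<omega> \<in> log_cell \<delta> a} = (\<Sum>i\<in>{i\<in>{..<n}. scaled_loss n i \<omega> \<in> log_cell \<delta> a}. 1)" by simp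
    also have "\<dots> = (\<Sum>i<n. if scaled_loss n i \<omega> \<in> log_cell \<delta> a then 1 else 0)" by (rule sum.inter_filter) simp
    finally show ?thesis .
  qed
  then have "(\<lambda>\<omega>. loss_counts \<delta> r n \<omega> a) = (\<lambda>\<omega>. \<Sum>i<n. if scaled_loss n i \<omega> \<in> log_cell \<delta> a then 1 else 0)"
    using \<open>a < r\<close> by (simp add: loss_counts_def)
  then show "(\<lambda>\<omega>. loss_counts \<delta> r n \<omega> a) \<in> measurable M (count_space UNIV)" by simp
qed (simp add: loss_counts_def)

lemma loss_counts_limit:
  assumes "\<delta> > 0" "\<forall>a\<ge>r. c a = 0"
  shows "(\<lambda>n. prob {\<omega>\<in>space M. loss_counts \<delta> r n \<omega> = c}) \<longlonglongrightarrow> (\<Prod>a<r. poisson_weight (lam (\<delta> * real a) - lam (\<delta> * (real a - 1))) (c a))"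
proof -
  have "{\<omega>\<in>space M. loss_counts \<delta> r n \<omega> = c} = {\<omega>\<in>space M. \<forall>a<r. card {i. i < n \<and> scaled_loss n i \<omega> \<in> log_cell \<delta> a} = c a}" for n
    unfolding loss_counts_def using assms(2) by (auto simp: fun_eq_iff)
  then show ?thesis using log_cell_counts_limit[OF assms(1)] by simp
qed

text \<open>The sample instance of the comparison. The tail sum is invariant under rearrangement and
  blind to zeros, so the bound for the unsorted weights carries over.\<close>

lemma sorted_loss_weights_approx:
  fixes f :: "(nat \<Rightarrow> real) \<Rightarrow> real"
  assumes \<beta>: "\<beta> n > 0" and \<delta>: "\<delta> > 0" "\<delta> * (real r - 1) = real K" and \<tau>: "\<tau> \<ge> 0"
    and tail: "(\<integral>\<^sup>+\<omega>. (\<Sum>i. ennreal (raw_weight n i \<omega> * of_bool (raw_weight n i \<omega> < exp (- real K)))) \<partial>M) \<le> ennreal \<tau>"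
    and f: "continuous_on UNIV f" and B: "\<And>z. \<bar>f z\<bar> \<le> B" and L: "L \<ge> 0"
    and mod: "\<And>z z'. (\<And>j. 0 \<le> z j \<and> z j \<le> 1 \<and> 0 \<le> z' j \<and> z' j \<le> 1) \<Longrightarrow> (\<And>j. k \<le> j \<Longrightarrow> z j = 0 \<and> z' j = 0) \<Longrightarrow>
       \<bar>f z - f z'\<bar> \<le> \<epsilon> + L * (\<Sum>j<k. \<bar>z j - z' j\<bar>)"
  shows "\<bar>expectation (\<lambda>\<omega>. f (norm_weights k (\<lambda>j. sorted_loss_weights n j \<omega>))) - expectation (\<lambda>\<omega>. f (count_weights \<delta> r k (loss_counts \<delta> r n \<omega>)))\<bar>
    \<le> \<epsilon> + L * real k * (2 * \<delta> + prob {\<omega>\<in>space M. card {i. i < n \<and> scaled_loss n i \<omega> \<in> {..b}} = 0} + 2 * exp b * \<tau>)"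
proof -
  let ?xs = "\<lambda>\<omega>. map (\<lambda>i. raw_weight n i \<omega>) [0..<n]"
  have unit: "set (?xs \<omega>) \<subseteq> {0..1}" if "\<omega> \<in> space M" for \<omega> using raw_weight_unit[OF \<beta> that] by auto
  have wm: "sorted_loss_weights n j \<in> borel_measurable M" for j
    unfolding sorted_loss_weights_def by (rule measurable_sorted_weights[OF raw_weight_measurable raw_weight_unit[OF \<beta>]])
  have AEw: "AE \<omega> in M. (\<forall>i. 0 \<le> sorted_loss_weights n i \<omega> \<and> sorted_loss_weights n i \<omega> \<le> 1) \<and> (\<forall>i j. i \<le> j \<longrightarrow> sorted_loss_weights n j \<omega> \<le> sorted_loss_weights n i \<omega>)
      \<and> summable (\<lambda>i. sorted_loss_weights n i \<omega>)"
  proof (rule AE_I2)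
    fix \<omega> assume \<omega>: "\<omega> \<in> space M"
    have "summable (\<lambda>i. sorted_loss_weights n i \<omega>)"
      unfolding sorted_loss_weights_def using sorted_weights_sums[of "\<lambda>x. x" "?xs \<omega>"] by (simp add: sums_iff)
    then show "(\<forall>i. 0 \<le> sorted_loss_weights n i \<omega> \<and> sorted_loss_weights n i \<omega> \<le> 1) \<and> (\<forall>i j. i \<le> j \<longrightarrow> sorted_loss_weights n j \<omega> \<le> sorted_loss_weights n i \<omega>)
      \<and> summable (\<lambda>i. sorted_loss_weights n i \<omega>)"
      using sorted_weights_unit[OF unit[OF \<omega>]] sorted_weights_antimono[OF unit[OF \<omega>]] unfolding sorted_loss_weights_def by blast
  qed
  have Cm: "(\<lambda>\<omega>. cell_counts \<delta> r (\<lambda>i. sorted_loss_weights n i \<omega>)) \<in> measurable M (count_space {c. \<forall>a\<ge>r. c a = 0})"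
    unfolding sorted_loss_weights_cell_counts using loss_counts_measurable by simp
  have tl: "(\<integral>\<^sup>+\<omega>. (\<Sum>i. ennreal (sorted_loss_weights n i \<omega> * of_bool (sorted_loss_weights n i \<omega> < exp (- real K)))) \<partial>M) \<le> ennreal \<tau>"
  proof (rule order_trans[OF eq_refl tail], rule nn_integral_cong)
    fix \<omega> assume \<omega>: "\<omega> \<in> space M"
    let ?h = "\<lambda>x. x * of_bool (x < exp (- real K))"
    have "(\<lambda>i. ?h (sorted_weights (?xs \<omega>) i)) sums (\<Sum>i<length (?xs \<omega>). ?h (?xs \<omega> ! i))"
      by (rule sorted_weights_sums) simp
    also have "(\<Sum>i<length (?xs \<omega>). ?h (?xs \<omega> ! i)) = (\<Sum>i<n. ?h (raw_weight n i \<omega>))" by simp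
    finally have 1: "(\<lambda>i. ?h (sorted_loss_weights n i \<omega>)) sums (\<Sum>i<n. ?h (raw_weight n i \<omega>))" unfolding sorted_loss_weights_def .
    have 2: "(\<lambda>i. ?h (raw_weight n i \<omega>)) sums (\<Sum>i<n. ?h (raw_weight n i \<omega>))"
      by (rule sums_finite) (auto simp: raw_weight_def)
    have n1: "0 \<le> ?h (sorted_loss_weights n i \<omega>)" for i
      using sorted_weights_unit[OF unit[OF \<omega>], of i] unfolding sorted_loss_weights_def by simp
    have n2: "0 \<le> ?h (raw_weight n i \<omega>)" for i using raw_weight_unit[OF \<beta> \<omega>, of i] by simp
    show "(\<Sum>i. ennreal (?h (sorted_loss_weights n i \<omega>))) = (\<Sum>i. ennreal (?h (raw_weight n i \<omega>)))"
      by (rule trans[OF suminf_ennreal_eq[OF n1 1] suminf_ennreal_eq[OF n2 2, symmetric]])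
  qed
  have P0: "{\<omega>\<in>space M. sorted_loss_weights n 0 \<omega> < exp (- b)} \<subseteq> {\<omega>\<in>space M. card {i. i < n \<and> scaled_loss n i \<omega> \<in> {..b}} = 0}"
  proof safe
    fix \<omega> assume \<omega>: "\<omega> \<in> space M" "sorted_loss_weights n 0 \<omega> < exp (- b)"
    have "sorted_loss_weights n j \<omega> < exp (- b)" for j
      using sorted_weights_antimono[OF unit[OF \<omega>(1)], of 0 j] \<omega>(2) unfolding sorted_loss_weights_def by simp
    then have "{j. sorted_weights (?xs \<omega>) j \<in> {exp (- b)..}} = {}" unfolding sorted_loss_weights_def by (auto simp: not_le)
    then have "card {j. sorted_weights (?xs \<omega>) j \<in> {exp (- b)..}} = 0" by (simp only: card.empty)
    moreover have "card {j. sorted_weights (?xs \<omega>) j \<in> {exp (- b)..}} = card {i. i < length (?xs \<omega>) \<and> ?xs \<omega> ! i \<in> {exp (- b)..}}"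
      by (rule sorted_weights_card) (simp add: not_le)
    moreover have "{i. i < length (?xs \<omega>) \<and> ?xs \<omega> ! i \<in> {exp (- b)..}} = {i. i < n \<and> scaled_loss n i \<omega> \<in> {..b}}"
      by (auto simp: raw_weight_def)
    ultimately show "card {i. i < n \<and> scaled_loss n i \<omega> \<in> {..b}} = 0" by (simp only:)
  qed
  have "{\<omega>\<in>space M. card {i. i < n \<and> scaled_loss n i \<omega> \<in> {..b}} = 0} = {\<omega>\<in>space M. \<forall>i\<in>{..<n}. b < scaled_loss n i \<omega>}"
    by (auto simp: card_eq_0_iff not_le)
  then have P0m: "{\<omega>\<in>space M. card {i. i < n \<and> scaled_loss n i \<omega> \<in> {..b}} = 0} \<in> sets M" by simp
  have "\<bar>expectation (\<lambda>\<omega>. f (norm_weights k (\<lambda>j. sorted_loss_weights n j \<omega>))) - expectation (\<lambda>\<omega>. f (count_weights \<delta> r k (cell_counts \<delta> r (\<lambda>j. sorted_loss_weights n j \<omega>))))\<bar>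
    \<le> \<epsilon> + L * real k * (2 * \<delta> + prob {\<omega>\<in>space M. sorted_loss_weights n 0 \<omega> < exp (- b)} + 2 * exp b * \<tau>)"
    by (rule expectation_norm_weights_approx[OF wm AEw Cm \<delta> \<tau> tl f B L mod])
  also have "\<dots> \<le> \<epsilon> + L * real k * (2 * \<delta> + prob {\<omega>\<in>space M. card {i. i < n \<and> scaled_loss n i \<omega> \<in> {..b}} = 0} + 2 * exp b * \<tau>)"
    using finite_measure_mono[OF P0 P0m] L by (intro add_left_mono mult_left_mono add_right_mono) auto
  finally show ?thesis unfolding sorted_loss_weights_cell_counts .
qed

text \<open>The value T is attained by \<open>lam\<close> at \<gamma> * (T / Cbar) powr (1 / pexp).
  This rests on \<open>Cbar\<close> being positive, hence on the positivity of \<rho> along the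
  orbit.\<close>

lemma lam_unbounded: "\<exists>b\<ge>0. a * exp (- lam b) < \<eta>" if "\<eta> > 0"
proof -
  have "((\<lambda>T. a * exp (- T)) \<longlongrightarrow> a * 0) at_top"
    by (intro tendsto_mult_left filterlim_compose[OF exp_at_bot filterlim_uminus_at_bot_at_top])
  then have "eventually (\<lambda>T. a * exp (- T) < \<eta>) at_top" by (rule order_tendstoD(2)) (use that in simp)
  then obtain T0 where T0: "\<And>T. T \<ge> T0 \<Longrightarrow> a * exp (- T) < \<eta>" by (auto simp: eventually_at_top_linorder)
  define T where "T = max T0 1"
  have T: "a * exp (- T) < \<eta>" "T > 0" using T0[of T] by (auto simp: T_def)
  define b where "b = \<gamma> * (T / Cbar freq q \<rho>) powr (1 / pexp)"
  have "b > 0" using gamma_pos T Cbar_pos by (simp add: b_def)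
  moreover have "lam b = T"
    using \<open>b > 0\<close> gamma_pos T Cbar_pos pexp_pos by (simp add: lam_def intensity_def max_def) (simp add: b_def powr_powr)
  ultimately show ?thesis using T by (intro exI[of _ b]) auto
qed

end

lemma image_in_closure:
  fixes f :: "'a \<Rightarrow> real"
  assumes z: "\<And>i. z i \<in> S"
  shows "f (z (i::nat)) \<in> closure (f ` S)"
  using z closure_subset by blast

section \<open>Convergence of the ordered weights\<close>

theorem mainTheorem19:
  fixes q :: "real^2^'l::finite"
    and freq :: "'l \<Rightarrow> real"
    and M :: "'w measure"
    and X :: "int \<Rightarrow> 'w \<Rightarrow> real^2^'l"
    and m :: nat
    and \<rho> :: "real^2^'l \<Rightarrow> real"
    and \<beta> :: "nat \<Rightarrow> real"
    and \<gamma> :: real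
    and N :: "'v measure"
    and Y :: "nat \<Rightarrow> 'v \<Rightarrow> real"
    and k :: nat
  assumes q_sphere: "q \<in> sphere 0 1"
    and prob: "prob_space M"
    and X_meas: "\<And>i. X i \<in> borel_measurable M"
    and X_sphere: "\<And>i \<omega>. \<omega> \<in> space M \<Longrightarrow> X i \<omega> \<in> sphere 0 1"
    and stationary: "\<And>(s::int) (J::int set). finite J \<Longrightarrow>
          distr M (PiM J (\<lambda>_. borel)) (\<lambda>\<omega>. \<lambda>j\<in>J. X (j + s) \<omega>)
        = distr M (PiM J (\<lambda>_. borel)) (\<lambda>\<omega>. \<lambda>j\<in>J. X j \<omega>)"
    and m_dependent: "\<And>n::int. prob_space.indep_var M
          (PiM {..n} (\<lambda>_. borel)) (\<lambda>\<omega>. \<lambda>i\<in>{..n}. X i \<omega>)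
          (PiM {n + int m + 1..} (\<lambda>_. borel)) (\<lambda>\<omega>. \<lambda>i\<in>{n + int m + 1..}. X i \<omega>)"
    and rho_meas: "\<rho> \<in> borel_measurable borel"
    and rho_nonneg: "\<And>x. x \<in> sphere 0 1 \<Longrightarrow> \<rho> x \<ge> 0"
    and density_X: "\<And>i. distr M borel (X i) = density sphere_measure (\<lambda>x. ennreal (\<rho> x))"
    and rho_cont_pos: "\<exists>U. open U \<and> orbit_closure freq q \<subseteq> U \<and>
          continuous_on (U \<inter> sphere 0 1) \<rho> \<and> (\<forall>x\<in>U \<inter> sphere 0 1. \<rho> x > 0)"
    and pair_density: "\<And>l::nat. 1 \<le> l \<Longrightarrow> l \<le> m \<Longrightarrow>
          \<exists>f. f \<in> borel_measurable (sphere_measure \<Otimes>\<^sub>M sphere_measure) \<and>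
            distr M (borel \<Otimes>\<^sub>M borel) (\<lambda>\<omega>. (X 0 \<omega>, X (int l) \<omega>))
              = density (sphere_measure \<Otimes>\<^sub>M sphere_measure) f \<and>
            (\<exists>U B. open U \<and> orbit_closure freq q \<times> orbit_closure freq q \<subseteq> U \<and>
               (\<forall>z\<in>U \<inter> (sphere 0 1 \<times> sphere 0 1). f z \<le> ennreal B))"
    and beta_lim: "(\<lambda>n. \<beta> n * real n powr (- alphaR TYPE('l))) \<longlonglongrightarrow> \<gamma>"
    and gamma_pos: "0 < \<gamma>"
    and PPP: "poisson_pp_atoms N Y
          (interval_measure (\<lambda>y. Cbar freq q \<rho> * (max y 0 / \<gamma>) powr (1 / alphaR TYPE('l))))"
    and atoms_ordered: "\<And>\<omega>. \<omega> \<in> space N \<Longrightarrow> 0 < Y 0 \<omega> \<and> strict_mono (\<lambda>i. Y i \<omega>)"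
    and k_pos: "1 \<le> k"
  shows "conv_distr M
           (\<lambda>n \<omega>. (\<lambda>j::nat. if j < k \<and> j < n then
                 desc_stat (map (A_weight (\<beta> n) n freq q (\<lambda>i. X i \<omega>)) [1..<n+1]) j else 0))
           N
           (\<lambda>\<omega>. (\<lambda>j::nat. if j < k then
                 exp (- Y j \<omega>) / (\<Sum>i. exp (- Y i \<omega>)) else 0))"
proof -
  interpret rope_setup M q freq X m \<rho> \<beta> \<gamma>
    by (rule rope_setup.intro[OF probability.intro[OF prob] rope_setup_axioms.intro[OF q_sphere X_meas X_sphere stationary m_dependent
          rho_meas rho_nonneg density_X rho_cont_pos pair_density beta_lim gamma_pos]])
  have Lam: "(\<lambda>y. Cbar freq q \<rho> * (max y 0 / \<gamma>) powr (1 / alphaR TYPE('l))) = intensity (Cbar freq q \<rho>) \<gamma> pexp"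
    by (simp add: fun_eq_iff intensity_def pexp_def)
  note ppp = PPP[unfolded Lam]
  have N: "prob_space N" using PPP by (simp add: poisson_pp_atoms_def)
  have c0: "Cbar freq q \<rho> \<ge> 0" using Cbar_pos by simp
  have W: "(\<lambda>j. if j < k then exp (- Y j \<omega>) / (\<Sum>i. exp (- Y i \<omega>)) else 0) = norm_weights k (\<lambda>i. exp (- Y i \<omega>))" for \<omega>
    by (simp only: norm_weights_def)
  show ?thesis unfolding conv_distr_def attention_weights_eq W
  proof (intro allI impI)
    fix f :: "(nat \<Rightarrow> real) \<Rightarrow> real" assume "continuous_on UNIV f \<and> bounded (range f)"
    then have f: "continuous_on UNIV f" and "bounded (range f)" by auto
    then obtain B where B: "\<And>z. \<bar>f z\<bar> \<le> B" unfolding bounded_iff by auto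
    let ?A = "\<lambda>n. expectation (\<lambda>\<omega>. f (norm_weights k (\<lambda>j. sorted_loss_weights n j \<omega>)))"
    let ?W = "\<integral>\<omega>. f (norm_weights k (\<lambda>i. exp (- Y i \<omega>))) \<partial>N"
    show "?A \<longlonglongrightarrow> ?W"
    proof (rule LIMSEQ_I)
      fix \<epsilon> :: real assume "\<epsilon> > 0"
      \<comment> \<open>Each comparison with rounded weights has four error terms below or equal to
        \<eta>, one on each side of the limit, and the convergence of counts adds one more \<eta>: 9
        * \<eta> in total.\<close>
      define \<eta> where "\<eta> = \<epsilon> / 16"
      have \<eta>: "\<eta> > 0" "16 * \<eta> = \<epsilon>" using \<open>\<epsilon> > 0\<close> by (auto simp: \<eta>_def)
      obtain L where L: "L \<ge> 0" and mod: "\<And>z z'. (\<And>j. 0 \<le> z j \<and> z j \<le> 1 \<and> 0 \<le> z' j \<and> z' j \<le> 1) \<Longrightarrow> (\<And>j. k \<le> j \<Longrightarrow> z j = 0 \<and> z' j = 0) \<Longrightarrow>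
          \<bar>f z - f z'\<bar> \<le> \<eta> + L * (\<Sum>j<k. \<bar>z j - z' j\<bar>)"
        using continuous_modulus_finite_coordinates[OF f B \<eta>(1)] by blast
      define a where "a = L * real k"
      have a0: "a \<ge> 0" using L by (simp add: a_def)
      \<comment> \<open>The order of choices matters. The factor exp b multiplies the tail error, so
        b is fixed first and K is taken large afterwards.\<close>
      obtain b where b: "b \<ge> 0" "a * exp (- lam b) < \<eta>" using lam_unbounded[OF \<eta>(1)] by blast
      obtain D where D: "D \<ge> 0" and Dtail: "\<And>K. eventually (\<lambda>n. (\<integral>\<^sup>+\<omega>. (\<Sum>i. ennreal (raw_weight n i \<omega> * of_bool (raw_weight n i \<omega> < exp (- real K)))) \<partial>M)
          \<le> ennreal (D * tail_const pexp * exp (- real K / 2))) sequentially"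
        using raw_weight_tail by blast
      \<comment> \<open>The constant of the expected counts on the Poisson side; a single K is
        chosen for D + D' and serves both sides.\<close>
      define D' where "D' = Cbar freq q \<rho> * (1 / \<gamma>) powr pexp"
      have D': "D' \<ge> 0" using c0 by (simp add: D'_def)
      have tc: "tail_const pexp \<ge> 0" by (simp add: tail_const_def)
      define E where "E = a * (2 * exp b * ((D + D') * tail_const pexp))"
      obtain s :: nat where s: "real s * \<eta> > a * 2" "s > 0"
      proof -
        obtain s0 :: nat where "a * 2 < real s0 * \<eta>" using reals_Archimedean3[OF \<eta>(1)] by blast
        then show thesis using \<eta>(1) by (intro that[of "Suc s0"]) (auto simp: algebra_simps)
      qed
      define \<delta> where "\<delta> = 1 / real s"
      have \<delta>: "\<delta> > 0" "a * (2 * \<delta>) < \<eta>" using s by (auto simp: \<delta>_def field_simps)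
      obtain K :: nat where K: "E * exp (- real K / 2) < \<eta>"
      proof -
        have "(\<lambda>K. E * exp (- (1/2)) ^ K) \<longlonglongrightarrow> E * 0" by (intro tendsto_mult_left LIMSEQ_realpow_zero) auto
        then have "eventually (\<lambda>K. E * exp (- (1/2)) ^ K < \<eta>) sequentially" by (rule order_tendstoD(2)) (use \<eta> in simp)
        then obtain K where "E * exp (- (1/2)) ^ K < \<eta>" by (auto simp: eventually_sequentially)
        moreover have "exp (- (1/2)) ^ K = exp (- real K / 2)" by (simp add: exp_of_nat_mult[symmetric])
        ultimately show thesis using that by simp
      qed
      \<comment> \<open>With \<delta> = 1 / s this number of cells places the lowest cell boundary
        exactly at the integer threshold K of the tail estimate.\<close>
      define r where "r = K * s + 1"
      have r: "\<delta> * (real r - 1) = real K" using s(2) by (simp add: \<delta>_def r_def)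
      have small: "a * (2 * exp b * (d * tail_const pexp * exp (- real K / 2))) < \<eta>" if "0 \<le> d" "d \<le> D + D'" for d
      proof -
        have "a * (2 * exp b * (d * tail_const pexp * exp (- real K / 2))) \<le> a * (2 * exp b * ((D + D') * tail_const pexp * exp (- real K / 2)))"
          using a0 that tc by (intro mult_left_mono mult_right_mono) auto
        also have "\<dots> = E * exp (- real K / 2)" by (simp add: E_def)
        finally show ?thesis using K by (rule le_less_trans)
      qed
      define h where "h c = f (count_weights \<delta> r k c)" for c
      have hlim: "(\<lambda>n. expectation (\<lambda>\<omega>. h (loss_counts \<delta> r n \<omega>))) \<longlonglongrightarrow> (\<integral>\<omega>. h (cell_counts \<delta> r (\<lambda>i. exp (- Y i \<omega>))) \<partial>N)"
      proof (rule expectation_tendsto_of_pmf_tendsto[OF prob_space_axioms N loss_counts_measurable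
            poisson_pp_cell_counts_measurable[OF ppp c0 gamma_pos pexp_pos \<delta>(1)]])
        fix c :: "nat \<Rightarrow> nat" assume c: "\<forall>a\<ge>r. c a = 0"
        show "(\<lambda>n. prob {\<omega>\<in>space M. loss_counts \<delta> r n \<omega> = c}) \<longlonglongrightarrow> measure N {\<omega>\<in>space N. cell_counts \<delta> r (\<lambda>i. exp (- Y i \<omega>)) = c}"
          unfolding poisson_pp_cell_counts[OF ppp c0 gamma_pos pexp_pos \<delta>(1) c]
          by (rule loss_counts_limit[OF \<delta>(1) c, unfolded lam_def])
      next
        fix c
        show "\<bar>h c\<bar> \<le> B" unfolding h_def by (rule B)
      qed
      have limN: "\<bar>?W - (\<integral>\<omega>. h (cell_counts \<delta> r (\<lambda>i. exp (- Y i \<omega>))) \<partial>N)\<bar> < 4 * \<eta>"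
      proof -
        have "\<bar>?W - (\<integral>\<omega>. h (cell_counts \<delta> r (\<lambda>i. exp (- Y i \<omega>))) \<partial>N)\<bar>
            \<le> \<eta> + a * (2 * \<delta> + exp (- lam b) + 2 * exp b * (D' * tail_const pexp * exp (- real K / 2)))"
          unfolding h_def a_def D'_def lam_def
          by (rule poisson_pp_weights_approx[OF ppp c0 gamma_pos pexp_pos atoms_ordered \<delta>(1) r b(1) f B L mod])
        then show ?thesis using \<delta>(2) b(2) small[of D'] D D' by (simp add: distrib_left)
      qed
      have "(\<lambda>n. a * prob {\<omega>\<in>space M. card {i. i < n \<and> scaled_loss n i \<omega> \<in> {..b}} = 0}) \<longlonglongrightarrow> a * exp (- lam b)"
        by (intro tendsto_mult_left no_small_loss_limit)
      then have "eventually (\<lambda>n. a * prob {\<omega>\<in>space M. card {i. i < n \<and> scaled_loss n i \<omega> \<in> {..b}} = 0} < \<eta>) sequentially"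
        using b(2) by (rule order_tendstoD(2))
      moreover have "eventually (\<lambda>n. \<bar>expectation (\<lambda>\<omega>. h (loss_counts \<delta> r n \<omega>)) - (\<integral>\<omega>. h (cell_counts \<delta> r (\<lambda>i. exp (- Y i \<omega>))) \<partial>N)\<bar> < \<eta>) sequentially"
        using tendstoD[OF hlim \<eta>(1)] by (simp add: dist_real_def)
      ultimately have "eventually (\<lambda>n. norm (?A n - ?W) < \<epsilon>) sequentially"
        using Dtail[of K] beta_pos
      proof eventually_elim
        case (elim n)
        have "\<bar>?A n - expectation (\<lambda>\<omega>. h (loss_counts \<delta> r n \<omega>))\<bar>
            \<le> \<eta> + a * (2 * \<delta> + prob {\<omega>\<in>space M. card {i. i < n \<and> scaled_loss n i \<omega> \<in> {..b}} = 0} + 2 * exp b * (D * tail_const pexp * exp (- real K / 2)))"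
          unfolding h_def a_def
          by (rule sorted_loss_weights_approx[OF elim(4) \<delta>(1) r _ elim(3) f B L mod]) (use D tc in simp)
        then have "\<bar>?A n - expectation (\<lambda>\<omega>. h (loss_counts \<delta> r n \<omega>))\<bar> < 4 * \<eta>"
          using \<delta>(2) elim(1) small[of D] D D' by (simp add: distrib_left)
        then show ?case using limN elim(2) \<eta> unfolding real_norm_def by linarith
      qed
      then show "\<exists>no. \<forall>n\<ge>no. norm (?A n - ?W) < \<epsilon>" by (simp add: eventually_sequentially)
    qed
  qed
qed

end
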